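(* Let $T\in\{DB,BD\}$, let $\omega$ be the type of bisectoriality of $DB$ and $BD$ and let $\nu\in(\omega,\frac{\pi}{2})$. Suppose there exists $r\in\mathcal{I}_{D,B}$ such that $\mathsf{N}_r(T)\ne\{0\}$ and let $f\in H^\infty(\dot S_\nu,\{0\})$ with $f(0)\ne0$. Then for all $p,q\in\mathcal{I}_{D,B}$ such that $p\ne q$, the operator $f(T)$ is not bounded from $\mathsf{N}_p(T)$ to $L^q$. In particular, for all $p,q\in\mathcal{I}_{D,B}$ such that $p\ne q$, the operator $f(T)$ is not bounded from $L^p$ to $L^q$.
   Context: "Not bounded": for Banach spaces $\mathcal{X},\mathcal{Y}$ and a bounded linear operator $S:\mathcal{X}\to\mathcal{X}$, $S$ is not bounded from $\mathcal{X}$ to $\mathcal{Y}$ if there is $u\in\mathcal{X}$ with $Su\notin\mathcal{Y}$, or if there is no constant $C>0$ with $\|Su\|_{\mathcal{Y}}\le C\|u\|_{\mathcal{X}}$ for all $u\in\mathcal{X}$. Here $\mathsf{N}_p(T)$ carries the $L^p$ norm. Let $n,N\in\mathbb{N}^*$ and $L^q:=L^q(\mathbb{R}^n,\mathbb{C}^N)$, $1<q<\infty$. For an unbounded operator $T$ on $L^q$, $\mathsf{D}_q(T)$, $\mathsf{N}_q(T)$, $\mathsf{R}_q(T)$ denote its domain, null space and range, and $\overline{\mathsf{R}_q(T)}$ is the closure of the range in $L^q$. $T$ admits a kernel/range decomposition on $L^q$ if $L^q=\mathsf{N}_q(T)\oplus\overline{\mathsf{R}_q(T)}$ topologically. Bisectors: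 for $\omega\in[0,\pi/2)$, $S_\omega:=\{\lambda\in\mathbb{C}\setminus\{0\}:|\arg\lambda|\le\omega\text{ or }|\arg(-\lambda)|\le\omega\}\cup\{0\}$; for $\nu\in(0,\pi/2)$, $\dot S_\nu:=\{\lambda\in\mathbb{C}\setminus\{0\}:|\arg\lambda|<\nu\text{ or }|\arg(-\lambda)|<\nu\}$. $T$ is bisectorial of type $\omega$ on $L^q$ if it is closed, its spectrum lies in $S_\omega$, and for each $\nu\in(\omega,\pi/2)$ there is $C_\nu$ with $\|(Id+\lambda T)^{-1}\|_{L^q\to L^q}\le C_\nu$ for all $\lambda\in\mathbb{C}\setminus S_\nu$. Functional calculus: for $\sigma,\tau>0$, $\Psi_\sigma^\tau(\dot S_\nu)$ is the set of holomorphic $\psi:\dot S_\nu\to\mathbb{C}$ with $|\psi(\lambda)|\lesssim\frac{|\lambda|^\sigma}{1+|\lambda|^{\sigma+\tau}}$ on $\dot S_\nu$; $\Psi(\dot S_\nu):=\bigcup_{\sigma,\tau>0}\Psi_\sigma^\tau(\dot S_\nu)$, with $\psi(0):=0$. $H^\infty(\dot S_\nu)$ is the set of bounded holomorphic functions on $\dot S_\nu$ with sup norm, and $H^\infty(\dot S_\nu,\{0\})$ the set of bounded functions on $\dot S_\nu\cup\{0\}$ holomorphic on $\dot S_\nu$. For $T$ bisectorial of type $\omega$, $\psi\in\Psi(\dot S_\nu)$, $\nu>\omega$, set $\psi(T):=\frac{1}{2\pi i}\int_{\partial S_\theta}\psi(\lambda)(Id-\lambda^{-1}T)^{-1}\frac{d\lambda}{\lambda}$,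 $\theta\in(\omega,\nu)$, with $\partial S_\theta=\{\pm te^{\pm i\theta}:t>0\}$ oriented counterclockwise surrounding $S_\omega$. $T$ has a bounded holomorphic functional calculus on $L^q$ if for each $\nu\in(\omega,\pi/2)$ there is $C_\nu$ with $\|\psi(T)u\|_{L^q}\le C_\nu\|\psi\|_{H^\infty(\dot S_\nu)}\|u\|_{L^q}$ for all $\psi\in\Psi(\dot S_\nu)$, $u\in L^q$. In that case $f\mapsto f(T)$ extends by a limiting procedure to $f\in H^\infty(\dot S_\nu)$ on $\overline{\mathsf{R}_q(T)}$ (if $\psi_k\in\Psi(\dot S_\nu)$ are uniformly bounded and converge to $f$ locally uniformly, then $f(T)u=\lim\psi_k(T)u$), and for $f\in H^\infty(\dot S_\nu,\{0\})$ one sets $f(T)u:=f(0)u_N+f|_{\dot S_\nu}(T)u_R$, where $u=u_N+u_R$ with $u_N\in\mathsf{N}_q(T)$, $u_R\in\overline{\mathsf{R}_q(T)}$. Off-diagonal estimates: for $1<p\le q<\infty$ and $\mathcal{A}\subset\mathbb{C}\setminus\{0\}$, a family $\{T_\lambda\}_{\lambda\in\mathcal{A}}$ satisfies $L^p-L^q$ off-diagonal estimates of order $K\in[0,\infty)$ if there is $C_{K,p,q}>0$ such that for all Borel sets $E,F\subset\mathbb{R}^n$, all $\lambda\in\mathcal{A}$ and all $u\in L^p$, $\|\chi_ET_\lambda(\chi_Fu)\|_{L^q}\le C_{K,p,q}|\lambda|^{\frac nq-\frac np}\big(1+\frac{d(E,F)}{|\lambda|}\big)^{-K}\|\chi_Fu\|_{L^p}$,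 where $d(E,F)=\inf_{x\in E,y\in F}|x-y|$ and $\chi_E$ is the characteristic function of $E$. Standing assumption on $D$ and $B$: (1) $D=-i\sum_{j=1}^n\hat D_j\partial_j$ with $\hat D_j\in\mathcal{L}(\mathbb{C}^N)$, with its natural domain $\{u\in L^q: Du\in L^q\}$ in $L^q$; (2) there is $\kappa>0$ such that the symbol $\hat D(\xi)=\sum_j\hat D_j\xi_j$ satisfies $\kappa|\xi||e|\le|\hat D(\xi)e|$ for all $\xi\in\mathbb{R}^n$ and all $e$ in the range of $\hat D(\xi)$; (3) there is $\omega_D\in[0,\pi/2)$ with $\sigma(\hat D(\xi))\subset S_{\omega_D}$ for all $\xi$. $B$ is multiplication by a matrix function $B\in L^\infty(\mathbb{R}^n,\mathcal{L}(\mathbb{C}^N))$, and one of the following equivalent conditions holds: (4) $\|Bu\|_{L^2}\gtrsim\|u\|_{L^2}$ for all $u\in\overline{\mathsf{R}_2(D)}$ and $BD$ is bisectorial of some type $\omega\in[0,\pi/2)$ on $L^2$; (5) $\|B^*u\|_{L^2}\gtrsim\|u\|_{L^2}$ for all $u\in\overline{\mathsf{R}_2(D^* )}$ and $DB$ is bisectorial of type $\omega\in[0,\pi/2)$ on $L^2$. This $\omega$ is the type of bisectoriality of both $BD$ and $DB$. In $L^q$, $BD$ has domain $\mathsf{D}_q(D)$ and $DB$ has domain $B^{-1}\mathsf{D}_q(D)=\{u\in L^q:Bu\in\mathsf{D}_q(D)\}$. The interval $\mathcal{I}_{D,B}$: there is an open interval $\mathcal{I}_2\subset(1,\infty)$ containing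 $2$ such that for all $q\in\mathcal{I}_2$ (with $q'=q/(q-1)$) one has $\|Bu\|_{L^q}\ge C\|u\|_{L^q}$ for $u\in\overline{\mathsf{R}_q(D)}$ and $\|B^*u^*\|_{L^{q'}}\ge C\|u^*\|_{L^{q'}}$ for $u^*\in\overline{\mathsf{R}_{q'}(D^* )}$. It is known that there is an open interval $\mathcal{I}_{D,B}=(p_-(D,B),p_+(D,B))\ni2$, maximal in $\mathcal{I}_2$, such that for all $q\in\mathcal{I}_{D,B}$ and $T\in\{BD,DB\}$: $T$ admits a kernel/range decomposition on $L^q$; $T$ is bisectorial of type $\omega$ on $L^q$; $T$ has a bounded holomorphic functional calculus on $L^q$; for each $\nu\in(\omega,\pi/2)$, $\{(Id+\lambda T)^{-1}\}_{\lambda\in\mathbb{C}\setminus S_\nu}$ satisfies $L^q-L^q$ off-diagonal estimates of every order $K\in[0,\infty)$. The functional calculi of $T$ on $L^p$ and $L^q$, $p,q\in\mathcal{I}_{D,B}$, agree on $L^p\cap L^q$. *)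

theory Defs
  imports "HOL-Analysis.Analysis"
begin

section \<open>Classes of measurable functions and the spaces $L^q$\<close>

text \<open>Measurable functions from $\mathbb{R}^n$ to $\mathbb{C}^N$ modulo equality almost everywhere.
  Borel representatives suffice: each Lebesgue measurable function agrees almost everywhere with
  a Borel function. The norm on \<^typ>\<open>complex^'m\<close> is the Euclidean (Hermitian) one.\<close>

definition ae_eq :: "(real^'n \<Rightarrow> complex^'m) \<Rightarrow> (real^'n \<Rightarrow> complex^'m) \<Rightarrow> bool" where
  "ae_eq u v \<longleftrightarrow> u \<in> borel_measurable lborel \<and> v \<in> borel_measurable lborel \<and>
     (AE x in lborel. u x = v x)"

quotient_type ('n, 'm) vfun = "real^'n::finite \<Rightarrow> complex^'m::finite" / partial: ae_eq
proof (rule part_equivpI)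
  show "\<exists>u::real^'n \<Rightarrow> complex^'m. ae_eq u u"
    by (rule exI[of _ "\<lambda>_. 0"]) (simp add: ae_eq_def)
  show "symp (ae_eq :: (real^'n \<Rightarrow> complex^'m) \<Rightarrow> _)"
    by (rule sympI) (auto simp: ae_eq_def)
  show "transp (ae_eq :: (real^'n \<Rightarrow> complex^'m) \<Rightarrow> _)"
    by (rule transpI) (auto simp: ae_eq_def)
qed

lemma borel_measurable_smult [measurable]:
  fixes u :: "'a \<Rightarrow> complex^'m"
  assumes [measurable]: "u \<in> borel_measurable M"
  shows "(\<lambda>x. c *s u x) \<in> borel_measurable M"
proof -
  have "linear (\<lambda>v::complex^'m. c *s v)"
    by (auto simp: linear_iff vec_eq_iff algebra_simps)
  then have "continuous_on UNIV (\<lambda>v::complex^'m. c *s v)"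
    by (simp add: linear_continuous_on linear_conv_bounded_linear)
  then have [measurable]: "(\<lambda>v::complex^'m. c *s v) \<in> borel_measurable borel"
    by (rule borel_measurable_continuous_onI)
  show ?thesis by measurable
qed

instantiation vfun :: (finite, finite) ab_group_add
begin

lift_definition zero_vfun :: "('a, 'b) vfun" is "\<lambda>_. 0"
  by (simp add: ae_eq_def)

lift_definition plus_vfun :: "('a, 'b) vfun \<Rightarrow> ('a, 'b) vfun \<Rightarrow> ('a, 'b) vfun"
  is "\<lambda>u v x. u x + v x"
  by (auto simp: ae_eq_def)

lift_definition minus_vfun :: "('a, 'b) vfun \<Rightarrow> ('a, 'b) vfun \<Rightarrow> ('a, 'b) vfun"
  is "\<lambda>u v x. u x - v x"
  by (auto simp: ae_eq_def)

lift_definition uminus_vfun :: "('a, 'b) vfun \<Rightarrow> ('a, 'b) vfun" is "\<lambda>u x. - u x"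
  by (auto simp: ae_eq_def)

instance
  by standard (transfer; auto simp: ae_eq_def algebra_simps)+

end

lift_definition cscale :: "complex \<Rightarrow> ('n::finite, 'm::finite) vfun \<Rightarrow> ('n, 'm) vfun"
  is "\<lambda>c u x. c *s u x"
  by (auto simp: ae_eq_def)

text \<open>Multiplication operators; meaningful only for Borel measurable \<open>B\<close> and Borel sets \<open>E\<close>.\<close>

definition matmult ::
    "(real^'n \<Rightarrow> complex^'m^'m) \<Rightarrow> ('n::finite, 'm::finite) vfun \<Rightarrow> ('n, 'm) vfun" where
  "matmult B u = abs_vfun (\<lambda>x. B x *v rep_vfun u x)"

definition cutoff :: "(real^'n) set \<Rightarrow> ('n::finite, 'm::finite) vfun \<Rightarrow> ('n, 'm) vfun" where
  "cutoff E u = abs_vfun (\<lambda>x. indicat_real E x *\<^sub>R rep_vfun u x)"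

text \<open>\<open>lpnorm q u\<close> is the norm of \<open>u\<close> only for \<open>u \<in> Lp q\<close>; outside \<open>Lp q\<close> the integral
  defaults to 0, so membership is always stated separately.\<close>

definition Lp :: "real \<Rightarrow> ('n::finite, 'm::finite) vfun set" where
  "Lp q = {u. integrable lborel (\<lambda>x. norm (rep_vfun u x) powr q)}"

definition lpnorm :: "real \<Rightarrow> ('n::finite, 'm::finite) vfun \<Rightarrow> real" where
  "lpnorm q u = (\<integral>x. norm (rep_vfun u x) powr q \<partial>lborel) powr (1 / q)"

definition Lp_lim ::
    "real \<Rightarrow> (nat \<Rightarrow> ('n::finite, 'm::finite) vfun) \<Rightarrow> ('n, 'm) vfun \<Rightarrow> bool" where
  "Lp_lim q us u \<longleftrightarrow> (\<forall>k. us k \<in> Lp q) \<and> u \<in> Lp q \<and> (\<lambda>k. lpnorm q (us k - u)) \<longlonglongrightarrow> 0"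

definition Lp_closure ::
    "real \<Rightarrow> ('n::finite, 'm::finite) vfun set \<Rightarrow> ('n, 'm) vfun set" where
  "Lp_closure q S = {u. \<exists>us. (\<forall>k. us k \<in> S) \<and> Lp_lim q us u}"

definition conj_exp :: "real \<Rightarrow> real" where
  "conj_exp q = q / (q - 1)"

definition pairing :: "('n::finite, 'm::finite) vfun \<Rightarrow> ('n, 'm) vfun \<Rightarrow> complex" where
  "pairing u v = (\<integral>x. (\<Sum>i\<in>UNIV. rep_vfun u x $ i * cnj (rep_vfun v x $ i)) \<partial>lborel)"


section \<open>Unbounded operators\<close>

text \<open>An unbounded operator on $L^q$ is identified with its graph; domain and range are
  \<^const>\<open>Domain\<close> and \<^const>\<open>Range\<close>.\<close>

type_synonym ('n, 'm) graph = "(('n, 'm) vfun \<times> ('n, 'm) vfun) set"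

definition null_space :: "('n::finite, 'm::finite) graph \<Rightarrow> ('n, 'm) vfun set" where
  "null_space T = {u. (u, 0) \<in> T}"

definition closed_op :: "real \<Rightarrow> ('n::finite, 'm::finite) graph \<Rightarrow> bool" where
  "closed_op q T \<longleftrightarrow>
     (\<forall>us ws u w. (\<forall>k. (us k, ws k) \<in> T) \<longrightarrow> Lp_lim q us u \<longrightarrow> Lp_lim q ws w \<longrightarrow> (u, w) \<in> T)"

text \<open>\<open>op_affine a b T\<close> is $a\,Id + b\,T$ with the domain of $T$.\<close>

definition op_affine ::
    "complex \<Rightarrow> complex \<Rightarrow> ('n::finite, 'm::finite) graph \<Rightarrow> ('n, 'm) graph" where
  "op_affine a b T = {(u, cscale a u + cscale b w) | u w. (u, w) \<in> T}"

definition boundedly_invertible :: "real \<Rightarrow> ('n::finite, 'm::finite) graph \<Rightarrow> bool" where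
  "boundedly_invertible q A \<longleftrightarrow> (\<forall>v\<in>Lp q. \<exists>!u. (u, v) \<in> A) \<and>
     (\<exists>C. \<forall>(u, v)\<in>A. lpnorm q u \<le> C * lpnorm q v)"

definition op_inv :: "('n::finite, 'm::finite) graph \<Rightarrow> ('n, 'm) vfun \<Rightarrow> ('n, 'm) vfun" where
  "op_inv A v = (THE u. (u, v) \<in> A)"

definition op_spectrum :: "real \<Rightarrow> ('n::finite, 'm::finite) graph \<Rightarrow> complex set" where
  "op_spectrum q T = {z. \<not> boundedly_invertible q (op_affine z (-1) T)}"

text \<open>\<open>resolvent_op T z\<close> is $(Id + zT)^{-1}$.\<close>

definition resolvent_op ::
    "('n::finite, 'm::finite) graph \<Rightarrow> complex \<Rightarrow> ('n, 'm) vfun \<Rightarrow> ('n, 'm) vfun" where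
  "resolvent_op T z = op_inv (op_affine 1 z T)"

text \<open>The adjoint, on $L^{q'}$, of an operator on $L^q$, for the sesquilinear duality
  between $L^q$ and $L^{q'}$ (the Hilbert space adjoint if $q = 2$).\<close>

definition adjoint_op :: "real \<Rightarrow> ('n::finite, 'm::finite) graph \<Rightarrow> ('n, 'm) graph" where
  "adjoint_op q T = {(v, z). v \<in> Lp (conj_exp q) \<and> z \<in> Lp (conj_exp q) \<and>
     (\<forall>(u, w)\<in>T. pairing w v = pairing u z)}"

definition kernel_range_decomposition ::
    "real \<Rightarrow> ('n::finite, 'm::finite) graph \<Rightarrow> bool" where
  "kernel_range_decomposition q T \<longleftrightarrow>
     (\<forall>u\<in>Lp q. \<exists>!(a, b). a \<in> null_space T \<and> b \<in> Lp_closure q (Range T) \<and> u = a + b) \<and>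
     (\<exists>C. \<forall>a\<in>null_space T. \<forall>b\<in>Lp_closure q (Range T).
        lpnorm q a \<le> C * lpnorm q (a + b) \<and> lpnorm q b \<le> C * lpnorm q (a + b))"


section \<open>Bisectorial operators and functional calculus\<close>

definition bisector :: "real \<Rightarrow> complex set" where
  "bisector w = insert 0 {z. z \<noteq> 0 \<and> (\<bar>Arg z\<bar> \<le> w \<or> \<bar>Arg (- z)\<bar> \<le> w)}"

definition open_bisector :: "real \<Rightarrow> complex set" where
  "open_bisector v = {z. z \<noteq> 0 \<and> (\<bar>Arg z\<bar> < v \<or> \<bar>Arg (- z)\<bar> < v)}"

definition bisectorial :: "real \<Rightarrow> ('n::finite, 'm::finite) graph \<Rightarrow> real \<Rightarrow> bool" where
  "bisectorial q T \<omega> \<longleftrightarrow> closed_op q T \<and> op_spectrum q T \<subseteq> bisector \<omega> \<and>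
     (\<forall>\<nu>. \<omega> < \<nu> \<and> \<nu> < pi / 2 \<longrightarrow>
        (\<exists>C. \<forall>z. z \<notin> bisector \<nu> \<longrightarrow>
           (\<forall>u\<in>Lp q. lpnorm q (resolvent_op T z u) \<le> C * lpnorm q u)))"

definition Psi_class :: "real \<Rightarrow> real \<Rightarrow> real \<Rightarrow> (complex \<Rightarrow> complex) set" where
  "Psi_class \<nu> \<sigma> \<tau> = {\<psi>. \<psi> holomorphic_on open_bisector \<nu> \<and> \<psi> 0 = 0 \<and>
     (\<exists>C. \<forall>z\<in>open_bisector \<nu>.
        cmod (\<psi> z) \<le> C * (cmod z powr \<sigma> / (1 + cmod z powr (\<sigma> + \<tau>))))}"

definition Psi :: "real \<Rightarrow> (complex \<Rightarrow> complex) set" where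
  "Psi \<nu> = (\<Union>\<sigma>\<in>{0<..}. \<Union>\<tau>\<in>{0<..}. Psi_class \<nu> \<sigma> \<tau>)"

definition Hinf_norm :: "real \<Rightarrow> (complex \<Rightarrow> complex) \<Rightarrow> real" where
  "Hinf_norm \<nu> f = (SUP z\<in>open_bisector \<nu>. cmod (f z))"

definition Hinf0 :: "real \<Rightarrow> (complex \<Rightarrow> complex) set" where
  "Hinf0 \<nu> = {f. f holomorphic_on open_bisector \<nu> \<and> bounded (f ` (open_bisector \<nu> \<union> {0}))}"

text \<open>Bochner integral of an $L^q$-valued function, following the library's
  \<^const>\<open>has_bochner_integral\<close>, which is only available for functions into a Banach space
  that is a type.\<close>

definition Lp_simple ::
    "real \<Rightarrow> 'a measure \<Rightarrow> ('a \<Rightarrow> ('n::finite, 'm::finite) vfun) \<Rightarrow> bool" where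
  "Lp_simple q M s \<longleftrightarrow> finite (s ` space M) \<and> s ` space M \<subseteq> Lp q \<and>
     (\<forall>y. {t \<in> space M. s t = y} \<in> sets M) \<and>
     (\<forall>y. y \<noteq> 0 \<longrightarrow> emeasure M {t \<in> space M. s t = y} < \<infinity>)"

definition Lp_simple_integral ::
    "'a measure \<Rightarrow> ('a \<Rightarrow> ('n::finite, 'm::finite) vfun) \<Rightarrow> ('n, 'm) vfun" where
  "Lp_simple_integral M s =
     (\<Sum>y\<in>s ` space M. cscale (of_real (measure M {t \<in> space M. s t = y})) y)"

definition has_Lp_integral ::
    "real \<Rightarrow> 'a measure \<Rightarrow> ('a \<Rightarrow> ('n::finite, 'm::finite) vfun) \<Rightarrow> ('n, 'm) vfun \<Rightarrow> bool" where
  "has_Lp_integral q M F w \<longleftrightarrow> (\<forall>t\<in>space M. F t \<in> Lp q) \<and>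
     (\<exists>s. (\<forall>i. Lp_simple q M (s i)) \<and>
          (\<forall>i. (\<lambda>t. lpnorm q (F t - s i t)) \<in> borel_measurable M) \<and>
          (\<lambda>i. \<integral>\<^sup>+t. ennreal (lpnorm q (F t - s i t)) \<partial>M) \<longlonglongrightarrow> 0 \<and>
          Lp_lim q (\<lambda>i. Lp_simple_integral M (s i)) w)"

text \<open>On each of the four rays of the boundary of the bisector of angle \<open>\<theta>\<close> one has
  $d\lambda/\lambda = dt/t$. Counterclockwise orientation means that the rays through
  $e^{-i\theta}$ and $-e^{-i\theta}$ are traversed from $0$ to $\infty$, and the rays through
  $e^{i\theta}$ and $-e^{i\theta}$ from $\infty$ to $0$.\<close>

definition psi_integrand ::
    "('n::finite, 'm::finite) graph \<Rightarrow> (complex \<Rightarrow> complex) \<Rightarrow> ('n, 'm) vfun \<Rightarrow> real \<Rightarrow> real \<Rightarrow>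
     ('n, 'm) vfun" where
  "psi_integrand T \<psi> u \<theta> t =
     (let h = (\<lambda>z. cscale (\<psi> z) (resolvent_op T (- inverse z) u))
      in cscale (of_real (1 / t))
           (h (of_real t * cis (- \<theta>)) - h (of_real t * cis \<theta>)
            + h (- (of_real t * cis (- \<theta>))) - h (- (of_real t * cis \<theta>))))"

text \<open>The value does not depend on \<open>\<theta>\<close>, by Cauchy's theorem.\<close>

definition psi_calc ::
    "real \<Rightarrow> ('n::finite, 'm::finite) graph \<Rightarrow> real \<Rightarrow> real \<Rightarrow> (complex \<Rightarrow> complex) \<Rightarrow>
     ('n, 'm) vfun \<Rightarrow> ('n, 'm) vfun" where
  "psi_calc q T \<omega> \<nu> \<psi> u =
     cscale (1 / (2 * of_real pi * \<i>))
       (THE w. \<forall>\<theta>. \<omega> < \<theta> \<and> \<theta> < \<nu> \<longrightarrow>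
          has_Lp_integral q (restrict_space lborel {0<..}) (psi_integrand T \<psi> u \<theta>) w)"

definition bounded_Hinf_calculus ::
    "real \<Rightarrow> ('n::finite, 'm::finite) graph \<Rightarrow> real \<Rightarrow> bool" where
  "bounded_Hinf_calculus q T \<omega> \<longleftrightarrow>
     (\<forall>\<nu>. \<omega> < \<nu> \<and> \<nu> < pi / 2 \<longrightarrow>
        (\<exists>C. \<forall>\<psi>\<in>Psi \<nu>. \<forall>u\<in>Lp q.
           lpnorm q (psi_calc q T \<omega> \<nu> \<psi> u) \<le> C * Hinf_norm \<nu> \<psi> * lpnorm q u))"

text \<open>\<open>f(T)u\<close> for bounded holomorphic \<open>f\<close> and \<open>u\<close> in the closure of the range: the common
  limit of \<open>\<psi>\<^sub>k(T)u\<close> along all uniformly bounded sequences \<open>\<psi>\<^sub>k\<close> in \<^const>\<open>Psi\<close> converging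
  to \<open>f\<close> locally uniformly.\<close>

definition Hinf_calc ::
    "real \<Rightarrow> ('n::finite, 'm::finite) graph \<Rightarrow> real \<Rightarrow> real \<Rightarrow> (complex \<Rightarrow> complex) \<Rightarrow>
     ('n, 'm) vfun \<Rightarrow> ('n, 'm) vfun" where
  "Hinf_calc q T \<omega> \<nu> f u =
     (THE w. \<forall>\<psi>. (\<forall>k. \<psi> k \<in> Psi \<nu>) \<longrightarrow>
        (\<exists>M. \<forall>k::nat. \<forall>z\<in>open_bisector \<nu>. cmod (\<psi> k z) \<le> M) \<longrightarrow>
        (\<forall>K. compact K \<and> K \<subseteq> open_bisector \<nu> \<longrightarrow> uniform_limit K \<psi> f sequentially) \<longrightarrow>
        Lp_lim q (\<lambda>k. psi_calc q T \<omega> \<nu> (\<psi> k) u) w)"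

definition Hinf0_calc ::
    "real \<Rightarrow> ('n::finite, 'm::finite) graph \<Rightarrow> real \<Rightarrow> real \<Rightarrow> (complex \<Rightarrow> complex) \<Rightarrow>
     ('n, 'm) vfun \<Rightarrow> ('n, 'm) vfun" where
  "Hinf0_calc q T \<omega> \<nu> f u =
     (case THE (a, b). a \<in> null_space T \<and> b \<in> Lp_closure q (Range T) \<and> u = a + b of
        (a, b) \<Rightarrow> cscale (f 0) a + Hinf_calc q T \<omega> \<nu> f b)"

definition off_diagonal ::
    "real \<Rightarrow> real \<Rightarrow> real \<Rightarrow> complex set \<Rightarrow>
     (complex \<Rightarrow> ('n::finite, 'm::finite) vfun \<Rightarrow> ('n, 'm) vfun) \<Rightarrow> bool" where
  "off_diagonal p q K A S \<longleftrightarrow>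
     (\<exists>C>0. \<forall>E\<in>sets borel. \<forall>F\<in>sets borel. \<forall>z\<in>A. \<forall>u\<in>Lp p.
        cutoff E (S z (cutoff F u)) \<in> Lp q \<and>
        lpnorm q (cutoff E (S z (cutoff F u)))
          \<le> C * cmod z powr (real CARD('n) / q - real CARD('n) / p)
              * (1 + setdist E F / cmod z) powr (- K) * lpnorm p (cutoff F u))"


section \<open>The operators $D$, $BD$ and $DB$\<close>

primrec Ck :: "nat \<Rightarrow> (real^'n \<Rightarrow> real) \<Rightarrow> bool" where
  "Ck 0 \<phi> \<longleftrightarrow> continuous_on UNIV \<phi>"
| "Ck (Suc k) \<phi> \<longleftrightarrow> (\<forall>x. \<phi> differentiable (at x)) \<and>
     (\<forall>h. Ck k (\<lambda>x. frechet_derivative \<phi> (at x) h))"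

definition test_functions :: "(real^'n \<Rightarrow> real) set" where
  "test_functions = {\<phi>. (\<forall>k. Ck k \<phi>) \<and> compact (closure {x. \<phi> x \<noteq> 0})}"

text \<open>\<open>weak_D Dh u w\<close> says that $-i\sum_j \hat D_j\partial_j u = w$ as distributions.
  Since the pairing is complex linear in the test function, real test functions suffice.\<close>

definition weak_D ::
    "('n \<Rightarrow> complex^'m^'m) \<Rightarrow> ('n::finite, 'm::finite) vfun \<Rightarrow> ('n, 'm) vfun \<Rightarrow> bool" where
  "weak_D Dh u w \<longleftrightarrow> (\<forall>\<phi>\<in>test_functions.
     (\<integral>x. \<phi> x *\<^sub>R rep_vfun w x \<partial>lborel) =
     (\<integral>x. (\<Sum>j\<in>UNIV. frechet_derivative \<phi> (at x) (axis j 1) *\<^sub>R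
              (\<i> *s (Dh j *v rep_vfun u x))) \<partial>lborel))"

definition op_D ::
    "('n \<Rightarrow> complex^'m^'m) \<Rightarrow> real \<Rightarrow> ('n::finite, 'm::finite) graph" where
  "op_D Dh q = {(u, w). u \<in> Lp q \<and> w \<in> Lp q \<and> weak_D Dh u w}"

definition op_BD ::
    "('n \<Rightarrow> complex^'m^'m) \<Rightarrow> (real^'n \<Rightarrow> complex^'m^'m) \<Rightarrow> real \<Rightarrow>
     ('n::finite, 'm::finite) graph" where
  "op_BD Dh B q = {(u, matmult B w) | u w. (u, w) \<in> op_D Dh q}"

definition op_DB ::
    "('n \<Rightarrow> complex^'m^'m) \<Rightarrow> (real^'n \<Rightarrow> complex^'m^'m) \<Rightarrow> real \<Rightarrow>
     ('n::finite, 'm::finite) graph" where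
  "op_DB Dh B q = {(u, w). u \<in> Lp q \<and> (matmult B u, w) \<in> op_D Dh q}"

definition symbol :: "('n::finite \<Rightarrow> complex^'m^'m) \<Rightarrow> real^'n \<Rightarrow> complex^'m^'m" where
  "symbol Dh \<xi> = (\<Sum>j\<in>UNIV. (\<xi> $ j) *\<^sub>R Dh j)"

definition mat_spectrum :: "complex^'m^'m \<Rightarrow> complex set" where
  "mat_spectrum A = {z. \<not> invertible (mat z - A)}"

definition D_admissible :: "('n::finite \<Rightarrow> complex^'m^'m) \<Rightarrow> bool" where
  "D_admissible Dh \<longleftrightarrow>
     (\<exists>\<kappa>>0. \<forall>\<xi>. \<forall>e\<in>range (\<lambda>v. symbol Dh \<xi> *v v).
        \<kappa> * norm \<xi> * norm e \<le> norm (symbol Dh \<xi> *v e)) \<and>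
     (\<exists>\<omega>D. 0 \<le> \<omega>D \<and> \<omega>D < pi / 2 \<and> (\<forall>\<xi>. mat_spectrum (symbol Dh \<xi>) \<subseteq> bisector \<omega>D))"

definition Linf_matrix :: "(real^'n \<Rightarrow> complex^'m^'m) \<Rightarrow> bool" where
  "Linf_matrix B \<longleftrightarrow> B \<in> borel_measurable lborel \<and> (\<exists>M. AE x in lborel. norm (B x) \<le> M)"

definition cadjoint :: "complex^'m^'m \<Rightarrow> complex^'m^'m" where
  "cadjoint A = (\<chi> i j. cnj (A $ j $ i))"

text \<open>$\|Bu\|_{L^q} \gtrsim \|u\|_{L^q}$ on $\overline{R_q(D)}$, and
  $\|B^*u\|_{L^{q'}} \gtrsim \|u\|_{L^{q'}}$ on $\overline{R_{q'}(D^*)}$.\<close>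

definition B_lower ::
    "('n \<Rightarrow> complex^'m^'m) \<Rightarrow> (real^'n \<Rightarrow> complex^'m^'m) \<Rightarrow> real \<Rightarrow> bool" where
  "B_lower Dh B q \<longleftrightarrow> (\<exists>c>0. \<forall>u\<in>Lp_closure q (Range (op_D Dh q)).
     c * lpnorm q u \<le> lpnorm q (matmult B u))"

definition Bstar_lower ::
    "('n \<Rightarrow> complex^'m^'m) \<Rightarrow> (real^'n \<Rightarrow> complex^'m^'m) \<Rightarrow> real \<Rightarrow> bool" where
  "Bstar_lower Dh B q \<longleftrightarrow>
     (\<exists>c>0. \<forall>u\<in>Lp_closure (conj_exp q) (Range (adjoint_op q (op_D Dh q))).
        c * lpnorm (conj_exp q) u \<le> lpnorm (conj_exp q) (matmult (\<lambda>x. cadjoint (B x)) u))"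

definition standing_assumption ::
    "('n \<Rightarrow> complex^'m^'m) \<Rightarrow> (real^'n \<Rightarrow> complex^'m^'m) \<Rightarrow> real \<Rightarrow> bool" where
  "standing_assumption Dh B \<omega> \<longleftrightarrow>
     D_admissible Dh \<and> Linf_matrix B \<and> 0 \<le> \<omega> \<and> \<omega> < pi / 2 \<and>
     (B_lower Dh B 2 \<and> bisectorial 2 (op_BD Dh B 2) \<omega> \<or>
      Bstar_lower Dh B 2 \<and> bisectorial 2 (op_DB Dh B 2) \<omega>)"


section \<open>The intervals $\mathcal{I}_2$ and $\mathcal{I}_{D,B}$\<close>

text \<open>Intervals are sets of reals, so that the right endpoint may be infinite.\<close>

definition open_interval_2 :: "real set \<Rightarrow> bool" where
  "open_interval_2 I \<longleftrightarrow> open I \<and> is_interval I \<and> I \<subseteq> {1<..} \<and> 2 \<in> I"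

definition is_I2 ::
    "('n \<Rightarrow> complex^'m^'m) \<Rightarrow> (real^'n \<Rightarrow> complex^'m^'m) \<Rightarrow> real set \<Rightarrow> bool" where
  "is_I2 Dh B I2 \<longleftrightarrow> open_interval_2 I2 \<and> (\<forall>q\<in>I2. B_lower Dh B q \<and> Bstar_lower Dh B q)"

definition good_exponent :: "(real \<Rightarrow> ('n::finite, 'm::finite) graph) \<Rightarrow> real \<Rightarrow> real \<Rightarrow> bool" where
  "good_exponent T \<omega> q \<longleftrightarrow>
     kernel_range_decomposition q (T q) \<and> bisectorial q (T q) \<omega> \<and>
     bounded_Hinf_calculus q (T q) \<omega> \<and>
     (\<forall>\<nu>. \<omega> < \<nu> \<and> \<nu> < pi / 2 \<longrightarrow>
        (\<forall>K\<ge>0. off_diagonal q q K (- bisector \<nu>) (resolvent_op (T q))))"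

definition good_interval ::
    "('n \<Rightarrow> complex^'m^'m) \<Rightarrow> (real^'n \<Rightarrow> complex^'m^'m) \<Rightarrow> real \<Rightarrow> real set \<Rightarrow> real set \<Rightarrow> bool"
  where
  "good_interval Dh B \<omega> I2 I \<longleftrightarrow> open_interval_2 I \<and> I \<subseteq> I2 \<and>
     (\<forall>q\<in>I. good_exponent (op_BD Dh B) \<omega> q \<and> good_exponent (op_DB Dh B) \<omega> q)"

definition is_I_DB ::
    "('n \<Rightarrow> complex^'m^'m) \<Rightarrow> (real^'n \<Rightarrow> complex^'m^'m) \<Rightarrow> real \<Rightarrow> real set \<Rightarrow> real set \<Rightarrow> bool"
  where
  "is_I_DB Dh B \<omega> I2 I \<longleftrightarrow> good_interval Dh B \<omega> I2 I \<and>
     (\<forall>J. good_interval Dh B \<omega> I2 J \<and> I \<subseteq> J \<longrightarrow> J = I)"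


section \<open>Unbounded maps between normed spaces\<close>

definition not_bounded_from ::
    "'a set \<Rightarrow> ('a \<Rightarrow> real) \<Rightarrow> 'a set \<Rightarrow> ('a \<Rightarrow> real) \<Rightarrow> ('a \<Rightarrow> 'a) \<Rightarrow> bool" where
  "not_bounded_from X nX Y nY S \<longleftrightarrow>
     (\<exists>u\<in>X. S u \<notin> Y) \<or> \<not> (\<exists>C>0. \<forall>u\<in>X. nY (S u) \<le> C * nX u)"

end

theory Submission
  imports Defs "HOL-Probability.Probability"
begin

text \<open>On \<open>N\<^sub>p(T)\<close> the operator \<open>f(T)\<close> is multiplication by \<open>f(0)\<close>, so it has to be shown that
  \<open>N\<^sub>p(T)\<close> does not embed into \<open>L\<^sup>q\<close>. The symbol \<open>A(\<xi>)\<close> of \<open>D\<close> is either invertible for all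
  \<open>\<xi> \<noteq> 0\<close> or singular for all \<open>\<xi>\<close>. In the first case a Liouville theorem gives \<open>N\<^sub>r(D) = 0\<close>, and
  then \<open>N\<^sub>r(BD) = N\<^sub>r(DB) = 0\<close>, which is excluded. In the second case \<open>D\<close> and \<open>D\<^sup>*\<close> annihilate
  nonzero compactly supported smooth fields \<open>v\<close>, of the form \<open>w(\<partial>)\<chi>\<close> with a polynomial field
  \<open>w\<close> in the kernel of the symbol, and all dilates \<open>v\<^sub>t(x) = v(t x)\<close>. For \<open>BD\<close> the norms of
  \<open>v\<^sub>t\<close> in \<open>L\<^sup>p\<close> and \<open>L\<^sup>q\<close> scale differently. For \<open>DB\<close> one pairs \<open>v\<^sub>t\<close>, annihilated by
  \<open>D\<^sup>*\<close>, with its own component in \<open>N\<^sub>p(DB)\<close>: the pairing is \<open>\<parallel>v\<^sub>t\<parallel>\<^sub>2\<^sup>2\<close>, because \<open>v\<^sub>t\<close> is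
  orthogonal to the range of \<open>DB\<close>, and scaling again contradicts boundedness.\<close>

section \<open>Lebesgue spaces\<close>

text \<open>The two operators need different test elements because \<open>B\<close> is only bounded
  and measurable. The null space of \<open>BD\<close> contains that of \<open>D\<close>, which is
  invariant under dilations. That of \<open>DB\<close> consists of the \<open>u\<close> for which
  \<open>B u\<close> is annihilated by \<open>D\<close>; dilations need not preserve it, and its
  elements are reached only through the kernel/range projection. In dimension n the pairing there
  has size t^(-n), while Holder bounds it by a constant times t^(-n/p) t^(-n/q'). The quotient
  t^(n/p - n/q) is unbounded on t > 0 for either sign of the exponent, and the constant does not
  depend on t, since it comes from the projection.

  The calculus is a chain of definite descriptions, so even f(T) 0 = 0 requires uniqueness of the
  integral and an actual approximating sequence in \<open>Psi\<close>. The compactly supported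
  fields come from Laplace transforms at real arguments, where positivity of the bump function gives
  nonvanishing. The Liouville theorem pairs the solution with finite differences of Gaussians, so
  that all its integrals converge absolutely.\<close>

lemma rep_vfun_measurable [measurable]: "rep_vfun u \<in> borel_measurable borel"
  using Quotient3_rep_reflp[OF Quotient3_vfun, of u] by (simp add: ae_eq_def)

lemma rep_abs_vfun:
  fixes f :: "real^'n::finite \<Rightarrow> complex^'m::finite"
  assumes "f \<in> borel_measurable borel"
  shows "AE x in lborel. rep_vfun (abs_vfun f) x = f x"
proof -
  have "ae_eq f f"
    using assms by (simp add: ae_eq_def)
  from rep_abs_rsp_left[OF Quotient3_vfun, OF this] show ?thesis
    by (simp add: ae_eq_def)
qed

lemma vfun_eqI:
  assumes "AE x in lborel. rep_vfun u x = rep_vfun v x"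
  shows "u = v"
  using Quotient3_rel_rep[OF Quotient3_vfun, of u v] assms by (simp add: ae_eq_def)

lemma rep_zero_vfun: "AE x in lborel. rep_vfun 0 x = 0"
  unfolding zero_vfun_def using rep_abs_vfun[of "\<lambda>_. 0"] by simp

lemma rep_plus_vfun: "AE x in lborel. rep_vfun (u + v) x = rep_vfun u x + rep_vfun v x"
  unfolding plus_vfun_def map_fun_apply by (rule rep_abs_vfun) measurable

lemma rep_minus_vfun: "AE x in lborel. rep_vfun (u - v) x = rep_vfun u x - rep_vfun v x"
  unfolding minus_vfun_def map_fun_apply by (rule rep_abs_vfun) measurable

lemma rep_cscale: "AE x in lborel. rep_vfun (cscale c u) x = c *s rep_vfun u x"
  unfolding cscale_def map_fun_apply id_apply by (rule rep_abs_vfun) measurable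

lemma matrix_vector_mult_measurable [measurable (raw)]:
  fixes B :: "'a \<Rightarrow> complex^'k^'m"
  assumes [measurable]: "B \<in> borel_measurable M" "u \<in> borel_measurable M"
  shows "(\<lambda>x. B x *v u x) \<in> borel_measurable M"
proof -
  have "continuous_on UNIV (\<lambda>p::(complex^'k^'m) \<times> (complex^'k). fst p *v snd p)"
    unfolding matrix_vector_mult_def by (intro continuous_intros)
  then have [measurable]: "(\<lambda>p::(complex^'k^'m) \<times> (complex^'k). fst p *v snd p) \<in> borel_measurable borel"
    by (rule borel_measurable_continuous_onI)
  have "(\<lambda>x. (\<lambda>p. fst p *v snd p) (B x, u x)) \<in> borel_measurable M"
    by measurable
  then show ?thesis by simp
qed

lemma rep_matmult:
  assumes "B \<in> borel_measurable borel"
  shows "AE x in lborel. rep_vfun (matmult B u) x = B x *v rep_vfun u x"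
  unfolding matmult_def
  using assms rep_vfun_measurable by (intro rep_abs_vfun matrix_vector_mult_measurable)

lemma borel_measurable_vec_nth_complex [measurable (raw)]:
  fixes u :: "'a \<Rightarrow> complex^'k"
  assumes [measurable]: "u \<in> borel_measurable M"
  shows "(\<lambda>x. u x $ i) \<in> borel_measurable M"
proof -
  have [measurable]: "(\<lambda>v::complex^'k. v $ i) \<in> borel_measurable borel"
    by (intro borel_measurable_continuous_onI continuous_intros)
  show ?thesis by measurable
qed

lemma borel_measurable_cnj [measurable (raw)]:
  assumes [measurable]: "f \<in> borel_measurable M"
  shows "(\<lambda>x. cnj (f x)) \<in> borel_measurable M"
proof -
  have [measurable]: "cnj \<in> borel_measurable borel"
    by (intro borel_measurable_continuous_onI continuous_intros)
  show ?thesis by measurable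
qed


lemma cscale_simps [simp]:
  fixes u :: "('n::finite, 'm::finite) vfun"
  shows "cscale c (0 :: ('n, 'm) vfun) = 0" "cscale 1 u = u" "cscale 0 u = 0" "cscale a (cscale b u) = cscale (a * b) u"
  "cscale (-1) u = - u"
proof -
  have z: "AE x in lborel. rep_vfun (0 :: ('n, 'm) vfun) x = 0"
    by (rule rep_zero_vfun)
  show "cscale c (0 :: ('n, 'm) vfun) = 0"
    by (rule vfun_eqI) (use z rep_cscale[of c "0 :: ('n, 'm) vfun"] in eventually_elim, simp)
  show "cscale 1 u = u"
    by (rule vfun_eqI) (use rep_cscale[of 1 u] in eventually_elim, simp)
  show "cscale 0 u = 0"
    by (rule vfun_eqI) (use z rep_cscale[of 0 u] in eventually_elim, simp)
  show "cscale a (cscale b u) = cscale (a * b) u"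
    by (rule vfun_eqI)
      (use rep_cscale[of a "cscale b u"] rep_cscale[of b u] rep_cscale[of "a*b" u] in eventually_elim, simp)
  have "u + cscale (-1) u = 0"
    by (rule vfun_eqI)
      (use rep_cscale[of "-1" u] rep_plus_vfun[of u "cscale (-1) u"] z in eventually_elim, simp)
  then show "cscale (-1) u = - u"
    by (metis add_eq_0_iff)
qed

lemma norm_smult_vec [simp]:
  fixes v :: "complex^'k"
  shows "norm (c *s v) = cmod c * norm v"
  by (simp add: norm_vec_def L2_set_def norm_mult power_mult_distrib sum_distrib_left[symmetric]
      real_sqrt_mult)

lemma LpD: "u \<in> Lp p \<Longrightarrow> integrable lborel (\<lambda>x. norm (rep_vfun u x) powr p)"
  by (simp add: Lp_def)

lemma lpnorm_nonneg [simp]: "0 \<le> lpnorm p u"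
  by (simp add: lpnorm_def)

lemma lpnorm_powr:
  assumes "0 < p"
  shows "lpnorm p u powr p = (\<integral>x. norm (rep_vfun u x) powr p \<partial>lborel)"
  using assms by (simp add: lpnorm_def powr_powr)

text \<open>Convexity of \<open>x powr p\<close> up to the endpoint 0, where it reduces to
  \<open>c powr p \<le> c\<close> for weights 0 < c \<le> 1. Norms of functions may vanish on large
  sets, so the endpoint matters.\<close>

lemma powr_convex_0:
  fixes a b x y p :: real
  assumes "1 \<le> p" "0 \<le> x" "0 \<le> y" "0 < a" "0 < b" "a + b = 1"
  shows "(a * x + b * y) powr p \<le> a * x powr p + b * y powr p"
proof -
  have le: "c powr p \<le> c" if "0 < c" "c \<le> 1" for c
    using that assms(1) by (metis powr_mono' powr_one less_eq_real_def)
  consider "x = 0" | "y = 0" | "0 < x" "0 < y" using assms by linarith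
  then show ?thesis
  proof cases
    case 1
    then show ?thesis using le[of b] assms by (simp add: powr_mult mult_right_mono)
  next
    case 2
    then show ?thesis using le[of a] assms by (simp add: powr_mult mult_right_mono)
  next
    case 3
    then show ?thesis
      using convex_onD[OF powr_convex[OF assms(1)], of b x y] assms
      by (simp add: eq_diff_eq[symmetric])
  qed
qed

text \<open>Convexity with weights a / (a + b) and b / (a + b), applied to f / a and g / b. The
  bounds \<open>a\<close> and \<open>b\<close> stand in for the norms because they must be positive
  to divide by; the norms themselves are reached by letting the bounds decrease to them.\<close>

lemma Minkowski_integral:
  fixes f g :: "'a \<Rightarrow> real"
  assumes p: "1 \<le> p" and ab: "0 < a" "0 < b"
    and nn: "\<And>x. 0 \<le> f x" "\<And>x. 0 \<le> g x"
    and [measurable]: "f \<in> borel_measurable M" "g \<in> borel_measurable M"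
    and int: "integrable M (\<lambda>x. f x powr p)" "integrable M (\<lambda>x. g x powr p)"
    and le: "(\<integral>x. f x powr p \<partial>M) \<le> a powr p" "(\<integral>x. g x powr p \<partial>M) \<le> b powr p"
  shows "integrable M (\<lambda>x. (f x + g x) powr p)" "(\<integral>x. (f x + g x) powr p \<partial>M) \<le> (a + b) powr p"
proof -
  define h where "h x = (a+b) powr p * (a/(a+b) * (f x powr p / a powr p) + b/(a+b) * (g x powr p / b powr p))" for x
  have pw: "(f x + g x) powr p \<le> h x" for x
  proof -
    have "(a/(a+b) * (f x / a) + b/(a+b) * (g x / b)) powr p
      \<le> a/(a+b) * (f x / a) powr p + b/(a+b) * (g x / b) powr p"
      using ab nn[of x] p by (intro powr_convex_0) (auto simp: add_divide_distrib[symmetric])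
    moreover have "f x + g x = (a+b) * (a/(a+b) * (f x / a) + b/(a+b) * (g x / b))"
      using ab by (simp add: add_divide_distrib[symmetric])
    ultimately show ?thesis
      unfolding h_def using ab nn[of x]
      by (simp add: powr_mult powr_divide mult_left_mono)
  qed
  have inth: "integrable M h"
    unfolding h_def using int by auto
  show i: "integrable M (\<lambda>x. (f x + g x) powr p)"
    by (rule Bochner_Integration.integrable_bound[OF inth])
      (use pw nn in \<open>auto intro!: order_trans[OF pw abs_ge_self]\<close>)
  have "(\<integral>x. (f x + g x) powr p \<partial>M) \<le> (\<integral>x. h x \<partial>M)"
    using i inth pw by (rule integral_mono)
  also have "\<dots> = (a+b) powr p * (a/(a+b) * ((\<integral>x. f x powr p \<partial>M) / a powr p) + b/(a+b) * ((\<integral>x. g x powr p \<partial>M) / b powr p))"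
    unfolding h_def using int by simp
  also have "\<dots> \<le> (a+b) powr p * (a/(a+b) * 1 + b/(a+b) * 1)"
    using ab le by (intro mult_left_mono add_mono) auto
  also have "\<dots> = (a+b) powr p"
    using ab by (simp add: add_divide_distrib[symmetric])
  finally show "(\<integral>x. (f x + g x) powr p \<partial>M) \<le> (a + b) powr p" .
qed

lemma
  assumes p: "1 \<le> p" and u: "u \<in> Lp p" and v: "v \<in> Lp p"
  shows Lp_add: "u + v \<in> Lp p" and lpnorm_triangle: "lpnorm p (u + v) \<le> lpnorm p u + lpnorm p v"
proof -
  define f where "f = (\<lambda>x. norm (rep_vfun u x))"
  define g where "g = (\<lambda>x. norm (rep_vfun v x))"
  have [measurable]: "f \<in> borel_measurable lborel" "g \<in> borel_measurable lborel"
    unfolding f_def g_def by measurable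
  have int: "integrable lborel (\<lambda>x. f x powr p)" "integrable lborel (\<lambda>x. g x powr p)"
    using u v by (auto simp: f_def g_def Lp_def)
  have ae: "AE x in lborel. norm (rep_vfun (u+v) x) powr p \<le> (f x + g x) powr p"
    using rep_plus_vfun[of u v]
    by eventually_elim (use p in \<open>auto simp: f_def g_def intro!: powr_mono2 norm_triangle_ineq\<close>)
  have *: "integrable lborel (\<lambda>x. norm (rep_vfun (u+v) x) powr p) \<and>
    (\<integral>x. norm (rep_vfun (u+v) x) powr p \<partial>lborel) \<le> (a+b) powr p"
    if a: "lpnorm p u < a" and b: "lpnorm p v < b" for a b
  proof -
    have ab: "0 < a" "0 < b" using a b lpnorm_nonneg[of p u] lpnorm_nonneg[of p v] by linarith+
    have le: "(\<integral>x. f x powr p \<partial>lborel) \<le> a powr p" "(\<integral>x. g x powr p \<partial>lborel) \<le> b powr p"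
      using p a b lpnorm_nonneg[of p u] lpnorm_nonneg[of p v]
        powr_mono2[of p "lpnorm p u" a] powr_mono2[of p "lpnorm p v" b]
      by (simp_all add: lpnorm_powr f_def g_def)
    have M: "integrable lborel (\<lambda>x. (f x + g x) powr p)" "(\<integral>x. (f x + g x) powr p \<partial>lborel) \<le> (a + b) powr p"
      using Minkowski_integral[OF p ab _ _ _ _ int le] by (auto simp: f_def g_def)
    have i: "integrable lborel (\<lambda>x. norm (rep_vfun (u+v) x) powr p)"
      by (rule Bochner_Integration.integrable_bound[OF M(1)])
        (use ae in \<open>auto elim!: eventually_mono\<close>)
    show ?thesis
      using i integral_mono_AE[OF i M(1) ae] M(2) by auto
  qed
  show "u + v \<in> Lp p"
    using *[of "lpnorm p u + 1" "lpnorm p v + 1"] by (simp add: Lp_def)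
  show "lpnorm p (u + v) \<le> lpnorm p u + lpnorm p v"
  proof (rule field_le_epsilon)
    fix e :: real assume "0 < e"
    then have "lpnorm p (u+v) powr p \<le> (lpnorm p u + e/2 + (lpnorm p v + e/2)) powr p"
      using *[of "lpnorm p u + e/2" "lpnorm p v + e/2"] lpnorm_powr[of p "u+v"] p by auto
    then have "lpnorm p (u+v) \<le> lpnorm p u + e/2 + (lpnorm p v + e/2)"
      using p \<open>0 < e\<close> lpnorm_nonneg[of p u] lpnorm_nonneg[of p v]
        powr_less_mono2[of p "lpnorm p u + e/2 + (lpnorm p v + e/2)" "lpnorm p (u+v)"]
      by linarith
    then show "lpnorm p (u+v) \<le> lpnorm p u + lpnorm p v + e" by simp
  qed
qed

lemma
  shows lpnorm_zero [simp]: "lpnorm p (0 :: ('n::finite, 'm::finite) vfun) = 0"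
    and zero_in_Lp [simp]: "(0 :: ('n::finite, 'm::finite) vfun) \<in> Lp p"
proof -
  have z: "AE x in lborel. norm (rep_vfun (0 :: ('n, 'm) vfun) x) powr p = 0"
    using rep_zero_vfun by eventually_elim simp
  have "(\<integral>x. norm (rep_vfun (0 :: ('n, 'm) vfun) x) powr p \<partial>lborel) = (\<integral>x. 0 \<partial>(lborel :: (real^'n) measure))"
    by (rule integral_cong_AE) (use z in auto)
  then show "lpnorm p (0 :: ('n, 'm) vfun) = 0" by (simp add: lpnorm_def)
  have "integrable lborel (\<lambda>x. norm (rep_vfun (0 :: ('n, 'm) vfun) x) powr p)
    \<longleftrightarrow> integrable lborel (\<lambda>x::real^'n. 0::real)"
    by (rule integrable_cong_AE) (use z in auto)
  then show "(0 :: ('n, 'm) vfun) \<in> Lp p" by (simp add: Lp_def)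
qed

lemma
  assumes "0 < p"
  shows Lp_cscale: "u \<in> Lp p \<Longrightarrow> cscale c u \<in> Lp p"
    and lpnorm_cscale: "lpnorm p (cscale c u) = cmod c * lpnorm p u"
proof -
  have ae: "AE x in lborel. norm (rep_vfun (cscale c u) x) powr p = cmod c powr p * norm (rep_vfun u x) powr p"
    using rep_cscale[of c u] by eventually_elim (simp add: powr_mult)
  have "integrable lborel (\<lambda>x. norm (rep_vfun (cscale c u) x) powr p) \<longleftrightarrow> integrable lborel (\<lambda>x. cmod c powr p * norm (rep_vfun u x) powr p)"
    by (rule integrable_cong_AE) (use ae in auto)
  then show "u \<in> Lp p \<Longrightarrow> cscale c u \<in> Lp p"
    by (simp add: Lp_def)
  have "(\<integral>x. norm (rep_vfun (cscale c u) x) powr p \<partial>lborel) = (\<integral>x. cmod c powr p * norm (rep_vfun u x) powr p \<partial>lborel)"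
    by (rule integral_cong_AE) (use ae in auto)
  then show "lpnorm p (cscale c u) = cmod c * lpnorm p u"
    using assms by (simp add: lpnorm_def powr_mult powr_powr)
qed

lemma lpnorm_uminus [simp]: "0 < p \<Longrightarrow> lpnorm p (- u) = lpnorm p u"
  using lpnorm_cscale[of p "-1" u] by simp

lemma lpnorm_minus_commute: "0 < p \<Longrightarrow> lpnorm p (u - v) = lpnorm p (v - u)"
  using lpnorm_uminus[of p "v - u"] by simp

lemma Lp_diff:
  assumes "1 \<le> p" "u \<in> Lp p" "v \<in> Lp p"
  shows "u - v \<in> Lp p"
  using Lp_add[OF assms(1,2), of "cscale (-1) v"] Lp_cscale[of p v "-1"] assms by simp

lemma lpnorm_eq_0D:
  fixes u :: "('n::finite, 'm::finite) vfun"
  assumes "0 < p" "u \<in> Lp p" "lpnorm p u = 0"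
  shows "u = 0"
proof -
  have "(\<integral>x. norm (rep_vfun u x) powr p \<partial>lborel) = 0"
    using lpnorm_powr[OF assms(1), of u] assms by simp
  then have "AE x in lborel. norm (rep_vfun u x) powr p = 0"
    using integral_nonneg_eq_0_iff_AE[OF LpD[OF assms(2)]] by simp
  moreover have "AE x in lborel. rep_vfun (0 :: ('n, 'm) vfun) x = 0"
    by (rule rep_zero_vfun)
  ultimately have "AE x in lborel. rep_vfun u x = rep_vfun 0 x"
    by eventually_elim simp
  then show ?thesis by (rule vfun_eqI)
qed

lemma Lp_lim_unique:
  assumes p: "1 \<le> p" and u: "Lp_lim p us u" and v: "Lp_lim p us v"
  shows "u = v"
proof -
  have uv: "u \<in> Lp p" "v \<in> Lp p" "\<And>k. us k \<in> Lp p"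
    using u v by (auto simp: Lp_lim_def)
  have "(\<lambda>k. lpnorm p (us k - u) + lpnorm p (us k - v)) \<longlonglongrightarrow> 0 + 0"
    using u v by (intro tendsto_add) (auto simp: Lp_lim_def)
  moreover have "lpnorm p (u - v) \<le> lpnorm p (us k - u) + lpnorm p (us k - v)" for k
  proof -
    have "lpnorm p (u - v) = lpnorm p ((u - us k) + (us k - v))" by simp
    also have "\<dots> \<le> lpnorm p (u - us k) + lpnorm p (us k - v)"
      using p uv by (intro lpnorm_triangle Lp_diff)
    finally show ?thesis using lpnorm_minus_commute[of p u "us k"] p by simp
  qed
  ultimately have "lpnorm p (u - v) \<le> 0"
    by (intro LIMSEQ_le_const[of _ _ "lpnorm p (u - v)"]) auto
  then have "u - v = 0"
    using p uv by (intro lpnorm_eq_0D[of p] Lp_diff) (auto intro: antisym)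
  then show ?thesis by simp
qed

lemma Lp_lim_const: "u \<in> Lp p \<Longrightarrow> Lp_lim p (\<lambda>_. u) u"
  by (simp add: Lp_lim_def)

lemma Lp_closure_subset: "Lp_closure p S \<subseteq> Lp p"
  unfolding Lp_closure_def Lp_lim_def by blast

lemma subset_Lp_closure: "S \<subseteq> Lp p \<Longrightarrow> S \<subseteq> Lp_closure p S"
proof
  fix u assume "S \<subseteq> Lp p" "u \<in> S"
  then have "(\<forall>k::nat. u \<in> S) \<and> Lp_lim p (\<lambda>_. u) u"
    by (auto intro: Lp_lim_const)
  then show "u \<in> Lp_closure p S"
    unfolding Lp_closure_def by (intro CollectI exI[of _ "\<lambda>_. u"])
qed

section \<open>Holder's inequality and the sesquilinear pairing\<close>

lemma norm_cinner_le:
  fixes a b :: "complex^'k"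
  shows "cmod (\<Sum>i\<in>UNIV. a $ i * cnj (b $ i)) \<le> norm a * norm b"
proof -
  have "cmod (\<Sum>i\<in>UNIV. a $ i * cnj (b $ i)) \<le> (\<Sum>i\<in>UNIV. \<bar>cmod (a $ i)\<bar> * \<bar>cmod (b $ i)\<bar>)"
    by (rule order_trans[OF norm_sum]) (simp add: norm_mult)
  also have "\<dots> \<le> L2_set (\<lambda>i. cmod (a $ i)) UNIV * L2_set (\<lambda>i. cmod (b $ i)) UNIV"
    by (rule L2_set_mult_ineq)
  finally show ?thesis by (simp add: norm_vec_def)
qed

text \<open>Young's inequality for |u| / a and |v| / b, with \<open>a\<close> and \<open>b\<close>
  strictly above the two norms to avoid division by 0. The product a b then decreases to the product
  of the norms.\<close>

lemma
  assumes p: "1 < p" and u: "u \<in> Lp p" and v: "v \<in> Lp (conj_exp p)"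
  shows pairing_integrable: "integrable lborel (\<lambda>x. \<Sum>i\<in>UNIV. rep_vfun u x $ i * cnj (rep_vfun v x $ i))"
    and Holder_pairing: "cmod (pairing u v) \<le> lpnorm p u * lpnorm (conj_exp p) v"
proof -
  define q where "q = conj_exp p"
  have q: "1 < q" "1/p + 1/q = 1" using p by (auto simp: q_def conj_exp_def field_simps)
  have iu: "integrable lborel (\<lambda>x. norm (rep_vfun u x) powr p)"
   and iv: "integrable lborel (\<lambda>x. norm (rep_vfun v x) powr q)"
    using u v by (auto simp: Lp_def q_def)
  define F where "F x = (\<Sum>i\<in>UNIV. rep_vfun u x $ i * cnj (rep_vfun v x $ i))" for x
  have [measurable]: "F \<in> borel_measurable borel"
    unfolding F_def by measurable
  have bd: "cmod (F x) \<le> a * b * ((norm (rep_vfun u x) powr p / a powr p) / p + (norm (rep_vfun v x) powr q / b powr q) / q)"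
    if ab: "0 < a" "0 < b" for a b x
  proof -
    have "cmod (F x) \<le> norm (rep_vfun u x) * norm (rep_vfun v x)"
      unfolding F_def by (rule norm_cinner_le)
    also have "\<dots> = a * b * ((norm (rep_vfun u x) / a) * (norm (rep_vfun v x) / b))"
      using ab by simp
    also have "\<dots> \<le> a * b * ((norm (rep_vfun u x) / a) powr p / p + (norm (rep_vfun v x) / b) powr q / q)"
      using ab p q by (intro mult_left_mono Youngs_inequality) auto
    finally show ?thesis using ab by (simp add: powr_divide)
  qed
  have inth: "integrable lborel (\<lambda>x. a * b * ((norm (rep_vfun u x) powr p / a powr p) / p + (norm (rep_vfun v x) powr q / b powr q) / q))" for a b :: real
    using iu iv by auto
  have iF: "integrable lborel F"
    by (rule Bochner_Integration.integrable_bound[OF inth[of 1 1]])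
      (use bd[of 1 1] in \<open>auto intro!: order_trans[OF _ abs_ge_self]\<close>)
  then show "integrable lborel (\<lambda>x. \<Sum>i\<in>UNIV. rep_vfun u x $ i * cnj (rep_vfun v x $ i))"
    unfolding F_def .
  have *: "cmod (pairing u v) \<le> a * b" if a: "lpnorm p u < a" and b: "lpnorm q v < b" for a b
  proof -
    have ab: "0 < a" "0 < b" using a b lpnorm_nonneg[of p u] lpnorm_nonneg[of q v] by linarith+
    have le: "lpnorm p u powr p \<le> a powr p" "lpnorm q v powr q \<le> b powr q"
      using a b p q by (auto intro!: powr_mono2)
    have "cmod (pairing u v) \<le> (\<integral>x. cmod (F x) \<partial>lborel)"
      unfolding pairing_def F_def[symmetric] by simp
    also have "\<dots> \<le> (\<integral>x. a * b * ((norm (rep_vfun u x) powr p / a powr p) / p + (norm (rep_vfun v x) powr q / b powr q) / q) \<partial>lborel)"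
      using iF inth bd[OF ab] by (intro integral_mono) auto
    also have "\<dots> = a * b * ((lpnorm p u powr p / a powr p) / p + (lpnorm q v powr q / b powr q) / q)"
      using iu iv p q by (simp add: lpnorm_powr)
    also have "\<dots> \<le> a * b * (1 / p + 1 / q)"
      using ab p q le by (intro mult_left_mono add_mono divide_right_mono) auto
    finally show ?thesis using q by simp
  qed
  have "((\<lambda>e. (lpnorm p u + e) * (lpnorm q v + e)) \<longlongrightarrow> (lpnorm p u + 0) * (lpnorm q v + 0)) (at_right 0)"
    by (intro tendsto_intros)
  moreover have "eventually (\<lambda>e. cmod (pairing u v) \<le> (lpnorm p u + e) * (lpnorm q v + e)) (at_right 0)"
    unfolding eventually_at_right_field by (intro exI[of _ 1]) (auto intro!: *)
  ultimately have "cmod (pairing u v) \<le> (lpnorm p u + 0) * (lpnorm q v + 0)"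
    by (intro tendsto_lowerbound) auto
  then show "cmod (pairing u v) \<le> lpnorm p u * lpnorm (conj_exp p) v"
    by (simp add: q_def)
qed

lemma
  assumes p: "1 < p" and u: "u \<in> Lp p" and w: "w \<in> Lp p" and v: "v \<in> Lp (conj_exp p)"
  shows pairing_add: "pairing (u + w) v = pairing u v + pairing w v"
    and pairing_diff: "pairing (u - w) v = pairing u v - pairing w v"
proof -
  note i = pairing_integrable[OF p u v] pairing_integrable[OF p w v]
  have "pairing (u + w) v = (\<integral>x. (\<Sum>i\<in>UNIV. rep_vfun u x $ i * cnj (rep_vfun v x $ i)) + (\<Sum>i\<in>UNIV. rep_vfun w x $ i * cnj (rep_vfun v x $ i)) \<partial>lborel)"
    unfolding pairing_def
  proof (rule integral_cong_AE)
    show "AE x in lborel. (\<Sum>i\<in>UNIV. rep_vfun (u + w) x $ i * cnj (rep_vfun v x $ i)) =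
      (\<Sum>i\<in>UNIV. rep_vfun u x $ i * cnj (rep_vfun v x $ i)) + (\<Sum>i\<in>UNIV. rep_vfun w x $ i * cnj (rep_vfun v x $ i))"
      using rep_plus_vfun[of u w] by eventually_elim (simp add: distrib_right sum.distrib)
  qed measurable
  then show "pairing (u + w) v = pairing u v + pairing w v"
    using i by (simp add: pairing_def)
  have "pairing (u - w) v = (\<integral>x. (\<Sum>i\<in>UNIV. rep_vfun u x $ i * cnj (rep_vfun v x $ i)) - (\<Sum>i\<in>UNIV. rep_vfun w x $ i * cnj (rep_vfun v x $ i)) \<partial>lborel)"
    unfolding pairing_def
  proof (rule integral_cong_AE)
    show "AE x in lborel. (\<Sum>i\<in>UNIV. rep_vfun (u - w) x $ i * cnj (rep_vfun v x $ i)) =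
      (\<Sum>i\<in>UNIV. rep_vfun u x $ i * cnj (rep_vfun v x $ i)) - (\<Sum>i\<in>UNIV. rep_vfun w x $ i * cnj (rep_vfun v x $ i))"
      using rep_minus_vfun[of u w] by eventually_elim (simp add: left_diff_distrib sum_subtractf)
  qed measurable
  then show "pairing (u - w) v = pairing u v - pairing w v"
    using i by (simp add: pairing_def)
qed

text \<open>Holder makes the pairing with \<open>v\<close> continuous on the p-space, so vanishing
  passes from \<open>S\<close> to its closure.\<close>

lemma pairing_Lp_closure_eq_0:
  assumes p: "1 < p" and S: "\<And>w. w \<in> S \<Longrightarrow> pairing w v = 0" and v: "v \<in> Lp (conj_exp p)"
    and u: "u \<in> Lp_closure p S"
  shows "pairing u v = 0"
proof -
  obtain us where us: "\<And>k. us k \<in> S" "Lp_lim p us u"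
    using u by (auto simp: Lp_closure_def)
  have L: "us k \<in> Lp p" "u \<in> Lp p" for k using us(2) by (auto simp: Lp_lim_def)
  have "cmod (pairing u v) \<le> lpnorm p (us k - u) * lpnorm (conj_exp p) v" for k
    using Holder_pairing[OF p Lp_diff[OF _ L(1) L(2)] v, of k] pairing_diff[OF p L(1) L(2) v, of k] S[OF us(1)[of k]] p
    by simp
  moreover have "(\<lambda>k. lpnorm p (us k - u) * lpnorm (conj_exp p) v) \<longlonglongrightarrow> 0 * lpnorm (conj_exp p) v"
    using us(2) by (intro tendsto_intros) (auto simp: Lp_lim_def)
  ultimately have "cmod (pairing u v) \<le> 0"
    by (intro LIMSEQ_le_const[of _ _ "cmod (pairing u v)"]) auto
  then show ?thesis by simp
qed

section \<open>The functional calculus on the null space\<close>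

text \<open>The opening angle keeps points of the bisector away from the imaginary axis, hence their
  squares away from the negative real axis. This is what bounds the denominators of the approximants
  from below.\<close>

lemma cos_mult_cmod_le_abs_Re:
  assumes "z \<in> open_bisector \<nu>" "0 \<le> \<nu>" "\<nu> < pi / 2"
  shows "cos \<nu> * cmod z \<le> \<bar>Re z\<bar>"
proof -
  have *: "cos \<nu> * cmod w \<le> \<bar>Re w\<bar>" if "w \<noteq> 0" "\<bar>Arg w\<bar> < \<nu>" for w
  proof -
    have "cos \<nu> \<le> cos \<bar>Arg w\<bar>"
      using that assms by (intro cos_monotone_0_pi_le) auto
    then have "cos \<nu> * cmod w \<le> cmod w * cos (Arg w)"
      by (simp add: mult.commute mult_left_mono)
    also have "cmod w * cos (Arg w) = Re w"
      using Arg_eq[OF that(1)] by (metis Re_rcis rcis_cmod_Arg)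
    finally show ?thesis by simp
  qed
  show ?thesis
    using assms(1) *[of z] *[of "-z"] by (auto simp: open_bisector_def)
qed

text \<open>With a = s |z|^2 one has |1 + s z^2|^2 = (1 - a)^2 + 4 s (Re z)^2, to be compared with
  (1 + a)^2 = (1 - a)^2 + 4 a.\<close>

lemma norm_one_plus_square_ge:
  assumes c: "0 \<le> c" "c \<le> 1" "c * cmod z \<le> \<bar>Re z\<bar>" and s: "0 \<le> s"
  shows "c * (1 + s * (cmod z)\<^sup>2) \<le> cmod (1 + of_real s * z\<^sup>2)"
proof -
  define a where "a = s * (cmod z)\<^sup>2"
  have a: "0 \<le> a" using s by (simp add: a_def)
  have sq: "c\<^sup>2 * (cmod z)\<^sup>2 \<le> (Re z)\<^sup>2"
    using power_mono[OF c(3), of 2] c(1) by (simp add: power_mult_distrib)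
  have "(c * (1 + a))\<^sup>2 = c\<^sup>2 * ((1 - a)\<^sup>2 + 4 * a)"
    by (simp add: power_mult_distrib) (simp add: power2_eq_square algebra_simps)
  also have "\<dots> \<le> (1 - a)\<^sup>2 + 4 * s * (c\<^sup>2 * (cmod z)\<^sup>2)"
    using c power_le_one[of c 2] by (simp add: a_def distrib_left mult_left_le_one_le)
  also have "\<dots> \<le> (1 - a)\<^sup>2 + 4 * s * (Re z)\<^sup>2"
    using sq s by (intro add_left_mono mult_left_mono) auto
  also have "\<dots> = (cmod (1 + of_real s * z\<^sup>2))\<^sup>2"
    unfolding a_def cmod_power2 by (simp add: power2_eq_square algebra_simps)
  finally show ?thesis
    unfolding a_def by (rule power2_le_imp_le) simp
qed


text \<open>The approximants are
  $f(\lambda)\,\frac{m\lambda^2}{1+m\lambda^2}\,\frac{1}{1+\lambda^2/m}$ with $m = (k+1)^2$.\<close>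

lemma Psi_approximation:
  assumes f: "f \<in> Hinf0 \<nu>" and \<nu>: "0 < \<nu>" "\<nu> < pi / 2"
  obtains \<psi> :: "nat \<Rightarrow> complex \<Rightarrow> complex" and M
  where "\<And>k. \<psi> k \<in> Psi \<nu>" "\<And>k z. z \<in> open_bisector \<nu> \<Longrightarrow> cmod (\<psi> k z) \<le> M"
    "\<And>K. compact K \<Longrightarrow> K \<subseteq> open_bisector \<nu> \<Longrightarrow> uniform_limit K \<psi> f sequentially"
proof -
  define c where "c = cos \<nu>"
  have c: "0 < c" "c \<le> 1" using \<nu> by (auto simp: c_def intro: cos_gt_zero)
  obtain M0 where M0: "\<And>z. z \<in> open_bisector \<nu> \<Longrightarrow> cmod (f z) \<le> M0"
    using f by (auto simp: Hinf0_def bounded_iff)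
  define M where "M = max M0 0"
  have M: "cmod (f z) \<le> M" "0 \<le> M" if "z \<in> open_bisector \<nu>" for z
    using M0[OF that] by (auto simp: M_def)
  have M_nn: "0 \<le> M" by (simp add: M_def)
  have low: "c * (1 + s * (cmod z)\<^sup>2) \<le> cmod (1 + of_real s * z\<^sup>2)"
    if "z \<in> open_bisector \<nu>" "0 \<le> s" for z s
    using norm_one_plus_square_ge[of c z s] cos_mult_cmod_le_abs_Re[OF that(1)] \<nu> c that by (simp add: c_def)
  have nz: "1 + of_real s * z\<^sup>2 \<noteq> 0" if "z \<in> open_bisector \<nu>" "0 \<le> s" for z s
  proof -
    have "0 < c * (1 + s * (cmod z)\<^sup>2)"
      using c that(2) by (intro mult_pos_pos) (auto simp: add_pos_nonneg)
    then show ?thesis using low[OF that] by auto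
  qed
  define m where "m k = (real (Suc k))\<^sup>2" for k
  have m: "1 \<le> m k" for k by (simp add: m_def)
  define g where "g k z = (of_real (m k) * z\<^sup>2) / ((1 + of_real (m k) * z\<^sup>2) * (1 + of_real (1 / m k) * z\<^sup>2))" for k and z :: complex
  have den: "c\<^sup>2 * ((1 + m k * (cmod z)\<^sup>2) * (1 + (cmod z)\<^sup>2 / m k)) \<le> cmod ((1 + of_real (m k) * z\<^sup>2) * (1 + of_real (1 / m k) * z\<^sup>2))"
    if z: "z \<in> open_bisector \<nu>" for k z
  proof -
    have "(c * (1 + m k * (cmod z)\<^sup>2)) * (c * (1 + (1 / m k) * (cmod z)\<^sup>2)) \<le> cmod (1 + of_real (m k) * z\<^sup>2) * cmod (1 + of_real (1 / m k) * z\<^sup>2)"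
      using low[OF z, of "m k"] low[OF z, of "1 / m k"] m[of k] c
      by (intro mult_mono) (auto intro!: mult_nonneg_nonneg add_nonneg_nonneg)
    then show ?thesis by (simp add: norm_mult power2_eq_square mult_ac)
  qed
  have gb: "cmod (g k z) \<le> m k * (cmod z)\<^sup>2 / (c\<^sup>2 * ((1 + m k * (cmod z)\<^sup>2) * (1 + (cmod z)\<^sup>2 / m k)))"
    if z: "z \<in> open_bisector \<nu>" for k z
  proof -
    have "0 < c\<^sup>2 * ((1 + m k * (cmod z)\<^sup>2) * (1 + (cmod z)\<^sup>2 / m k))"
      using c m[of k] by (intro mult_pos_pos add_pos_nonneg) auto
    then show ?thesis
      unfolding g_def norm_divide using den[OF z, of k] m[of k]
      by (intro frac_le) (auto simp: norm_mult norm_power)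
  qed
  \<comment> \<open>This bound is uniform in \<open>k\<close>, as the limiting procedure demands.
    The next one depends on \<open>k\<close> but decays at 0 and at infinity, as membership in
    \<open>Psi\<close> demands.\<close>
  have gb1: "cmod (g k z) \<le> 1 / c\<^sup>2" if z: "z \<in> open_bisector \<nu>" for k z
  proof -
    have "m k * (cmod z)\<^sup>2 \<le> (1 + m k * (cmod z)\<^sup>2) * 1" by simp
    also have "\<dots> \<le> (1 + m k * (cmod z)\<^sup>2) * (1 + (cmod z)\<^sup>2 / m k)"
      using m[of k] by (intro mult_left_mono) auto
    finally have "m k * (cmod z)\<^sup>2 / (c\<^sup>2 * ((1 + m k * (cmod z)\<^sup>2) * (1 + (cmod z)\<^sup>2 / m k)))
      \<le> ((1 + m k * (cmod z)\<^sup>2) * (1 + (cmod z)\<^sup>2 / m k)) / (c\<^sup>2 * ((1 + m k * (cmod z)\<^sup>2) * (1 + (cmod z)\<^sup>2 / m k)))"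
      using c m[of k] by (intro divide_right_mono) (auto intro!: mult_nonneg_nonneg add_nonneg_nonneg)
    also have "\<dots> = 1 / c\<^sup>2"
    proof -
      have "(1 + m k * (cmod z)\<^sup>2) * (1 + (cmod z)\<^sup>2 / m k) > 0"
        using m[of k] by (intro mult_pos_pos add_pos_nonneg) auto
      then show ?thesis by (simp only: divide_simps) (use c in auto)
    qed
    finally show ?thesis using gb[OF z, of k] by simp
  qed
  have gb2: "cmod (g k z) \<le> m k / c\<^sup>2 * ((cmod z)\<^sup>2 / (1 + (cmod z)^4))" if z: "z \<in> open_bisector \<nu>" for k z
  proof -
    define a where "a = (cmod z)\<^sup>2"
    have "1 + a\<^sup>2 \<le> (1 + m k * a) * (1 + a / m k)"
      using m[of k] by (simp add: field_simps power2_eq_square a_def)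
    then have "m k * a / (c\<^sup>2 * ((1 + m k * a) * (1 + a / m k))) \<le> m k * a / (c\<^sup>2 * (1 + a\<^sup>2))"
      using c m[of k] by (intro divide_left_mono mult_left_mono mult_pos_pos add_pos_nonneg)
         (auto simp: a_def add_pos_nonneg)
    then show ?thesis using gb[OF z, of k] by (simp add: a_def)
  qed
  define \<psi> where "\<psi> k z = (if z = 0 then 0 else f z * g k z)" for k z
  have z0: "z \<noteq> 0" if "z \<in> open_bisector \<nu>" for z using that by (auto simp: open_bisector_def)
  have bound: "cmod (\<psi> k z) \<le> M / c\<^sup>2" if z: "z \<in> open_bisector \<nu>" for k z
    using mult_mono[OF M(1)[OF z] gb1[OF z, of k]] M_nn z0[OF z] by (simp add: \<psi>_def norm_mult)
  show thesis
  proof (rule that)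
    show "\<psi> k \<in> Psi \<nu>" for k
    proof -
      have "(\<lambda>z. f z * g k z) holomorphic_on open_bisector \<nu>"
        unfolding g_def using f nz[of _ "m k"] nz[of _ "1 / m k"] m[of k]
        by (intro holomorphic_intros) (auto simp: Hinf0_def)
      then have hol: "\<psi> k holomorphic_on open_bisector \<nu>"
        by (rule holomorphic_transform) (use z0 in \<open>auto simp: \<psi>_def\<close>)
      have "cmod (\<psi> k z) \<le> (M * m k / c\<^sup>2) * (cmod z powr 2 / (1 + cmod z powr (2 + 2)))"
        if z: "z \<in> open_bisector \<nu>" for z
        using mult_mono[OF M(1)[OF z] gb2[OF z, of k]] M_nn z0[OF z]
        by (simp add: \<psi>_def norm_mult)
      then have "\<exists>C. \<forall>z\<in>open_bisector \<nu>. cmod (\<psi> k z) \<le> C * (cmod z powr 2 / (1 + cmod z powr (2 + 2)))"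
        by blast
      then have "\<psi> k \<in> Psi_class \<nu> 2 2"
        using hol by (simp add: Psi_class_def \<psi>_def)
      then show ?thesis by (auto simp: Psi_def intro!: bexI[of _ 2])
    qed
    show "cmod (\<psi> k z) \<le> M / c\<^sup>2" if "z \<in> open_bisector \<nu>" for k z
      by (rule bound[OF that])
    show "uniform_limit K \<psi> f sequentially" if K: "compact K" "K \<subseteq> open_bisector \<nu>" for K
    proof (cases "K = {}")
      case False
      obtain R where R: "\<And>z. z \<in> K \<Longrightarrow> cmod z \<le> R"
        using compact_imp_bounded[OF K(1)] by (auto simp: bounded_iff)
      obtain z1 where z1: "z1 \<in> K" "\<And>z. z \<in> K \<Longrightarrow> cmod z1 \<le> cmod z"
        using continuous_attains_inf[OF K(1) False, of cmod] by (auto intro: continuous_intros)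
      define d where "d = cmod z1"
      have d: "0 < d" "\<And>z. z \<in> K \<Longrightarrow> d \<le> cmod z" using z1 z0 K by (auto simp: d_def)
      have est: "cmod (\<psi> k z - f z) \<le> (M / c\<^sup>2 * (1 / d\<^sup>2 + R\<^sup>2 + 1)) * (1 / real (Suc k))"
        if z: "z \<in> K" for k z
      proof -
        have zb: "z \<in> open_bisector \<nu>" using z K by auto
        have n0: "1 + of_real (m k) * z\<^sup>2 \<noteq> 0" "1 + of_real (1 / m k) * z\<^sup>2 \<noteq> 0"
          using nz[OF zb, of "m k"] nz[OF zb, of "1 / m k"] m[of k] by auto
        \<comment> \<open>\<open>e\<close> is 1 / g - 1 multiplied out, so that 1 - g = e g. Its
          three terms tend to 0 uniformly on \<open>K\<close>, which is bounded and stays away from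
          0.\<close>
        define e where "e = 1 / (complex_of_real (m k) * z\<^sup>2) + of_real (1 / m k) * z\<^sup>2 + 1 / of_real ((m k)\<^sup>2)"
        have mz: "complex_of_real (m k) \<noteq> 0" using m[of k] by auto
        have "e * (of_real (m k) * z\<^sup>2) = 1 + (z\<^sup>2)\<^sup>2 + z\<^sup>2 / of_real (m k)"
          using mz z0[OF zb] by (simp add: e_def field_simps power2_eq_square)
        also have "\<dots> = (1 + of_real (m k) * z\<^sup>2) * (1 + of_real (1 / m k) * z\<^sup>2) - of_real (m k) * z\<^sup>2"
          using mz by (simp add: field_simps power2_eq_square)
        finally have "e * g k z = 1 - g k z"
          using n0 unfolding g_def by (simp add: diff_divide_distrib)
        then have "f z * g k z * e = f z * (1 - g k z)"
          by (simp add: mult_ac)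
        then have eq: "\<psi> k z - f z = - (f z * g k z * e)"
          using z0[OF zb] by (simp add: \<psi>_def right_diff_distrib)
        have "cmod e \<le> 1 / (m k * (cmod z)\<^sup>2) + (cmod z)\<^sup>2 / m k + 1 / (m k)\<^sup>2"
          unfolding e_def
          by (rule order_trans[OF norm_triangle_ineq] add_mono order_trans[OF norm_triangle_ineq])+
            (use m[of k] in \<open>auto simp: norm_mult norm_divide norm_power\<close>)
        also have "\<dots> \<le> 1 / (m k * d\<^sup>2) + R\<^sup>2 / m k + 1 / m k"
          using m[of k] d(1) d(2)[OF z] R[OF z]
          by (intro add_mono divide_left_mono divide_right_mono mult_left_mono power_mono)
             (auto simp: power2_eq_square intro!: mult_pos_pos)
        also have "\<dots> = (1 / d\<^sup>2 + R\<^sup>2 + 1) * (1 / m k)"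
          by (simp add: add_divide_distrib mult.commute)
        also have "\<dots> \<le> (1 / d\<^sup>2 + R\<^sup>2 + 1) * (1 / real (Suc k))"
          by (intro mult_left_mono divide_left_mono) (auto simp: m_def power2_eq_square add_nonneg_nonneg)
        finally have e: "cmod e \<le> (1 / d\<^sup>2 + R\<^sup>2 + 1) * (1 / real (Suc k))" .
        have "cmod (f z * g k z) \<le> M / c\<^sup>2"
          using bound[OF zb, of k] z0[OF zb] by (simp add: \<psi>_def)
        from mult_mono[OF this e] show ?thesis
          using M_nn by (simp add: eq norm_mult mult_ac)
      qed
      have lim: "(\<lambda>k. (M / c\<^sup>2 * (1 / d\<^sup>2 + R\<^sup>2 + 1)) * (1 / real (Suc k))) \<longlonglongrightarrow> 0"
        using LIMSEQ_inverse_real_of_nat[THEN tendsto_mult_right_zero] by (simp only: inverse_eq_divide)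
      show ?thesis
      proof (rule uniform_limitI)
        fix e :: real assume "0 < e"
        with lim have "eventually (\<lambda>k. (M / c\<^sup>2 * (1 / d\<^sup>2 + R\<^sup>2 + 1)) * (1 / real (Suc k)) < e) sequentially"
          by (rule order_tendstoD)
        then show "\<forall>\<^sub>F k in sequentially. \<forall>z\<in>K. dist (\<psi> k z) (f z) < e"
          by eventually_elim (auto simp only: dist_norm intro: le_less_trans[OF est])
      qed
    qed simp
  qed
qed

text \<open>\<open>op_inv\<close> is a definite description, so the value at 0 also needs
  uniqueness. The spectral inclusion gives it for z Id - T, and multiplication by z carries it over
  to Id - z^(-1) T.\<close>

lemma resolvent_op_zero:
  assumes T0: "(0, 0) \<in> T" and b: "bisectorial p T \<omega>" and z: "z \<notin> bisector \<omega>"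
  shows "resolvent_op T (- inverse z) 0 = 0"
proof -
  have z0: "z \<noteq> 0" using z by (auto simp: bisector_def)
  have "boundedly_invertible p (op_affine z (-1) T)"
    using b z by (auto simp: bisectorial_def op_spectrum_def)
  then have uniq: "\<exists>!u. (u, 0) \<in> op_affine z (-1) T"
    by (auto simp: boundedly_invertible_def)
  have sub: "(u, 0) \<in> op_affine z (-1) T" if A: "(u, 0) \<in> op_affine 1 (- inverse z) T" for u
  proof -
    obtain w where w: "(u, w) \<in> T" "0 = cscale 1 u + cscale (- inverse z) w"
      using A unfolding op_affine_def by blast
    have "u = cscale (inverse z) w"
      using w(2) cscale_simps(4)[of "-1" "inverse z" w]
      by (metis add_eq_0_iff cscale_simps(2) cscale_simps(4) cscale_simps(5) minus_minus mult_minus1)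
    then have "cscale z u + cscale (-1) w = 0"
      using z0 by simp
    then show ?thesis using w(1) unfolding op_affine_def by force
  qed
  have "(0, 0) \<in> op_affine a b T" for a b
    using T0 unfolding op_affine_def by force
  then show ?thesis
    unfolding resolvent_op_def op_inv_def using uniq sub by (intro the_equality) blast+
qed

lemma lpnorm_sum_le:
  assumes "1 \<le> p" "\<And>i. i \<in> S \<Longrightarrow> u i \<in> Lp p"
  shows "(\<Sum>i\<in>S. u i) \<in> Lp p \<and> lpnorm p (\<Sum>i\<in>S. u i) \<le> (\<Sum>i\<in>S. lpnorm p (u i))"
  using assms(2)
proof (induction S rule: infinite_finite_induct)
  case (insert i S)
  then show ?case
    using Lp_add[OF assms(1), of "u i" "\<Sum>i\<in>S. u i"] lpnorm_triangle[OF assms(1), of "u i" "\<Sum>i\<in>S. u i"]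
    by auto
qed auto

lemma Lp_simple_integral_le:
  assumes p: "1 \<le> p" and s: "Lp_simple p M s"
  shows "Lp_simple_integral M s \<in> Lp p"
    and "ennreal (lpnorm p (Lp_simple_integral M s)) \<le> (\<integral>\<^sup>+t. ennreal (lpnorm p (s t)) \<partial>M)"
proof -
  note sD = s[unfolded Lp_simple_def]
  define A where "A y = {t \<in> space M. s t = y}" for y
  have A: "A y \<in> sets M" for y using sD by (auto simp: A_def)
  have fin: "finite (s ` space M)" using sD by auto
  have *: "cscale (of_real (measure M (A y))) y \<in> Lp p" if "y \<in> s ` space M" for y
    using sD that p by (intro Lp_cscale) auto
  show "Lp_simple_integral M s \<in> Lp p"
    unfolding Lp_simple_integral_def A_def[symmetric] using lpnorm_sum_le[OF p *, of "s ` space M" "\<lambda>y. y"] by auto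
  have "lpnorm p (Lp_simple_integral M s) \<le> (\<Sum>y\<in>s ` space M. lpnorm p (cscale (of_real (measure M (A y))) y))"
    unfolding Lp_simple_integral_def A_def[symmetric] using lpnorm_sum_le[OF p *, of "s ` space M" "\<lambda>y. y"] by auto
  also have "\<dots> = (\<Sum>y\<in>s ` space M. lpnorm p y * measure M (A y))"
    using p by (simp add: lpnorm_cscale mult.commute)
  finally have "ennreal (lpnorm p (Lp_simple_integral M s)) \<le> ennreal (\<Sum>y\<in>s ` space M. lpnorm p y * measure M (A y))"
    by (rule ennreal_leI)
  also have "\<dots> = (\<Sum>y\<in>s ` space M. ennreal (lpnorm p y) * ennreal (measure M (A y)))"
    by (simp add: ennreal_mult sum_ennreal[symmetric])
  \<comment> \<open>Only an inequality: the level set of the value 0 may have infinite measure, and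
    \<open>measure\<close> is 0 there by default.\<close>
  also have "\<dots> \<le> (\<Sum>y\<in>s ` space M. ennreal (lpnorm p y) * emeasure M (A y))"
    by (intro sum_mono mult_left_mono) (auto simp: measure_def ennreal_enn2real_if)
  also have "\<dots> = (\<integral>\<^sup>+t. (\<Sum>y\<in>s ` space M. ennreal (lpnorm p y) * indicator (A y) t) \<partial>M)"
    using A by (simp add: nn_integral_sum nn_integral_cmult_indicator)
  also have "\<dots> = (\<integral>\<^sup>+t. ennreal (lpnorm p (s t)) \<partial>M)"
  proof (rule nn_integral_cong)
    fix t assume t: "t \<in> space M"
    have "(\<Sum>y\<in>s ` space M. ennreal (lpnorm p y) * indicator (A y) t) = (\<Sum>y\<in>s ` space M. if y = s t then ennreal (lpnorm p y) else 0)"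
      using t by (intro sum.cong) (auto simp: A_def)
    also have "\<dots> = ennreal (lpnorm p (s t))"
      using t fin by simp
    finally show "(\<Sum>y\<in>s ` space M. ennreal (lpnorm p y) * indicator (A y) t) = ennreal (lpnorm p (s t))" .
  qed
  finally show "ennreal (lpnorm p (Lp_simple_integral M s)) \<le> (\<integral>\<^sup>+t. ennreal (lpnorm p (s t)) \<partial>M)" .
qed

text \<open>Uniqueness is the point. For every admissible sequence of simple functions the norms of
  the integrals are at most the integrals of the norms, which tend to 0; a description by THE then
  denotes 0.\<close>

lemma has_Lp_integral_zero:
  fixes F :: "'a \<Rightarrow> ('n::finite, 'm::finite) vfun"
  assumes p: "1 \<le> p" and F: "\<And>t. t \<in> space M \<Longrightarrow> F t = 0"
  shows "has_Lp_integral p M F w \<longleftrightarrow> w = 0"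
proof
  assume "has_Lp_integral p M F w"
  then obtain s where s: "\<And>i. Lp_simple p M (s i)"
    and lim: "(\<lambda>i. \<integral>\<^sup>+t. ennreal (lpnorm p (F t - s i t)) \<partial>M) \<longlonglongrightarrow> 0"
    and w: "Lp_lim p (\<lambda>i. Lp_simple_integral M (s i)) w"
    by (auto simp: has_Lp_integral_def)
  have "(\<integral>\<^sup>+t. ennreal (lpnorm p (F t - s i t)) \<partial>M) = (\<integral>\<^sup>+t. ennreal (lpnorm p (s i t)) \<partial>M)" for i
    using F p by (intro nn_integral_cong) simp
  with lim have "(\<lambda>i. \<integral>\<^sup>+t. ennreal (lpnorm p (s i t)) \<partial>M) \<longlonglongrightarrow> 0" by simp
  then have "(\<lambda>i. ennreal (lpnorm p (Lp_simple_integral M (s i)))) \<longlonglongrightarrow> ennreal 0"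
    unfolding ennreal_0
    by (rule tendsto_sandwich[OF _ _ tendsto_const, rotated 2]) (auto simp: Lp_simple_integral_le(2)[OF p s])
  then have "(\<lambda>i. lpnorm p (Lp_simple_integral M (s i) - 0)) \<longlonglongrightarrow> 0"
    by (subst (asm) tendsto_ennreal_iff) auto
  then have "Lp_lim p (\<lambda>i. Lp_simple_integral M (s i)) 0"
    using Lp_simple_integral_le(1)[OF p s] by (simp add: Lp_lim_def)
  with w show "w = 0" by (rule Lp_lim_unique[OF p])
next
  assume w: "w = 0"
  have "Lp_simple p M (\<lambda>_. 0 :: ('n, 'm) vfun)"
    by (auto simp: Lp_simple_def image_constant_conv)
  moreover have "Lp_simple_integral M (\<lambda>_. 0 :: ('n, 'm) vfun) = 0"
    by (simp add: Lp_simple_integral_def image_constant_conv)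
  moreover have "(\<lambda>t. lpnorm p (F t)) \<in> borel_measurable M"
    using F by (subst measurable_cong[of _ _ "\<lambda>_. 0"]) auto
  moreover have "(\<integral>\<^sup>+t. ennreal (lpnorm p (F t)) \<partial>M) = 0"
    using F by (subst nn_integral_cong[of _ _ "\<lambda>_. 0"]) auto
  ultimately show "has_Lp_integral p M F w"
    unfolding has_Lp_integral_def w using F
    by (intro conjI exI[of _ "\<lambda>_ _. 0"]) (auto simp: Lp_lim_def)
qed

text \<open>The boundary rays with angle \<theta> > \<omega> avoid the closed bisector of angle
  \<omega>, so the resolvents in the integrand map 0 to 0 and the integrand vanishes.\<close>

lemma psi_calc_zero:
  assumes p: "1 \<le> p" and T0: "(0, 0) \<in> T" and b: "bisectorial p T \<omega>"
    and \<omega>: "0 \<le> \<omega>" "\<omega> < \<nu>" "\<nu> < pi / 2"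
  shows "psi_calc p T \<omega> \<nu> \<psi> 0 = 0"
proof -
  have 0: "psi_integrand T \<psi> 0 \<theta> t = 0" if "\<omega> < \<theta>" "\<theta> < \<nu>" "0 < t" for \<theta> t
  proof -
    have ray: "of_real t * cis \<phi> \<notin> bisector \<omega> \<and> - (of_real t * cis \<phi>) \<notin> bisector \<omega>" if "\<bar>\<phi>\<bar> = \<theta>" for \<phi>
    proof -
      have "Arg (of_real t * cis \<phi>) = \<phi>"
        using that \<open>\<theta> < \<nu>\<close> \<omega> \<open>0 < t\<close> by (intro Arg_unique[of t]) (auto simp: cis_conv_exp)
      moreover have "of_real t * cis \<phi> \<noteq> 0" using \<open>0 < t\<close> by simp
      ultimately show ?thesis
        using that \<open>\<theta> < \<nu>\<close> \<open>\<omega> < \<theta>\<close> \<omega> by (auto simp: bisector_def Arg_minus split: if_splits)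
    qed
    have a: "\<bar>\<theta>\<bar> = \<theta>" "\<bar>- \<theta>\<bar> = \<theta>" using that \<omega> by auto
    show ?thesis
      unfolding psi_integrand_def Let_def
      using ray[OF a(1)] ray[OF a(2)]
      by (simp only: resolvent_op_zero[OF T0 b] cscale_simps not_False_eq_True) simp
  qed
  have iff: "has_Lp_integral p (restrict_space lborel {0<..}) (psi_integrand T \<psi> 0 \<theta>) w \<longleftrightarrow> w = 0"
    if "\<omega> < \<theta>" "\<theta> < \<nu>" for \<theta> w
    using 0[OF that] by (intro has_Lp_integral_zero[OF p]) (auto simp: space_restrict_space)
  \<comment> \<open>Some angle must exist here; otherwise the condition inside THE would be vacuous
    and hold for every \<open>w\<close>.\<close>
  obtain \<theta> where "\<omega> < \<theta>" "\<theta> < \<nu>" using dense[OF \<omega>(2)] by blast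
  then have "(THE w. \<forall>\<theta>. \<omega> < \<theta> \<and> \<theta> < \<nu> \<longrightarrow>
          has_Lp_integral p (restrict_space lborel {0<..}) (psi_integrand T \<psi> 0 \<theta>) w) = 0"
    by (intro the_equality) (auto simp: iff)
  then show ?thesis by (simp add: psi_calc_def)
qed

text \<open>A vector of the null space decomposes as \<open>(u, 0)\<close>, so only the calculus at
  0 remains to be evaluated.\<close>

lemma Hinf0_calc_null_space:
  assumes p: "1 \<le> p" and T0: "(0, 0) \<in> T" and b: "bisectorial p T \<omega>"
    and kr: "kernel_range_decomposition p T"
    and \<omega>: "0 \<le> \<omega>" "\<omega> < \<nu>" "\<nu> < pi / 2" and f: "f \<in> Hinf0 \<nu>"
    and u: "u \<in> null_space T" "u \<in> Lp p"
  shows "Hinf0_calc p T \<omega> \<nu> f u = cscale (f 0) u"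
proof -
  have 0: "0 \<in> Lp_closure p (Range T)"
  proof -
    have "(\<forall>k::nat. 0 \<in> Range T) \<and> Lp_lim p (\<lambda>_. 0) 0"
      using T0 by (auto intro: Lp_lim_const)
    then show ?thesis
      unfolding Lp_closure_def by (intro CollectI exI[of _ "\<lambda>_. 0"])
  qed
  have ex1: "\<exists>!(a, b). a \<in> null_space T \<and> b \<in> Lp_closure p (Range T) \<and> u = a + b"
    using kr u(2) by (auto simp: kernel_range_decomposition_def)
  have the: "(THE (a, b). a \<in> null_space T \<and> b \<in> Lp_closure p (Range T) \<and> u = a + b) = (u, 0)"
    by (rule the1_equality[OF ex1]) (use u 0 in auto)
  obtain \<psi> :: "nat \<Rightarrow> complex \<Rightarrow> complex" and M where \<psi>: "\<And>k. \<psi> k \<in> Psi \<nu>"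
    "\<And>k z. z \<in> open_bisector \<nu> \<Longrightarrow> cmod (\<psi> k z) \<le> M"
    "\<And>K. compact K \<Longrightarrow> K \<subseteq> open_bisector \<nu> \<Longrightarrow> uniform_limit K \<psi> f sequentially"
    using Psi_approximation[OF f] \<omega> by (metis order_le_less_trans)
  have z: "psi_calc p T \<omega> \<nu> \<phi> 0 = 0" for \<phi>
    by (rule psi_calc_zero[OF p T0 b \<omega>])
  have "Hinf_calc p T \<omega> \<nu> f 0 = 0"
    unfolding Hinf_calc_def z
  proof (rule the_equality)
    show "\<forall>\<psi>. (\<forall>k. \<psi> k \<in> Psi \<nu>) \<longrightarrow>
        (\<exists>M. \<forall>k::nat. \<forall>z\<in>open_bisector \<nu>. cmod (\<psi> k z) \<le> M) \<longrightarrow>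
        (\<forall>K. compact K \<and> K \<subseteq> open_bisector \<nu> \<longrightarrow> uniform_limit K \<psi> f sequentially) \<longrightarrow>
        Lp_lim p (\<lambda>k. 0) 0"
      by (auto intro: Lp_lim_const)
    fix w
    assume "\<forall>\<psi>. (\<forall>k. \<psi> k \<in> Psi \<nu>) \<longrightarrow>
        (\<exists>M. \<forall>k::nat. \<forall>z\<in>open_bisector \<nu>. cmod (\<psi> k z) \<le> M) \<longrightarrow>
        (\<forall>K. compact K \<and> K \<subseteq> open_bisector \<nu> \<longrightarrow> uniform_limit K \<psi> f sequentially) \<longrightarrow>
        Lp_lim p (\<lambda>k. 0) w"
    \<comment> \<open>An actual approximating sequence is what pins down \<open>w\<close>: with
      none, the condition would hold vacuously for every \<open>w\<close>.\<close>
    then have "Lp_lim p (\<lambda>k. 0) w"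
      using \<psi> by blast
    then show "w = 0" by (rule Lp_lim_unique[OF p]) (auto intro: Lp_lim_const)
  qed
  then show ?thesis
    by (simp add: Hinf0_calc_def the)
qed

section \<open>Linear algebra of the symbol\<close>

text \<open>Polynomial functions of a real vector with complex coefficients, generated by rules so
  that the constant-coefficient operator p(\<partial>) can later be built by induction along
  them.\<close>

inductive_set cpoly :: "(real^'n \<Rightarrow> complex) set" where
  const: "(\<lambda>_. c) \<in> cpoly"
| coord: "(\<lambda>\<xi>. of_real (\<xi> $ j)) \<in> cpoly"
| add: "p \<in> cpoly \<Longrightarrow> q \<in> cpoly \<Longrightarrow> (\<lambda>\<xi>. p \<xi> + q \<xi>) \<in> cpoly"
| mult: "p \<in> cpoly \<Longrightarrow> q \<in> cpoly \<Longrightarrow> (\<lambda>\<xi>. p \<xi> * q \<xi>) \<in> cpoly"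

lemma cpoly_sum: "(\<And>i. i \<in> S \<Longrightarrow> p i \<in> cpoly) \<Longrightarrow> (\<lambda>\<xi>. \<Sum>i\<in>S. p i \<xi>) \<in> cpoly"
  by (induction S rule: infinite_finite_induct) (auto intro: cpoly.intros)

lemma cpoly_prod: "(\<And>i. i \<in> S \<Longrightarrow> p i \<in> cpoly) \<Longrightarrow> (\<lambda>\<xi>. \<Prod>i\<in>S. p i \<xi>) \<in> cpoly"
  by (induction S rule: infinite_finite_induct) (auto intro: cpoly.intros)

lemma cpoly_det:
  fixes A :: "real^'n \<Rightarrow> complex^'m^'m"
  assumes "\<And>i j. (\<lambda>\<xi>. A \<xi> $ i $ j) \<in> cpoly"
  shows "(\<lambda>\<xi>. det (A \<xi>)) \<in> cpoly"
  unfolding det_def by (intro cpoly_sum cpoly.mult cpoly.const cpoly_prod assms)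

lemma cpoly_symbol: "(\<lambda>\<xi>. symbol Dh \<xi> $ i $ k) \<in> cpoly"
proof -
  have "(\<lambda>\<xi>. symbol Dh \<xi> $ i $ k) = (\<lambda>\<xi>. \<Sum>j\<in>UNIV. of_real (\<xi> $ j) * Dh j $ i $ k)"
    by (simp add: symbol_def fun_eq_iff) (simp add: scaleR_conv_of_real)
  then show ?thesis
    by (auto intro!: cpoly_sum cpoly.mult cpoly.coord cpoly.const)
qed

text \<open>Choose coordinates \<open>i\<close> and \<open>j\<close> with \<open>a $ i\<close> and
  \<open>b $ j\<close> nonzero. One of the two coordinate functionals, or their sum, is nonzero on
  both vectors. The functional is complex linear, without conjugation.\<close>

lemma exists_functional_nonzero_on_two:
  fixes a b :: "complex^'m"
  assumes "a \<noteq> 0" "b \<noteq> 0"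
  obtains m :: "complex^'m" where "(\<Sum>i\<in>UNIV. m $ i * a $ i) = 1" "(\<Sum>i\<in>UNIV. m $ i * b $ i) \<noteq> 0"
proof -
  define L where "L m v = (\<Sum>i\<in>UNIV. m $ i * v $ i)" for m v :: "complex^'m"
  have "\<exists>m. L m a \<noteq> 0 \<and> L m b \<noteq> 0"
  proof -
    obtain i j where ij: "a $ i \<noteq> 0" "b $ j \<noteq> 0"
      using assms by (auto simp: vec_eq_iff)
    have ax: "L (axis k 1) v = v $ k" for k v
      unfolding L_def axis_def by (simp add: if_distrib[where f = "\<lambda>x. x * _"] cong: if_cong)
    have add: "L (m + m') v = L m v + L m' v" for m m' v
      by (simp add: L_def algebra_simps sum.distrib)
    show ?thesis
      using ij ax[of i a] ax[of i b] ax[of j a] ax[of j b] add[of "axis i 1" "axis j 1"]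
      by (metis add.right_neutral add.left_neutral)
  qed
  then obtain m where m: "L m a \<noteq> 0" "L m b \<noteq> 0" by blast
  have "L ((1 / L m a) *s m) v = L m v / L m a" for v
    by (simp add: L_def sum_divide_distrib)
  with m show ?thesis
    by (intro that[of "(1 / L m a) *s m"]) (auto simp: L_def)
qed

text \<open>\<open>X\<close> is a matrix of minimal rank such that \<open>A \<xi>\<^sub>0 + X\<close> is invertible for some \<open>\<xi>\<^sub>0\<close>, and
  \<open>c\<close> is a nonzero vector in its range. Minimality forces the solution \<open>w\<close> of
  \<open>(A \<xi> + X) w = c\<close> to lie in the kernel of \<open>A \<xi>\<close>, and Cramer's rule makes it polynomial
  after multiplication by the determinant.\<close>

lemma singular_imp_polynomial_kernel:
  fixes A :: "real^'n \<Rightarrow> complex^'m^'m"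
  assumes poly: "\<And>i j. (\<lambda>\<xi>. A \<xi> $ i $ j) \<in> cpoly" and sing: "\<And>\<xi>. det (A \<xi>) = 0"
  obtains w :: "real^'n \<Rightarrow> complex^'m" and \<xi>0
  where "\<And>i. (\<lambda>\<xi>. w \<xi> $ i) \<in> cpoly" "\<And>\<xi>. A \<xi> *v w \<xi> = 0" "w \<xi>0 \<noteq> 0"
proof -
  define R where "R X = vec.dim (range ((*v) X))" for X :: "complex^'m^'m"
  define P where "P X \<longleftrightarrow> (\<exists>\<xi>. det (A \<xi> + X) \<noteq> 0)" for X
  \<comment> \<open>At \<xi> = 0 the sum \<open>A 0 + X\<close> is then the identity, so admissible
    \<open>X\<close> exist and one of least rank can be chosen.\<close>
  have "P (mat 1 - A 0)" by (auto simp: P_def intro!: exI[of _ 0])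
  then obtain X where X: "P X" and min: "\<And>Y. P Y \<Longrightarrow> R X \<le> R Y"
    using ex_has_least_nat[of P _ R] by metis
  have "X \<noteq> 0" using X sing by (auto simp: P_def)
  then have "\<exists>z. X *v z \<noteq> 0" by (metis matrix_eq matrix_vector_mult_0)
  then obtain z c where c: "c = X *v z" "c \<noteq> 0" by blast
  have ker: "A \<xi> *v w = 0" if d: "det (A \<xi> + X) \<noteq> 0" and w: "(A \<xi> + X) *v w = c" for \<xi> w
  proof (rule ccontr)
    assume nz: "A \<xi> *v w \<noteq> 0"
    obtain m :: "complex^'m" where m: "(\<Sum>i\<in>UNIV. m $ i * c $ i) = 1" "(\<Sum>i\<in>UNIV. m $ i * (A \<xi> *v w) $ i) \<noteq> 0"
      using exists_functional_nonzero_on_two[OF c(2) nz] by blast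
    define L where "L v = (\<Sum>i\<in>UNIV. m $ i * v $ i)" for v
    have L: "L (u + v) = L u + L v" "L (u - v) = L u - L v" "L (k *s v) = k * L v" for u v k
      by (auto simp: L_def algebra_simps sum.distrib sum_subtractf sum_distrib_left)
    \<comment> \<open>\<open>E\<close> is the projection along \<open>c\<close> onto the kernel of
      \<open>L\<close>, as L c = 1. Since \<open>c\<close> lies in the range of \<open>X\<close>,
      the product \<open>E ** X\<close> has smaller rank; yet adding it to \<open>A \<xi>\<close>
      will still give an invertible matrix.\<close>
    define E :: "complex^'m^'m" where "E = (\<chi> i j. (if i = j then 1 else 0) - c $ i * m $ j)"
    have E: "E *v v = v - L v *s c" for v
    proof -
      have "((if i = j then 1 else 0) - c $ i * m $ j) * v $ j = (if i = j then v $ j else 0) - c $ i * (m $ j * v $ j)" for i j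
        by (simp add: algebra_simps)
      then show ?thesis
        by (simp add: E_def L_def vec_eq_iff matrix_vector_mult_def sum_subtractf
            sum_distrib_left mult.commute[of _ "c $ _"])
    qed
    define Y where "Y = E ** X"
    have Y: "Y *v v = X *v v - L (X *v v) *s c" for v
      by (simp add: Y_def matrix_vector_mul_assoc[symmetric] E)
    have "inj ((*v) (A \<xi> + Y))"
    proof (rule injI)
      fix v1 v2 assume eq: "(A \<xi> + Y) *v v1 = (A \<xi> + Y) *v v2"
      define v where "v = v1 - v2"
      have "(A \<xi> + Y) *v v = 0"
        using eq by (simp add: v_def matrix_vector_mult_diff_distrib)
      then have "(A \<xi> + X) *v v = L (X *v v) *s c"
        by (simp add: matrix_vector_mult_add_rdistrib Y) (simp add: algebra_simps)
      also have "\<dots> = (A \<xi> + X) *v (L (X *v v) *s w)"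
        using w by (simp add: vector_scalar_commute)
      \<comment> \<open>Every kernel vector of A + Y is a multiple of \<open>w\<close>. Inserting
        this into L (X v) gives L (X v) = L (X v) (1 - L (A w)), and L (A w) \<noteq> 0 forces the
        multiple to be 0.\<close>
      finally have veq: "v = L (X *v v) *s w"
        using d by (metis inj_matrix_vector_mult invertible_det_nz injD)
      have "X *v w = c - A \<xi> *v w"
        using w by (simp add: matrix_vector_mult_add_rdistrib algebra_simps)
      then have Lw: "L (X *v w) = 1 - L (A \<xi> *v w)"
        using m by (simp add: L) (simp add: L_def)
      have "L (X *v v) = L (X *v v) * L (X *v w)"
        by (subst veq) (simp add: vector_scalar_commute L)
      then have "L (X *v v) = 0" using Lw m(2) by (auto simp: L_def algebra_simps)
      then show "v1 = v2" using veq by (simp add: v_def)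
    qed
    then have "P Y"
      unfolding P_def by (metis invertible_det_nz invertible_left_inverse matrix_left_invertible_injective)
    then have le: "R X \<le> R Y" by (rule min)
    have subsp: "vec.subspace (range ((*v) X))"
      by (auto simp: vec.subspace_def image_iff matrix_vector_right_distrib[symmetric]
          vector_scalar_commute[symmetric] intro: exI[of _ 0])
    have rng: "range ((*v) Y) = (*v) E ` range ((*v) X)"
      by (auto simp: Y_def matrix_vector_mul_assoc image_image)
    have "c \<in> range ((*v) X)" using c by auto
    have "E *v c = 0" using m by (simp add: E L_def)
    \<comment> \<open>A basis of the range of \<open>X\<close> that contains \<open>c\<close>: its
      image under \<open>E\<close> spans the range of \<open>Y\<close>, and \<open>c\<close>
      contributes only the zero vector.\<close>
    obtain b where b: "{c} \<subseteq> b" "b \<subseteq> range ((*v) X)" "vec.independent b" "range ((*v) X) \<subseteq> vec.span b"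
      using vec.maximal_independent_subset_extend[of "{c}" "range ((*v) X)"] c
      by (auto simp: vec.dependent_single)
    have fb: "finite b" using b(3) by (rule vec.finiteI_independent)
    have "range ((*v) Y) \<subseteq> vec.span ((*v) E ` b)"
      unfolding rng vec.linear_span_image[OF matrix_vector_mul_linear_gen] using b(4) by blast
    also have "(*v) E ` b = insert 0 ((*v) E ` (b - {c}))"
      using b(1) \<open>E *v c = 0\<close> by auto
    finally have "range ((*v) Y) \<subseteq> vec.span ((*v) E ` (b - {c}))"
      by (simp add: vec.span_insert_0)
    then have "R Y \<le> card ((*v) E ` (b - {c}))"
      unfolding R_def using fb by (intro vec.dim_le_card) auto
    also have "\<dots> \<le> card (b - {c})" using fb by (intro card_image_le) auto
    also have "\<dots> < card b" using fb b(1) by (intro psubset_card_mono) auto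
    also have "card b = R X"
      unfolding R_def using b by (intro vec.basis_card_eq_dim) auto
    finally show False using le by simp
  qed
  define M where "M \<xi> = A \<xi> + X" for \<xi>
  define v where "v \<xi> = (\<chi> k. det (\<chi> i j. if j = k then c $ i else M \<xi> $ i $ j))" for \<xi>
  \<comment> \<open>The components of \<open>v\<close> are Cramer's numerators. The extra
    determinant makes \<open>w\<close> vanish where \<open>M \<xi>\<close> is singular, so that
    \<open>A \<xi>\<close> annihilates \<open>w \<xi>\<close> there as well.\<close>
  define w where "w \<xi> = det (M \<xi>) *s v \<xi>" for \<xi>
  have pM: "(\<lambda>\<xi>. M \<xi> $ i $ j) \<in> cpoly" for i j
    unfolding M_def using cpoly.add[OF poly cpoly.const[of "X $ i $ j"]] by simp
  have "(\<lambda>\<xi>. (\<chi> i j. if j = k then c $ i else M \<xi> $ i $ j) $ i $ j) \<in> cpoly" for i j k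
    by (cases "j = k") (auto intro: cpoly.const pM)
  then have pw: "(\<lambda>\<xi>. w \<xi> $ k) \<in> cpoly" for k
    unfolding w_def v_def by (auto intro!: cpoly.mult cpoly_det pM)
  have Aw: "A \<xi> *v w \<xi> = 0" for \<xi>
  proof (cases "det (M \<xi>) = 0")
    case False
    define y where "y = (\<chi> k. det (\<chi> i j. if j = k then c $ i else M \<xi> $ i $ j) / det (M \<xi>))"
    have "M \<xi> *v y = c"
      unfolding cramer[OF False] y_def ..
    then have "A \<xi> *v y = 0"
      using ker False by (simp add: M_def)
    moreover have "w \<xi> = (det (M \<xi>) * det (M \<xi>)) *s y"
      using False by (simp add: w_def v_def y_def vec_eq_iff)
    ultimately show ?thesis by (simp add: vector_scalar_commute)
  qed (simp add: w_def)
  obtain \<xi>0 where \<xi>0: "det (M \<xi>0) \<noteq> 0" using X by (auto simp: P_def M_def)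
  have "w \<xi>0 \<noteq> 0"
  proof
    assume "w \<xi>0 = 0"
    then have "v \<xi>0 = 0" using \<xi>0 by (simp add: w_def vec_eq_iff)
    then have "(\<chi> k. det (\<chi> i j. if j = k then c $ i else M \<xi>0 $ i $ j) / det (M \<xi>0)) = 0"
      by (simp add: v_def vec_eq_iff)
    then have "M \<xi>0 *v 0 = c" unfolding cramer[OF \<xi>0] by simp
    then show False using c by simp
  qed
  with pw Aw show thesis by (rule that)
qed

section \<open>Invertibility of the symbol: in all directions or in none\<close>

lemma symbol_scaleR: "symbol Dh (r *\<^sub>R \<xi>) = r *\<^sub>R symbol Dh \<xi>"
  by (simp add: symbol_def scaleR_sum_right)

lemma continuous_on_symbol [continuous_intros]:
  "continuous_on S f \<Longrightarrow> continuous_on S (\<lambda>x. symbol Dh (f x))"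
  unfolding symbol_def by (intro continuous_intros)

lemma continuous_on_matrix_vector_mult_left:
  fixes A :: "'a::topological_space \<Rightarrow> complex^'k^'m"
  shows "continuous_on S A \<Longrightarrow> continuous_on S (\<lambda>x. A x *v e)"
  unfolding matrix_vector_mult_def by (intro continuous_intros)

lemma continuous_on_det [continuous_intros]:
  fixes A :: "'a::topological_space \<Rightarrow> complex^'m^'m"
  shows "continuous_on S A \<Longrightarrow> continuous_on S (\<lambda>x. det (A x))"
  unfolding det_def by (intro continuous_intros)

text \<open>The lower bound on the range makes invertibility of the symbol a closed condition on
  \<open>\<xi> \<noteq> 0\<close>, so it holds everywhere or nowhere by connectedness; in dimension one the symbol is a
  multiple of a fixed matrix.\<close>

lemma symbol_singular_or_elliptic:
  fixes Dh :: "'n::finite \<Rightarrow> complex^'m^'m::finite"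
  assumes "D_admissible Dh"
  shows "(\<forall>\<xi>. det (symbol Dh \<xi>) = 0) \<or>
    (\<exists>\<kappa>>0. \<forall>\<xi> e. \<kappa> * norm \<xi> * norm e \<le> norm (symbol Dh \<xi> *v e))"
proof -
  obtain \<kappa> where \<kappa>: "0 < \<kappa>" and low: "\<And>\<xi> v. \<kappa> * norm \<xi> * norm (symbol Dh \<xi> *v v) \<le> norm (symbol Dh \<xi> *v (symbol Dh \<xi> *v v))"
    using assms by (auto simp: D_admissible_def)
  define S where "S = {\<xi>. \<xi> \<noteq> 0 \<and> det (symbol Dh \<xi>) \<noteq> 0}"
  \<comment> \<open>Where the symbol is invertible every \<open>e\<close> lies in its range, so the
    admissibility bound applies to all vectors.\<close>
  have ell: "\<kappa> * norm \<xi> * norm e \<le> norm (symbol Dh \<xi> *v e)" if "\<xi> \<in> S" for \<xi> e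
  proof -
    have "invertible (symbol Dh \<xi>)" using that by (simp add: S_def invertible_det_nz)
    then obtain C where "symbol Dh \<xi> ** C = mat 1" by (auto simp: invertible_def)
    then have "e = symbol Dh \<xi> *v (C *v e)" by (simp add: matrix_vector_mul_assoc)
    then show ?thesis using low[of \<xi> "C *v e"] by simp
  qed
  have "open S"
  proof -
    have "S = {\<xi>. \<xi> \<noteq> 0} \<inter> {\<xi>. det (symbol Dh \<xi>) \<noteq> 0}" by (auto simp: S_def)
    moreover have "open {\<xi>. det (symbol Dh \<xi>) \<noteq> 0}"
      by (intro open_Collect_neq continuous_intros)
    moreover have "open {\<xi>::real^'n. \<xi> \<noteq> 0}"
      by (intro open_Collect_neq continuous_intros)
    ultimately show ?thesis by auto
  qed
  \<comment> \<open>The same lower bound describes a closed set. Together with the openness of det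
    \<noteq> 0 this makes \<open>S\<close> both open and closed in the punctured space.\<close>
  define C where "C = (\<Inter>e. {\<xi>. \<kappa> * norm \<xi> * norm e \<le> norm (symbol Dh \<xi> *v e)})"
  have "closed C"
    unfolding C_def
    by (intro closed_INT ballI closed_Collect_le continuous_intros continuous_on_matrix_vector_mult_left)
  have CS: "C \<inter> {\<xi>. \<xi> \<noteq> 0} = S"
  proof
    show "S \<subseteq> C \<inter> {\<xi>. \<xi> \<noteq> 0}" using ell by (auto simp: C_def S_def)
    show "C \<inter> {\<xi>. \<xi> \<noteq> 0} \<subseteq> S"
    proof
      fix \<xi> assume \<xi>: "\<xi> \<in> C \<inter> {\<xi>. \<xi> \<noteq> 0}"
      have "e = 0" if "symbol Dh \<xi> *v e = 0" for e
      proof -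
        have "\<kappa> * norm \<xi> * norm e \<le> norm (symbol Dh \<xi> *v e)" using \<xi> by (auto simp: C_def)
        then have "\<kappa> * norm \<xi> * norm e \<le> 0" using that by simp
        moreover have "0 < \<kappa> * norm \<xi>" using \<xi> \<kappa> by simp
        ultimately show ?thesis using \<xi> \<kappa> by (auto simp: mult_le_0_iff)
      qed
      then have "det (symbol Dh \<xi>) \<noteq> 0"
        by (metis invertible_det_nz invertible_left_inverse matrix_left_invertible_ker)
      with \<xi> show "\<xi> \<in> S" by (simp add: S_def)
    qed
  qed
  have all: "S = {\<xi>. \<xi> \<noteq> 0}" if ne: "S \<noteq> {}"
  proof (cases "2 \<le> CARD('n)")
    case True
    have conn: "connected (- {0::real^'n})"
      using True by (intro path_connected_imp_connected path_connected_punctured_universe) simp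
    have "- {0} \<subseteq> S \<or> - {0} \<inter> S = {}"
    proof -
      have "openin (top_of_set (- {0})) S"
        using \<open>open S\<close> by (intro open_openin_trans) (auto simp: S_def openin_open_eq)
      moreover have "closedin (top_of_set (- {0})) S"
        using \<open>closed C\<close> CS by (auto simp: closedin_closed Compl_eq)
      ultimately show ?thesis
        using conn unfolding connected_clopen by blast
    qed
    then show ?thesis using ne by (auto simp: S_def)
  next
    case False
    \<comment> \<open>The punctured line is disconnected, but here homogeneity suffices: every \<xi>
      is a real multiple of \<open>\<xi>0\<close>, possibly a negative one.\<close>
    then have "CARD('n) = 1" by (metis One_nat_def Suc_leI le_antisym not_less_eq_eq numeral_2_eq_2 zero_less_card_finite)
    then obtain j :: 'n where j: "UNIV = {j}" by (metis card_1_singletonE)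
    obtain \<xi>0 where \<xi>0: "\<xi>0 \<in> S" using ne by auto
    have j0: "\<xi> $ j \<noteq> 0" if "\<xi> \<noteq> 0" for \<xi> :: "real^'n"
    proof
      assume "\<xi> $ j = 0"
      then have "\<forall>i\<in>UNIV. \<xi> $ i = 0" unfolding j by simp
      then show False using that by (simp add: vec_eq_iff)
    qed
    have "\<xi> \<in> S" if "\<xi> \<noteq> 0" for \<xi>
    proof -
      have nz: "\<xi> $ j \<noteq> 0" "\<xi>0 $ j \<noteq> 0" using j0[OF that] j0[of \<xi>0] \<xi>0 by (auto simp: S_def)
      define r where "r = \<xi> $ j / \<xi>0 $ j"
      have "\<forall>i\<in>UNIV. \<xi> $ i = r * \<xi>0 $ i" unfolding j using nz by (simp add: r_def)
      then have eq: "\<xi> = r *\<^sub>R \<xi>0" by (simp add: vec_eq_iff)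
      have "r \<noteq> 0" using nz by (simp add: r_def)
      have "\<xi> \<in> C"
      proof -
        have "\<kappa> * norm \<xi> * norm e \<le> norm (symbol Dh \<xi> *v e)" for e
        proof -
          have "symbol Dh \<xi> *v e = of_real r *s (symbol Dh \<xi>0 *v e)"
            unfolding eq symbol_scaleR
            by (simp add: vec_eq_iff matrix_vector_mult_def sum_distrib_left) (simp add: scaleR_conv_of_real mult_ac)
          then have "norm (symbol Dh \<xi> *v e) = \<bar>r\<bar> * norm (symbol Dh \<xi>0 *v e)"
            by (simp add: norm_smult_vec)
          then show ?thesis using mult_left_mono[OF ell[OF \<xi>0, of e], of "\<bar>r\<bar>"] by (simp add: eq mult_ac)
        qed
        then show ?thesis by (simp add: C_def)
      qed
      then show ?thesis using that CS by auto
    qed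
    then show ?thesis by (auto simp: S_def)
  qed
  show ?thesis
  proof (cases "S = {}")
    case True
    then have *: "det (symbol Dh \<xi>) = 0" if "\<xi> \<noteq> 0" for \<xi> using that by (auto simp: S_def)
    \<comment> \<open>At \<xi> = 0 the symbol is the zero matrix, which is singular because it
      annihilates some unit vector.\<close>
    have "symbol Dh 0 *v (axis undefined 1) = 0"
      by (simp add: symbol_def)
    then have "det (symbol Dh 0) = 0"
      by (metis axis_eq_0_iff inj_matrix_vector_mult invertible_det_nz injD matrix_vector_mult_0_right zero_neq_one)
    with * show ?thesis by metis
  next
    case False
    have "\<kappa> * norm \<xi> * norm e \<le> norm (symbol Dh \<xi> *v e)" for \<xi> e
      by (cases "\<xi> = 0") (use ell all[OF False] in auto)
    then show ?thesis using \<kappa> by blast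
  qed
qed

section \<open>Smooth functions and test functions\<close>

abbreviation dd :: "'a::real_normed_vector \<Rightarrow> ('a \<Rightarrow> 'b::real_normed_vector) \<Rightarrow> 'a \<Rightarrow> 'b" where
  "dd h f x \<equiv> frechet_derivative f (at x) h"

lemma dd_eqI: "(f has_derivative f') (at x) \<Longrightarrow> dd h f x = f' h"
  using frechet_derivative_at by metis

definition smooth :: "(real^'n::finite \<Rightarrow> real) \<Rightarrow> bool" where
  "smooth \<phi> \<longleftrightarrow> (\<forall>k. Ck k \<phi>)"

lemma smoothD:
  assumes "smooth \<phi>"
  shows "\<phi> differentiable (at x)" "smooth (dd h \<phi>)" "continuous_on S \<phi>"
    "(\<phi> has_derivative (\<lambda>h. dd h \<phi> x)) (at x)"
proof -
  have *: "Ck (Suc k) \<phi>" for k using assms by (simp add: smooth_def)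
  show "\<phi> differentiable (at x)" "smooth (dd h \<phi>)"
    using * unfolding smooth_def by auto
  then show "(\<phi> has_derivative (\<lambda>h. dd h \<phi> x)) (at x)"
    using frechet_derivative_works by blast
  have "Ck 0 \<phi>" using assms unfolding smooth_def by blast
  then show "continuous_on S \<phi>"
    by (auto intro: continuous_on_subset)
qed

text \<open>\<open>Ck\<close> recurses on the order, but a family closed under directional
  derivatives can be treated as a whole in one induction on \<open>k\<close>. Each closure property
  of \<open>smooth\<close> below then only needs a suitable family.\<close>

lemma smooth_coinduct:
  assumes "\<phi> \<in> S"
    and diff: "\<And>f x. f \<in> S \<Longrightarrow> f differentiable (at x)" and dd: "\<And>f h. f \<in> S \<Longrightarrow> dd h f \<in> S"
  shows "smooth \<phi>"
proof -
  have "\<forall>f\<in>S. Ck k f" for k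
  proof (induction k)
    case 0
    show ?case
      using diff by (auto intro!: continuous_at_imp_continuous_on differentiable_imp_continuous_within)
  next
    case (Suc k)
    then show ?case using diff dd by auto
  qed
  then show ?thesis using assms(1) by (auto simp: smooth_def)
qed

text \<open>The factor \<open>c\<close> belongs to the invariant family because every derivative
  produces another factor \<open>r\<close>.\<close>

lemma smooth_affine:
  assumes "smooth f"
  shows "smooth (\<lambda>x. c * f (r *\<^sub>R x + y))"
proof -
  define S where "S = {\<lambda>x. c * f (r *\<^sub>R x + y) | c f. smooth f}"
  have der: "((\<lambda>x. c * f (r *\<^sub>R x + y)) has_derivative (\<lambda>h. c * r * dd h f (r *\<^sub>R x + y))) (at x)"
    if "smooth f" for c f x
  proof -
    have "linear (\<lambda>h. dd h f (r *\<^sub>R x + y))"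
      by (rule linear_frechet_derivative[OF smoothD(1)[OF that]])
    from linear_scale[OF this] show ?thesis
      by (auto intro!: derivative_eq_intros has_derivative_compose[OF _ smoothD(4)[OF that], of "\<lambda>x. r *\<^sub>R x + y"]
        simp: mult.assoc)
  qed
  show ?thesis
  proof (rule smooth_coinduct[of _ S])
    show "(\<lambda>x. c * f (r *\<^sub>R x + y)) \<in> S" using assms by (auto simp: S_def)
    fix g h x assume "g \<in> S"
    then obtain d k where g: "g = (\<lambda>x. d * k (r *\<^sub>R x + y))" "smooth k" by (auto simp: S_def)
    show "g differentiable (at x)" using der[OF g(2)] unfolding g(1) by (auto simp: differentiable_def)
    have "dd h g = (\<lambda>x. (d * r) * dd h k (r *\<^sub>R x + y))"
      unfolding g(1) using dd_eqI[OF der[OF g(2)]] by auto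
    then show "dd h g \<in> S"
      unfolding S_def using smoothD(2)[OF g(2), of h] by auto
  qed
qed

lemma smooth_cmult: "smooth f \<Longrightarrow> smooth (\<lambda>x. c * f x)"
  using smooth_affine[of f c 1 0] by simp

lemma smooth_add:
  assumes "smooth f" "smooth g"
  shows "smooth (\<lambda>x. f x + g x)"
proof (rule smooth_coinduct[of _ "{\<lambda>x. f x + g x | f g. smooth f \<and> smooth g}"])
  fix k h x assume "k \<in> {\<lambda>x. f x + g x | f g. smooth f \<and> smooth g}"
  then obtain f g where k: "k = (\<lambda>x. f x + g x)" "smooth f" "smooth g" by auto
  have der: "(k has_derivative (\<lambda>h. dd h f x + dd h g x)) (at x)" for x
    unfolding k(1) by (intro has_derivative_add smoothD k)
  then show "k differentiable (at x)" by (auto simp: differentiable_def)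
  have "dd h k = (\<lambda>x. dd h f x + dd h g x)" using dd_eqI[OF der] by auto
  then show "dd h k \<in> {\<lambda>x. f x + g x | f g. smooth f \<and> smooth g}"
    using smoothD(2)[OF k(2), of h] smoothD(2)[OF k(3), of h]
    by (intro CollectI exI[of _ "dd h f"] exI[of _ "dd h g"]) auto
qed (use assms in auto)

text \<open>By the Leibniz rule the derivative of a product is a sum of two products, so sums have
  to be included to obtain a family closed under differentiation.\<close>

inductive_set sum_of_products :: "(real^'n::finite \<Rightarrow> real) set" where
  mult: "smooth f \<Longrightarrow> smooth g \<Longrightarrow> (\<lambda>x. f x * g x) \<in> sum_of_products"
| add: "f \<in> sum_of_products \<Longrightarrow> g \<in> sum_of_products \<Longrightarrow> (\<lambda>x. f x + g x) \<in> sum_of_products"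

lemma smooth_mult:
  assumes "smooth f" "smooth g"
  shows "smooth (\<lambda>x. f x * g x)"
proof -
  have *: "(\<forall>x. k differentiable (at x)) \<and> (\<forall>h. dd h k \<in> sum_of_products)" if "k \<in> sum_of_products" for k :: "real^'a \<Rightarrow> real"
    using that
  proof induction
    case (mult f g)
    have der: "((\<lambda>x. f x * g x) has_derivative (\<lambda>h. f x * dd h g x + dd h f x * g x)) (at x)" for x
      by (intro has_derivative_mult smoothD mult)
    have "dd h (\<lambda>x. f x * g x) = (\<lambda>x. f x * dd h g x + dd h f x * g x)" for h
      using dd_eqI[OF der] by auto
    then show ?case
      using der mult smoothD(2) by (auto simp: differentiable_def intro!: sum_of_products.intros)
  next
    case (add f g)
    have der: "((\<lambda>x. f x + g x) has_derivative (\<lambda>h. dd h f x + dd h g x)) (at x)" for x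
      using add.IH frechet_derivative_works by (intro has_derivative_add) blast+
    have "dd h (\<lambda>x. f x + g x) = (\<lambda>x. dd h f x + dd h g x)" for h
      using dd_eqI[OF der] by auto
    then show ?case
      using der add by (auto simp: differentiable_def intro!: sum_of_products.add)
  qed
  show ?thesis
    by (rule smooth_coinduct[of _ sum_of_products]) (use * assms in \<open>auto intro: sum_of_products.mult\<close>)
qed

lemma smooth_const: "smooth (\<lambda>_. c)"
proof (rule smooth_coinduct[of _ "{\<lambda>_. c | c. True}"])
  fix f :: "real^'n \<Rightarrow> real" and h assume "f \<in> {\<lambda>_. c | c. True}"
  then obtain c where f: "f = (\<lambda>_. c)" by auto
  have "dd h f = (\<lambda>_. 0)" unfolding f using dd_eqI[OF has_derivative_const] by auto
  then show "dd h f \<in> {\<lambda>_. c | c. True}" by auto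
qed auto

lemma smooth_prod: "(\<And>i. i \<in> S \<Longrightarrow> smooth (f i)) \<Longrightarrow> smooth (\<lambda>x. \<Prod>i\<in>S. f i x)"
  by (induction S rule: infinite_finite_induct) (auto intro: smooth_mult smooth_const)

text \<open>Closure of the one-variable family \<open>G\<close> under derivatives is inherited by
  functions of one affine form. The families used are the exponential, the span of sine and cosine,
  and the flat functions below.\<close>

lemma smooth_ridge:
  fixes a :: "real^'n"
  assumes "g \<in> G" and G: "\<And>g. g \<in> G \<Longrightarrow> \<exists>g'\<in>G. \<forall>t. (g has_real_derivative g' t) (at t)"
  shows "smooth (\<lambda>x. g (a \<bullet> x + b))"
proof -
  define S where "S = {\<lambda>x::real^'n. c * g (a \<bullet> x + b) | c g. g \<in> G}"
  show ?thesis
  proof (rule smooth_coinduct[of _ S])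
    show "(\<lambda>x. g (a \<bullet> x + b)) \<in> S"
      unfolding S_def using assms(1) by (intro CollectI exI[of _ 1] exI[of _ g]) auto
    fix k h x assume "k \<in> S"
    then obtain c g where k: "k = (\<lambda>x. c * g (a \<bullet> x + b))" "g \<in> G" by (auto simp: S_def)
    obtain g' where g': "g' \<in> G" "\<And>t. (g has_real_derivative g' t) (at t)" using G[OF k(2)] by auto
    have der: "(k has_derivative (\<lambda>h. (c * (a \<bullet> h)) * g' (a \<bullet> x + b))) (at x)" for x
      unfolding k(1)
      by (rule derivative_eq_intros has_derivative_compose[OF _ g'(2)[unfolded has_field_derivative_def], of "\<lambda>x. a \<bullet> x + b"] refl)+
        (auto simp: mult_ac)
    show "k differentiable (at x)" using der by (auto simp: differentiable_def)
    have "dd h k = (\<lambda>x. (c * (a \<bullet> h)) * g' (a \<bullet> x + b))" using dd_eqI[OF der] by auto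
    then show "dd h k \<in> S" unfolding S_def using g'(1) by blast
  qed
qed

lemma smooth_exp_inner: "smooth (\<lambda>x. exp (\<zeta> \<bullet> x))"
proof -
  have "smooth (\<lambda>x. exp (\<zeta> \<bullet> x + 0))"
    by (rule smooth_ridge[of _ "{exp}"]) (auto intro: DERIV_exp)
  then show ?thesis by simp
qed

lemma smooth_cos_inner: "smooth (\<lambda>x. cos (\<xi> \<bullet> x))" and smooth_sin_inner: "smooth (\<lambda>x. sin (\<xi> \<bullet> x))"
proof -
  define G where "G = {\<lambda>t. a * cos t + b * sin t | a b :: real. True}"
  have G: "\<exists>g'\<in>G. \<forall>t. (g has_real_derivative g' t) (at t)" if "g \<in> G" for g
  proof -
    obtain a b where g: "g = (\<lambda>t. a * cos t + b * sin t)" using \<open>g \<in> G\<close> by (auto simp: G_def)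
    have "\<forall>t. (g has_real_derivative b * cos t + (- a) * sin t) (at t)"
      unfolding g by (auto intro!: derivative_eq_intros)
    moreover have "(\<lambda>t. b * cos t + (- a) * sin t) \<in> G" unfolding G_def by blast
    ultimately show ?thesis by (rule bexI)
  qed
  have "(\<lambda>t. 1 * cos t + 0 * sin t) \<in> G" "(\<lambda>t. 0 * cos t + 1 * sin t) \<in> G"
    unfolding G_def by blast+
  from smooth_ridge[OF this(1) G, of \<xi> 0] smooth_ridge[OF this(2) G, of \<xi> 0]
  show "smooth (\<lambda>x. cos (\<xi> \<bullet> x))" "smooth (\<lambda>x. sin (\<xi> \<bullet> x))" by auto
qed

section \<open>A smooth compactly supported bump function\<close>

definition exp_flat :: "real poly \<Rightarrow> real \<Rightarrow> real" where
  "exp_flat p t = (if 0 < t then poly p (1 / t) * exp (- (1 / t)) else 0)"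

lemma exp_flat_tendsto_0: "(exp_flat p \<longlongrightarrow> 0) (at_right 0)"
proof -
  have "((\<lambda>t. poly p t * exp (- t)) \<longlongrightarrow> (\<Sum>i\<le>degree p. coeff p i * 0)) at_top"
    unfolding poly_altdef sum_distrib_right mult.assoc
    using tendsto_power_div_exp_0 by (intro tendsto_intros) (simp add: exp_minus field_simps)
  then have "((\<lambda>t. poly p (inverse t) * exp (- inverse t)) \<longlongrightarrow> 0) (at_right 0)"
    using filterlim_compose[OF _ filterlim_inverse_at_top_right] by fastforce
  then show ?thesis
    by (rule Lim_transform_eventually)
      (auto simp: eventually_at_right_field exp_flat_def inverse_eq_divide intro: exI[of _ 1])
qed

text \<open>For t > 0 the derivative of p(1/t) exp(-1/t) is t^(-2) (p - p')(1/t) exp(-1/t), and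
  \<open>[:0, 0, 1:]\<close> is the factor t^(-2) in the variable 1/t. So the family is closed under
  differentiation, also at 0, where the exponential beats every power.\<close>

lemma exp_flat_has_derivative:
  "(exp_flat p has_real_derivative exp_flat ([:0, 0, 1:] * (p - pderiv p)) t) (at t)"
proof -
  consider "0 < t" | "t < 0" | "t = 0" by linarith
  then show ?thesis
  proof cases
    case 1
    have "((\<lambda>t. poly p (1 / t) * exp (- (1 / t))) has_real_derivative exp_flat ([:0, 0, 1:] * (p - pderiv p)) t) (at t)"
      using 1 by (auto intro!: derivative_eq_intros DERIV_chain'[OF _ poly_DERIV]
          simp: exp_flat_def power2_eq_square field_simps)
    then show ?thesis
      by (rule has_field_derivative_transform_within_open[of _ _ _ "{0<..}"]) (use 1 in \<open>auto simp: exp_flat_def\<close>)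
  next
    case 2
    have "((\<lambda>t. 0) has_real_derivative exp_flat ([:0, 0, 1:] * (p - pderiv p)) t) (at t)"
      using 2 by (simp add: exp_flat_def)
    then show ?thesis
      by (rule has_field_derivative_transform_within_open[of _ _ _ "{..<0}"]) (use 2 in \<open>auto simp: exp_flat_def\<close>)
  next
    case 3
    have "((\<lambda>h. (exp_flat p (0 + h) - exp_flat p 0) / h) \<longlongrightarrow> 0) (at 0)"
      unfolding filterlim_at_split
    proof
      show "((\<lambda>h. (exp_flat p (0 + h) - exp_flat p 0) / h) \<longlongrightarrow> 0) (at_left 0)"
        by (rule Lim_transform_eventually[OF tendsto_const])
          (auto simp: eventually_at_left_field exp_flat_def intro: exI[of _ "-1"])
      \<comment> \<open>For h > 0 the quotient is p(1/h) exp(-1/h) / h, which is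
        \<open>exp_flat\<close> of the polynomial x p(x).\<close>
      show "((\<lambda>h. (exp_flat p (0 + h) - exp_flat p 0) / h) \<longlongrightarrow> 0) (at_right 0)"
        by (rule Lim_transform_eventually[OF exp_flat_tendsto_0[of "pCons 0 p"]])
          (auto simp: eventually_at_right_field exp_flat_def intro: exI[of _ 1])
    qed
    then show ?thesis
      using 3 by (simp add: DERIV_def exp_flat_def)
  qed
qed

lemma smooth_exp_flat: "smooth (\<lambda>x. exp_flat p (a \<bullet> x + b))"
  by (rule smooth_ridge[of _ "range exp_flat"]) (use exp_flat_has_derivative in blast)+

lemma test_functions_iff: "\<phi> \<in> test_functions \<longleftrightarrow> smooth \<phi> \<and> bounded {x. \<phi> x \<noteq> 0}"
  by (simp add: test_functions_def smooth_def compact_closure)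

definition bump :: "real^'n::finite \<Rightarrow> real" where
  "bump x = (\<Prod>j\<in>UNIV. exp_flat 1 (1 + x $ j) * exp_flat 1 (1 - x $ j))"

lemma bump_nonneg: "0 \<le> bump x"
  unfolding bump_def by (intro prod_nonneg) (auto simp: exp_flat_def)

lemma bump_0: "0 < bump 0"
  unfolding bump_def by (intro prod_pos) (auto simp: exp_flat_def)

lemma bump_test: "(bump :: real^'n::finite \<Rightarrow> real) \<in> test_functions"
proof -
  have eq: "(bump :: real^'n \<Rightarrow> real) = (\<lambda>x. \<Prod>j\<in>UNIV. exp_flat 1 (axis j 1 \<bullet> x + 1) * exp_flat 1 (axis j (-1) \<bullet> x + 1))"
    by (simp add: fun_eq_iff bump_def inner_axis' add.commute)
  have "smooth (bump :: real^'n \<Rightarrow> real)"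
    unfolding eq by (intro smooth_prod smooth_mult smooth_exp_flat)
  \<comment> \<open>The support lies in the cube [-1, 1]^n; the radius comes from bounding the
    Euclidean norm by the sum of the n coordinates.\<close>
  moreover have "{x :: real^'n. bump x \<noteq> 0} \<subseteq> cball 0 (real CARD('n))"
  proof
    fix x :: "real^'n" assume "x \<in> {x. bump x \<noteq> 0}"
    then have "exp_flat 1 (1 + x $ j) \<noteq> 0 \<and> exp_flat 1 (1 - x $ j) \<noteq> 0" for j
      by (simp add: bump_def)
    then have "0 < 1 + x $ j \<and> 0 < 1 - x $ j" for j
      by (metis exp_flat_def)
    then have "\<bar>x $ j\<bar> \<le> 1" for j
      by (smt (verit))
    then have "(\<Sum>j\<in>UNIV. \<bar>x $ j\<bar>) \<le> (\<Sum>j\<in>(UNIV :: 'n set). 1)"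
      by (intro sum_mono) auto
    then show "x \<in> cball 0 (real CARD('n))"
      using norm_le_l1_cart[of x] by simp
  qed
  ultimately show ?thesis
    unfolding test_functions_iff using bounded_subset[OF bounded_cball] by blast
qed

section \<open>Complex test functions\<close>

definition csmooth :: "(real^'n::finite \<Rightarrow> complex) \<Rightarrow> bool" where
  "csmooth f \<longleftrightarrow> smooth (\<lambda>x. Re (f x)) \<and> smooth (\<lambda>x. Im (f x))"

lemma csmooth_intros:
  "csmooth (\<lambda>_. c)" "smooth \<phi> \<Longrightarrow> csmooth (\<lambda>x. of_real (\<phi> x))"
  "csmooth f \<Longrightarrow> csmooth g \<Longrightarrow> csmooth (\<lambda>x. f x + g x)"
  "csmooth f \<Longrightarrow> csmooth g \<Longrightarrow> csmooth (\<lambda>x. f x * g x)"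
  "csmooth (\<lambda>x. cis (\<xi> \<bullet> x))"
  "csmooth f \<Longrightarrow> csmooth (\<lambda>x. f (r *\<^sub>R x + y))"
  "csmooth f \<Longrightarrow> csmooth (\<lambda>x. cnj (f x))"
proof -
  assume fg: "csmooth f" "csmooth g"
  have "smooth (\<lambda>x. Re (f x) * Re (g x) + (-1) * (Im (f x) * Im (g x)))"
    using fg by (intro smooth_add smooth_cmult smooth_mult) (auto simp: csmooth_def)
  then have "smooth (\<lambda>x. Re (f x) * Re (g x) - Im (f x) * Im (g x))" by simp
  then show "csmooth (\<lambda>x. f x * g x)"
    using fg by (auto simp: csmooth_def intro!: smooth_add smooth_mult)
qed (auto simp: csmooth_def intro: smooth_const smooth_add smooth_cos_inner smooth_sin_inner
    dest: smooth_affine[where c = 1] smooth_cmult[where c = "-1"])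

lemma csmoothD:
  assumes "csmooth f"
  shows "(f has_derivative (\<lambda>h. dd h f x)) (at x)" "csmooth (dd h f)" "continuous_on S f"
    "dd h f x = Complex (dd h (\<lambda>x. Re (f x)) x) (dd h (\<lambda>x. Im (f x)) x)"
    "f \<in> borel_measurable borel"
proof -
  have s: "smooth (\<lambda>x. Re (f x))" "smooth (\<lambda>x. Im (f x))" using assms by (auto simp: csmooth_def)
  have "((\<lambda>x. of_real (Re (f x)) + \<i> * of_real (Im (f x))) has_derivative
    (\<lambda>h. of_real (dd h (\<lambda>x. Re (f x)) x) + \<i> * of_real (dd h (\<lambda>x. Im (f x)) x))) (at x)" for x
    by (intro has_derivative_add has_derivative_mult_right has_derivative_of_real smoothD s)
  then have der: "(f has_derivative (\<lambda>h. of_real (dd h (\<lambda>x. Re (f x)) x) + \<i> * of_real (dd h (\<lambda>x. Im (f x)) x))) (at x)" for x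
    by (simp add: complex_eq[symmetric])
  then show "(f has_derivative (\<lambda>h. dd h f x)) (at x)"
    using frechet_derivative_works differentiable_def by blast
  show eq: "dd h f x = Complex (dd h (\<lambda>x. Re (f x)) x) (dd h (\<lambda>x. Im (f x)) x)" for h x
    by (subst dd_eqI[OF der]) (simp add: complex_eq_iff)
  show "csmooth (dd h f)"
    unfolding csmooth_def eq using smoothD(2)[OF s(1), of h] smoothD(2)[OF s(2), of h] by simp
  have c: "continuous_on S f" for S
    using der by (intro continuous_at_imp_continuous_on) (auto intro: has_derivative_continuous)
  then show "continuous_on S f" "f \<in> borel_measurable borel"
    by (auto intro: borel_measurable_continuous_onI)
qed

lemma dd_of_real:
  "smooth \<phi> \<Longrightarrow> dd h (\<lambda>x. complex_of_real (\<phi> x)) x = of_real (dd h \<phi> x)"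
  by (intro dd_eqI has_derivative_of_real smoothD)

definition ctest :: "(real^'n::finite \<Rightarrow> complex) set" where
  "ctest = {f. csmooth f \<and> bounded {x. f x \<noteq> 0}}"

lemma ctest_iff: "f \<in> ctest \<longleftrightarrow> (\<lambda>x. Re (f x)) \<in> test_functions \<and> (\<lambda>x. Im (f x)) \<in> test_functions"
proof -
  have "{x. f x \<noteq> 0} = {x. Re (f x) \<noteq> 0} \<union> {x. Im (f x) \<noteq> 0}"
    by (auto simp: complex_eq_iff)
  then show ?thesis
    by (auto simp: ctest_def test_functions_iff csmooth_def)
qed

lemma ctest_supp:
  assumes "f \<in> ctest"
  obtains R where "0 < R" "\<And>x. R < norm x \<Longrightarrow> f x = 0"
  using assms unfolding ctest_def bounded_pos by (force simp: not_less[symmetric])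

lemma ctestI: "csmooth f \<Longrightarrow> (\<And>x. R < norm x \<Longrightarrow> f x = 0) \<Longrightarrow> f \<in> ctest"
  unfolding ctest_def bounded_iff by (force simp: not_less[symmetric])

lemma ctest_csmooth: "f \<in> ctest \<Longrightarrow> csmooth f"
  by (simp add: ctest_def)

lemma ctest_of_real: "\<phi> \<in> test_functions \<Longrightarrow> (\<lambda>x. of_real (\<phi> x)) \<in> ctest"
  by (simp add: ctest_def test_functions_iff csmooth_intros)

lemma ctest_mult:
  assumes "f \<in> ctest" "csmooth g"
  shows "(\<lambda>x. f x * g x) \<in> ctest" "(\<lambda>x. g x * f x) \<in> ctest"
proof -
  obtain R where "\<And>x. R < norm x \<Longrightarrow> f x = 0" using ctest_supp[OF assms(1)] by blast
  then show "(\<lambda>x. f x * g x) \<in> ctest" "(\<lambda>x. g x * f x) \<in> ctest"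
    using assms(2) ctest_csmooth[OF assms(1)] by (auto intro!: ctestI[of _ R] csmooth_intros)
qed

lemma ctest_add:
  assumes "f \<in> ctest" "g \<in> ctest"
  shows "(\<lambda>x. f x + g x) \<in> ctest"
proof -
  obtain R where R: "\<And>x. R < norm x \<Longrightarrow> f x = 0" using ctest_supp[OF assms(1)] by blast
  obtain R' where R': "\<And>x. R' < norm x \<Longrightarrow> g x = 0" using ctest_supp[OF assms(2)] by blast
  show ?thesis
    using assms by (intro ctestI[of _ "max R R'"] csmooth_intros) (auto simp: ctest_def R R')
qed

lemma ctest_zero: "(\<lambda>_. 0) \<in> ctest"
  by (intro ctestI[of _ 0] csmooth_intros) auto

lemma ctest_sum: "(\<And>i. i \<in> S \<Longrightarrow> f i \<in> ctest) \<Longrightarrow> (\<lambda>x. \<Sum>i\<in>S. f i x) \<in> ctest"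
  by (induction S rule: infinite_finite_induct) (auto intro: ctest_add ctest_zero)

lemma ctest_cnj: "f \<in> ctest \<Longrightarrow> (\<lambda>x. cnj (f x)) \<in> ctest"
  by (auto simp: ctest_def intro: csmooth_intros)

lemma dd_eq_0_outside:
  assumes "\<And>x. R < norm x \<Longrightarrow> f x = 0" "R < norm x"
  shows "dd h f x = 0"
proof -
  have "(f has_derivative (\<lambda>_. 0)) (at x)"
    by (rule has_derivative_transform_within_open[of "\<lambda>_. 0" _ _ _ "{x. R < norm x}"])
      (use assms in \<open>auto intro!: open_Collect_less continuous_intros\<close>)
  then show ?thesis by (rule dd_eqI)
qed

lemma ctest_dd:
  assumes "f \<in> ctest"
  shows "dd h f \<in> ctest"
proof -
  obtain R where R: "\<And>x. R < norm x \<Longrightarrow> f x = 0" using ctest_supp[OF assms(1)] by blast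
  show ?thesis
    using assms by (intro ctestI[of _ R] csmoothD dd_eq_0_outside[of R, OF R]) (auto simp: ctest_def)
qed

lemma ctest_affine:
  fixes f :: "real^'n::finite \<Rightarrow> complex"
  assumes "f \<in> ctest" "r \<noteq> 0"
  shows "(\<lambda>x. f (r *\<^sub>R x + y)) \<in> ctest"
proof -
  obtain R where R: "\<And>x. R < norm x \<Longrightarrow> f x = 0" using ctest_supp[OF assms(1)] by blast
  show ?thesis
  proof (rule ctestI[of _ "(R + norm y) / \<bar>r\<bar>"])
    show "csmooth (\<lambda>x. f (r *\<^sub>R x + y))" using assms by (intro csmooth_intros) (auto simp: ctest_def)
    fix x :: "real^'n" assume "(R + norm y) / \<bar>r\<bar> < norm x"
    then have "R + norm y < norm (r *\<^sub>R x)" using assms(2) by (simp add: field_simps)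
    then show "f (r *\<^sub>R x + y) = 0"
      using norm_triangle_ineq2[of "r *\<^sub>R x" "- y"] by (intro R) simp
  qed
qed

lemma ctest_bounded:
  assumes "f \<in> ctest"
  obtains M where "0 < M" "\<And>x. cmod (f x) \<le> M"
proof -
  obtain R where R: "0 < R" "\<And>x. R < norm x \<Longrightarrow> f x = 0" using ctest_supp[OF assms(1)] by blast
  have "bounded (f ` cball 0 R)"
    using assms by (intro compact_imp_bounded compact_continuous_image csmoothD) (auto simp: ctest_def)
  then obtain M where M: "0 < M" "\<And>x. x \<in> cball 0 R \<Longrightarrow> cmod (f x) \<le> M"
    by (auto simp: bounded_pos)
  have "cmod (f x) \<le> M" for x
    using M(2)[of x] R(2)[of x] M(1) by (cases "norm x \<le> R") auto
  with M(1) show ?thesis by (rule that)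
qed

section \<open>Integrals against complex test functions\<close>

definition loc_integrable :: "(real^'n::finite \<Rightarrow> complex) \<Rightarrow> bool" where
  "loc_integrable g \<longleftrightarrow> (\<forall>R. set_integrable lborel (cball 0 R) g)"

lemma ctest_times_integrable:
  assumes f: "f \<in> ctest" and g: "loc_integrable g"
  shows "integrable lborel (\<lambda>x. f x * g x)"
proof -
  obtain R where R: "0 < R" "\<And>x. R < norm x \<Longrightarrow> f x = 0" using ctest_supp[OF f] by blast
  obtain M where M: "0 < M" "\<And>x. cmod (f x) \<le> M" using ctest_bounded[OF f] by blast
  have [measurable]: "f \<in> borel_measurable borel" using f by (auto simp: ctest_def intro: csmoothD)
  have i: "integrable lborel (\<lambda>x. indicat_real (cball 0 R) x *\<^sub>R g x)"
    using g by (auto simp: loc_integrable_def set_integrable_def)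
  have eq: "(\<lambda>x. f x * g x) = (\<lambda>x. f x * (indicat_real (cball 0 R) x *\<^sub>R g x))"
    using R(2) by (auto simp: fun_eq_iff indicator_def not_le[symmetric])
  show ?thesis
    unfolding eq
  proof (rule Bochner_Integration.integrable_bound[OF integrable_mult_right[OF integrable_norm[OF i], of M]])
    show "(\<lambda>x. f x * (indicat_real (cball 0 R) x *\<^sub>R g x)) \<in> borel_measurable lborel"
      using borel_measurable_integrable[OF i] by measurable
    show "AE x in lborel. norm (f x * (indicat_real (cball 0 R) x *\<^sub>R g x)) \<le> norm (M * norm (indicat_real (cball 0 R) x *\<^sub>R g x))"
      using M by (intro AE_I2) (simp add: norm_mult mult_right_mono abs_mult mult.left_commute mult_left_mono)
  qed
qed

lemma loc_integrable_bounded: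
  assumes [measurable]: "g \<in> borel_measurable borel" and "\<And>x. cmod (g x) \<le> M"
  shows "loc_integrable g"
  unfolding loc_integrable_def set_integrable_def
proof
  fix R
  have "integrable lborel (\<lambda>x. M * indicat_real (cball 0 R) x)"
    by (intro integrable_mult_right integrable_real_indicator) (simp_all add: emeasure_lborel_cball_finite[unfolded infinity_ennreal_def])
  then show "integrable lborel (\<lambda>x. indicat_real (cball 0 R) x *\<^sub>R g x)"
    by (rule Bochner_Integration.integrable_bound)
       (use assms order_trans[OF norm_ge_zero assms(2)] in \<open>auto simp: abs_mult indicator_def\<close>)
qed

lemma ctest_integrable: "f \<in> ctest \<Longrightarrow> integrable lborel f"
  using ctest_times_integrable[of f "\<lambda>_. 1"] loc_integrable_bounded[of "\<lambda>_. 1" 1] by simp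

lemma has_vector_derivative_quotient:
  fixes g :: "real \<Rightarrow> 'a::real_normed_vector"
  assumes "((\<lambda>t. g t) has_vector_derivative v) (at 0)"
  shows "((\<lambda>t. (g t - g 0) /\<^sub>R t) \<longlongrightarrow> v) (at 0)"
proof -
  have "((\<lambda>t. norm (g (0 + t) - g 0 - t *\<^sub>R v) / norm t) \<longlongrightarrow> 0) (at 0)"
    using assms unfolding has_vector_derivative_def has_derivative_at by auto
  then have "((\<lambda>t. norm ((g t - g 0) /\<^sub>R t - v)) \<longlongrightarrow> 0) (at 0)"
  proof (rule Lim_transform_eventually)
    have "norm (g (0 + t) - g 0 - t *\<^sub>R v) / norm t = norm ((g t - g 0) /\<^sub>R t - v)" if "t \<noteq> 0" for t
    proof -
      have "(g t - g 0) /\<^sub>R t - v = (g t - g 0 - t *\<^sub>R v) /\<^sub>R t"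
        using that by (simp add: scaleR_diff_right)
      then show ?thesis by (simp add: divide_inverse mult.commute)
    qed
    then show "\<forall>\<^sub>F t in at 0. norm (g (0 + t) - g 0 - t *\<^sub>R v) / norm t = norm ((g t - g 0) /\<^sub>R t - v)"
      by (auto simp: eventually_at intro: exI[of _ 1])
  qed
  then have "((\<lambda>t. (g t - g 0) /\<^sub>R t - v) \<longlongrightarrow> 0) (at 0)"
    by (rule tendsto_norm_zero_cancel)
  then show ?thesis by (rule LIM_zero_cancel)
qed

text \<open>Difference quotients in direction \<open>h\<close> have integral 0 by translation
  invariance of Lebesgue measure, and dominated convergence passes to the derivative. Every later
  integration by parts rests on this.\<close>

lemma integral_dd_eq_0:
  fixes f :: "real^'n::finite \<Rightarrow> complex"
  assumes f: "f \<in> ctest"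
  shows "(\<integral>x. dd h f x \<partial>lborel) = 0"
proof -
  have cs: "csmooth f" using f by (rule ctest_csmooth)
  have [measurable]: "f \<in> borel_measurable borel" using cs by (rule csmoothD)
  obtain R where R: "0 < R" "\<And>x. R < norm x \<Longrightarrow> f x = 0" using ctest_supp[OF f] by blast
  obtain M where M: "0 < M" "\<And>x. cmod (dd h f x) \<le> M" using ctest_bounded[OF ctest_dd[OF f]] by blast
  define s where "s k = 1 / real (Suc k)" for k
  have s: "0 < s k" "s k \<le> 1" for k by (auto simp: s_def)
  define F where "F k x = (f (s k *\<^sub>R h + x) - f x) /\<^sub>R s k" for k x
  \<comment> \<open>The mean value inequality gives a bound independent of \<open>k\<close>. Since
    \<open>s k \<le> 1\<close>, all quotients are supported in one ball of radius
    \<open>R + norm h\<close>.\<close>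
  have lip: "cmod (F k x) \<le> M" for k x
  proof -
    have der: "((\<lambda>t. f (t *\<^sub>R h + x)) has_derivative (\<lambda>d. d *\<^sub>R dd h f (t *\<^sub>R h + x))) (at t within {0..s k})" for t
    proof -
      have "((\<lambda>t. f (t *\<^sub>R h + x)) has_derivative (\<lambda>d. dd (d *\<^sub>R h) f (t *\<^sub>R h + x))) (at t within {0..s k})"
        by (rule has_derivative_compose[OF _ csmoothD(1)[OF cs], of "\<lambda>t. t *\<^sub>R h + x"])
          (auto intro!: derivative_eq_intros)
      moreover have "linear (\<lambda>v. dd v f (t *\<^sub>R h + x))"
        using csmoothD(1)[OF cs] has_derivative_linear by blast
      ultimately show ?thesis by (simp add: linear_scale)
    qed
    have "norm (f (s k *\<^sub>R h + x) - f (0 *\<^sub>R h + x)) \<le> M * norm (s k - 0)"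
      by (rule differentiable_bound[OF _ der])
        (use s[of k] M in \<open>auto intro!: onorm_bound simp: mult.commute[of M] mult_left_mono\<close>)
    then show ?thesis
      using s[of k] by (simp add: F_def norm_mult) (simp add: field_simps)
  qed
  have i: "integrable lborel (\<lambda>x. f (s k *\<^sub>R h + x))" for k
    using ctest_integrable[OF ctest_affine[OF f, of 1 "s k *\<^sub>R h"]] by (simp add: add.commute)
  have int0: "(\<integral>x. F k x \<partial>lborel) = 0" for k
  proof -
    have "(\<integral>x. f (s k *\<^sub>R h + x) \<partial>lborel) = (\<integral>x. f x \<partial>distr lborel borel ((+) (s k *\<^sub>R h)))"
      by (rule integral_distr[symmetric]) auto
    also have "\<dots> = (\<integral>x. f x \<partial>lborel)" by (simp add: lborel_distr_plus)
    finally show ?thesis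
      unfolding F_def using i[of k] ctest_integrable[OF f] by simp
  qed
  have "(\<lambda>k. \<integral>x. F k x \<partial>lborel) \<longlonglongrightarrow> (\<integral>x. dd h f x \<partial>lborel)"
  proof (rule integral_dominated_convergence[where w = "\<lambda>x. M * indicat_real (cball 0 (R + norm h)) x"])
    show "dd h f \<in> borel_measurable lborel" using csmoothD(5)[OF csmoothD(2)[OF cs]] by simp
    show "F k \<in> borel_measurable lborel" for k unfolding F_def by measurable
    show "integrable lborel (\<lambda>x. M * indicat_real (cball 0 (R + norm h)) x :: real)"
      by (intro integrable_mult_right integrable_real_indicator) (simp_all add: emeasure_lborel_cball_finite[unfolded infinity_ennreal_def])
    show "AE x in lborel. (\<lambda>k. F k x) \<longlonglongrightarrow> dd h f x"
    proof (rule AE_I2)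
      fix x
      have "((\<lambda>t. f (t *\<^sub>R h + x)) has_vector_derivative dd h f x) (at 0)"
      proof -
        have "((\<lambda>t. f (t *\<^sub>R h + x)) has_derivative (\<lambda>d. dd (d *\<^sub>R h) f (0 *\<^sub>R h + x))) (at 0)"
          by (rule has_derivative_compose[OF _ csmoothD(1)[OF cs], of "\<lambda>t. t *\<^sub>R h + x"])
            (auto intro!: derivative_eq_intros)
        moreover have "linear (\<lambda>v. dd v f x)"
          using csmoothD(1)[OF cs] has_derivative_linear by blast
        ultimately show ?thesis by (simp add: linear_scale has_vector_derivative_def)
      qed
      then have "((\<lambda>t. (f (t *\<^sub>R h + x) - f (0 *\<^sub>R h + x)) /\<^sub>R t) \<longlongrightarrow> dd h f x) (at 0)"
        by (rule has_vector_derivative_quotient)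
      moreover have "filterlim s (at 0) sequentially"
        unfolding filterlim_at using s LIMSEQ_inverse_real_of_nat
        by (auto simp: s_def[abs_def] inverse_eq_divide less_imp_neq[THEN not_sym])
      ultimately show "(\<lambda>k. F k x) \<longlonglongrightarrow> dd h f x"
        unfolding F_def by (auto dest: filterlim_compose)
    qed
    show "AE x in lborel. norm (F k x) \<le> M * indicat_real (cball 0 (R + norm h)) x" for k
    proof (rule AE_I2)
      fix x
      have "F k x = 0" if "R + norm h < norm x"
      proof -
        have "norm (s k *\<^sub>R h) \<le> norm h" using s[of k] by (simp add: mult_left_le_one_le)
        then have "R < norm (s k *\<^sub>R h + x)"
          using norm_triangle_ineq2[of x "- (s k *\<^sub>R h)"] that by (simp add: add.commute)
        moreover have "R < norm x" using that norm_ge_zero[of h] by linarith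
        ultimately show ?thesis using R(2)[of x] R(2)[of "s k *\<^sub>R h + x"] by (simp add: F_def)
      qed
      then show "norm (F k x) \<le> M * indicat_real (cball 0 (R + norm h)) x"
        using lip[of k x] by (auto simp: indicator_def not_le)
    qed
  qed
  then show ?thesis by (simp add: int0 LIMSEQ_const_iff)
qed

section \<open>Compactly supported solutions in the singular case\<close>

text \<open>The set where \<open>g\<close> does not vanish is open and a null set, hence
  empty.\<close>

lemma continuous_integral_eq_0:
  fixes g :: "real^'n::finite \<Rightarrow> real"
  assumes "continuous_on UNIV g" "\<And>x. 0 \<le> g x" "integrable lborel g" "(\<integral>x. g x \<partial>lborel) = 0"
  shows "g x = 0"
proof (rule ccontr)
  assume "g x \<noteq> 0"
  have "AE x in lborel. g x = 0"
    using integral_nonneg_eq_0_iff_AE[OF assms(3)] assms by auto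
  moreover have [measurable]: "g \<in> borel_measurable borel"
    using assms(1) by (rule borel_measurable_continuous_onI)
  have "{x \<in> space lborel. g x \<noteq> 0} \<in> sets lborel" by measurable
  ultimately have "{x. g x \<noteq> 0} \<in> null_sets lborel"
    by (subst (asm) AE_iff_null) auto
  then have "negligible {x. g x \<noteq> 0}"
    using negligible_iff_null_sets null_sets_completionI by blast
  moreover have "open {x. g x \<noteq> 0}"
    using assms(1) by (intro open_Collect_neq continuous_intros)
  ultimately show False
    using open_not_negligible \<open>g x \<noteq> 0\<close> by blast
qed

text \<open>The two-sided Laplace transform at real arguments. Real exponentials are positive, so
  the transform of the bump function has no zeros there; and their sums form a real algebra to which
  Stone-Weierstrass applies, so the transform is injective.\<close>

definition lap :: "(real^'n::finite \<Rightarrow> complex) \<Rightarrow> real^'n \<Rightarrow> complex" where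
  "lap f \<zeta> = (\<integral>x. f x * of_real (exp (\<zeta> \<bullet> x)) \<partial>lborel)"

lemma ctest_exp: "f \<in> ctest \<Longrightarrow> (\<lambda>x. f x * of_real (exp (\<zeta> \<bullet> x))) \<in> ctest"
  by (intro ctest_mult csmooth_intros smooth_exp_inner)

lemma lap_integrable: "f \<in> ctest \<Longrightarrow> integrable lborel (\<lambda>x. f x * of_real (exp (\<zeta> \<bullet> x)))"
  by (intro ctest_integrable ctest_exp)

lemma lap_add: "f \<in> ctest \<Longrightarrow> g \<in> ctest \<Longrightarrow> lap (\<lambda>x. f x + g x) \<zeta> = lap f \<zeta> + lap g \<zeta>"
  using lap_integrable[of f \<zeta>] lap_integrable[of g \<zeta>] by (simp add: lap_def distrib_right)

lemma lap_cmult: "lap (\<lambda>x. c * f x) \<zeta> = c * lap f \<zeta>"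
  by (simp add: lap_def mult.assoc)

lemma lap_zero: "lap (\<lambda>x. 0) \<zeta> = 0"
  by (simp add: lap_def)

lemma ctest_cmult: "f \<in> ctest \<Longrightarrow> (\<lambda>x. c * f x) \<in> ctest"
  by (intro ctest_mult csmooth_intros)

lemma lap_sum: "(\<And>i. i \<in> S \<Longrightarrow> f i \<in> ctest) \<Longrightarrow> lap (\<lambda>x. \<Sum>i\<in>S. f i x) \<zeta> = (\<Sum>i\<in>S. lap (f i) \<zeta>)"
  by (induction S rule: infinite_finite_induct) (auto simp: lap_zero lap_add ctest_sum)

text \<open>The product of \<open>f\<close> with the exponential is again a test function, so the
  integral of its derivative vanishes.\<close>

lemma lap_dd:
  assumes f: "f \<in> ctest"
  shows "lap (dd h f) \<zeta> = - of_real (\<zeta> \<bullet> h) * lap f \<zeta>"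
proof -
  define g where "g x = f x * of_real (exp (\<zeta> \<bullet> x))" for x
  have "(g has_derivative (\<lambda>h. f x * of_real (\<zeta> \<bullet> h * exp (\<zeta> \<bullet> x)) + dd h f x * of_real (exp (\<zeta> \<bullet> x)))) (at x)" for x
    unfolding g_def
    by (intro has_derivative_mult csmoothD ctest_csmooth f has_derivative_of_real)
       (auto intro!: derivative_eq_intros)
  from dd_eqI[OF this] have "dd h g x = of_real (\<zeta> \<bullet> h) * (f x * of_real (exp (\<zeta> \<bullet> x))) + dd h f x * of_real (exp (\<zeta> \<bullet> x))" for x
    by (simp add: mult_ac)
  moreover have "(\<integral>x. dd h g x \<partial>lborel) = 0"
    unfolding g_def by (intro integral_dd_eq_0 ctest_exp f)
  ultimately show ?thesis
    using lap_integrable[OF f, of \<zeta>] lap_integrable[OF ctest_dd[OF f], of h \<zeta>]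
    by (simp add: lap_def add_eq_0_iff)
qed

text \<open>\<open>lap\<close> turns $p(\partial)$ into multiplication by $p(-\zeta)$, so the witness \<open>g\<close> is \<open>p(\<partial>) f\<close>.\<close>

lemma cpoly_differential_operator:
  assumes "p \<in> cpoly" "f \<in> ctest"
  shows "\<exists>g\<in>ctest. \<forall>\<zeta>. lap g \<zeta> = p (- \<zeta>) * lap f \<zeta>"
  using assms
proof (induction arbitrary: f)
  case (const c)
  then show ?case by (intro bexI[of _ "\<lambda>x. c * f x"]) (auto simp: lap_cmult ctest_cmult)
next
  case (coord j)
  then show ?case
    by (intro bexI[of _ "dd (axis j 1) f"]) (auto simp: lap_dd ctest_dd inner_axis)
next
  case (add p q)
  obtain g h where "g \<in> ctest" "\<And>\<zeta>. lap g \<zeta> = p (- \<zeta>) * lap f \<zeta>" "h \<in> ctest" "\<And>\<zeta>. lap h \<zeta> = q (- \<zeta>) * lap f \<zeta>"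
    using add by metis
  then show ?case
    by (intro bexI[of _ "\<lambda>x. g x + h x"]) (auto simp: lap_add distrib_right intro: ctest_add)
next
  case (mult p q)
  obtain g where g: "g \<in> ctest" "\<And>\<zeta>. lap g \<zeta> = q (- \<zeta>) * lap f \<zeta>"
    using mult by metis
  obtain h where "h \<in> ctest" "\<And>\<zeta>. lap h \<zeta> = p (- \<zeta>) * lap g \<zeta>"
    using mult.IH(1)[OF g(1)] by metis
  with g show ?case by (intro bexI[of _ h]) (auto simp: mult.assoc)
qed

text \<open>Sums of real exponentials are closed under products, contain the constants and separate
  points. Integrals against them are linear combinations of values of the transform.\<close>

inductive exp_sum :: "(real^'n::finite \<Rightarrow> real) \<Rightarrow> bool" where
  exp: "exp_sum (\<lambda>x. c * exp (\<zeta> \<bullet> x))"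
| add: "exp_sum f \<Longrightarrow> exp_sum g \<Longrightarrow> exp_sum (\<lambda>x. f x + g x)"

lemma exp_sum_continuous: "exp_sum f \<Longrightarrow> continuous_on S f"
  by (induction rule: exp_sum.induct) (auto intro!: continuous_intros)

lemma exp_sum_mult: "exp_sum f \<Longrightarrow> exp_sum g \<Longrightarrow> exp_sum (\<lambda>x. f x * g x)"
proof (induction rule: exp_sum.induct)
  case (exp c \<zeta>)
  show ?case using exp
  proof (induction rule: exp_sum.induct)
    case (exp d \<eta>)
    have "(\<lambda>x. c * exp (\<zeta> \<bullet> x) * (d * exp (\<eta> \<bullet> x))) = (\<lambda>x. (c * d) * exp ((\<zeta> + \<eta>) \<bullet> x))"
      by (auto simp: fun_eq_iff inner_add_left exp_add)
    then show ?case by (simp add: exp_sum.exp)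
  next
    case (add f g)
    then show ?case by (simp add: distrib_left exp_sum.add)
  qed
next
  case (add f g)
  then show ?case by (simp add: distrib_right exp_sum.add)
qed

text \<open>For an exponential sum \<open>g\<close> within e of \<phi> on a ball containing the
  support, the integral of \<phi> squared equals that of \<phi> (\<phi> - g), which is at most e
  times the integral of |\<phi>|.\<close>

lemma test_function_eq_0:
  fixes \<phi> :: "real^'n::finite \<Rightarrow> real"
  assumes \<phi>: "(\<lambda>x. complex_of_real (\<phi> x)) \<in> ctest" and lap: "\<And>\<zeta>. (\<integral>x. \<phi> x * exp (\<zeta> \<bullet> x) \<partial>lborel) = 0"
  shows "\<phi> x = 0"
proof -
  obtain R where R: "0 < R" "\<And>x. R < norm x \<Longrightarrow> complex_of_real (\<phi> x) = 0" using ctest_supp[OF \<phi>] by blast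
  have sm: "smooth \<phi>" using ctest_csmooth[OF \<phi>] by (simp add: csmooth_def)
  have i: "integrable lborel (\<lambda>x. \<phi> x * g x)" if "continuous_on UNIV g" for g
  proof -
    have [measurable]: "g \<in> borel_measurable borel" using that by (rule borel_measurable_continuous_onI)
    have "loc_integrable (\<lambda>x. complex_of_real (g x))"
      unfolding loc_integrable_def set_integrable_def
    proof
      fix R
      show "integrable lborel (\<lambda>x. indicat_real (cball 0 R) x *\<^sub>R complex_of_real (g x))"
        by (rule borel_integrable_compact)
          (auto intro!: continuous_intros continuous_on_subset[OF that])
    qed
    then have "integrable lborel (\<lambda>x. complex_of_real (\<phi> x) * complex_of_real (g x))"
      by (rule ctest_times_integrable[OF \<phi>])
    then have "integrable lborel (\<lambda>x. complex_of_real (\<phi> x * g x))" by simp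
    then show ?thesis by (simp only: complex_of_real_integrable_eq)
  qed
  have cont: "continuous_on UNIV \<phi>" using sm by (rule smoothD)
  have 0: "(\<integral>x. \<phi> x * g x \<partial>lborel) = 0" if "exp_sum g" for g
    using that
  proof induction
    case (exp c \<zeta>)
    show ?case using lap[of \<zeta>] by (simp add: mult.left_commute[of _ c])
  next
    case (add f g)
    then show ?case using i[OF exp_sum_continuous[OF add(1)]] i[OF exp_sum_continuous[OF add(2)]]
      by (simp add: distrib_left)
  qed
  have i1: "integrable lborel (\<lambda>x. \<bar>\<phi> x\<bar>)"
    using i[of "\<lambda>_. 1"] by simp
  define N where "N = (\<integral>x. \<bar>\<phi> x\<bar> \<partial>lborel)"
  have "(\<integral>x. \<phi> x * \<phi> x \<partial>lborel) \<le> e * N" if e: "0 < e" for e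
  proof -
    obtain g where g: "exp_sum g" "\<And>x. x \<in> cball 0 R \<Longrightarrow> \<bar>\<phi> x - g x\<bar> < e"
    proof -
      have "\<exists>g. exp_sum g \<and> (\<forall>x\<in>cball 0 R. \<bar>\<phi> x - g x\<bar> < e)"
      proof (rule Stone_Weierstrass_HOL)
        show "exp_sum (\<lambda>x. c)" for c :: real
          using exp_sum.exp[of c 0] by simp
        show "continuous_on (cball 0 R) f" if "exp_sum f" for f using that by (rule exp_sum_continuous)
        fix x y :: "real^'n" assume "x \<in> cball 0 R \<and> y \<in> cball 0 R \<and> x \<noteq> y"
        then have "(x - y) \<bullet> (x - y) \<noteq> 0" by simp
        then have "(x - y) \<bullet> x \<noteq> (x - y) \<bullet> y" by (simp add: inner_diff_right)
        then show "\<exists>f. exp_sum f \<and> f x \<noteq> f y"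
          using exp_sum.exp[of 1 "x - y"] by (intro exI[of _ "\<lambda>z. 1 * exp ((x - y) \<bullet> z)"]) auto
      qed (use cont e in \<open>auto intro: exp_sum.add exp_sum_mult continuous_on_subset\<close>)
      then show ?thesis using that by blast
    qed
    have ig: "integrable lborel (\<lambda>x. \<phi> x * (\<phi> x - g x))"
      using cont exp_sum_continuous[OF g(1)] by (intro i continuous_intros)
    have "(\<integral>x. \<phi> x * \<phi> x \<partial>lborel) = (\<integral>x. \<phi> x * (\<phi> x - g x) \<partial>lborel)"
      using i[OF cont] i[OF exp_sum_continuous[OF g(1)]] 0[OF g(1)] by (simp add: right_diff_distrib)
    also have "\<dots> \<le> (\<integral>x. e * \<bar>\<phi> x\<bar> \<partial>lborel)"
    proof (rule integral_mono[OF ig])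
      show "integrable lborel (\<lambda>x. e * \<bar>\<phi> x\<bar>)" using i1 by simp
      fix x
      have "\<bar>\<phi> x * (\<phi> x - g x)\<bar> \<le> e * \<bar>\<phi> x\<bar>"
      proof (cases "norm x \<le> R")
        case True
        then have "\<bar>\<phi> x\<bar> * \<bar>\<phi> x - g x\<bar> \<le> \<bar>\<phi> x\<bar> * e"
          using g(2)[of x] by (intro mult_left_mono) auto
        then show ?thesis by (simp add: abs_mult mult.commute)
      next
        case False
        then show ?thesis using R(2)[of x] by simp
      qed
      then show "\<phi> x * (\<phi> x - g x) \<le> e * \<bar>\<phi> x\<bar>" by linarith
    qed
    finally show ?thesis by (simp add: N_def)
  qed
  then have "\<forall>\<^sub>F e in at_right 0. (\<integral>x. \<phi> x * \<phi> x \<partial>lborel) \<le> e * N"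
    unfolding eventually_at_right_field by (intro exI[of _ 1]) auto
  moreover have "((\<lambda>e. e * N) \<longlongrightarrow> 0 * N) (at_right 0)" by (intro tendsto_intros)
  ultimately have "(\<integral>x. \<phi> x * \<phi> x \<partial>lborel) \<le> 0 * N"
    by (intro tendsto_lowerbound) auto
  then have le: "(\<integral>x. \<phi> x * \<phi> x \<partial>lborel) \<le> 0" unfolding mult_zero_left .
  have ge: "0 \<le> (\<integral>x. \<phi> x * \<phi> x \<partial>lborel)" by (intro integral_nonneg_AE) auto
  have "\<phi> x * \<phi> x = 0"
    by (rule continuous_integral_eq_0[OF continuous_on_mult[OF cont cont] _ i[OF cont] antisym[OF le ge]])
      (rule zero_le_square)
  then show ?thesis by (metis mult_eq_0_iff)
qed

lemma lap_eq_0: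
  assumes f: "f \<in> ctest" and lap: "\<And>\<zeta>. lap f \<zeta> = 0"
  shows "f x = 0"
proof -
  have t: "(\<lambda>x. Re (f x)) \<in> test_functions" "(\<lambda>x. Im (f x)) \<in> test_functions"
    using f by (auto simp: ctest_iff)
  have "(\<integral>x. Re (f x) * exp (\<zeta> \<bullet> x) \<partial>lborel) = Re (lap f \<zeta>)" for \<zeta>
    unfolding lap_def using integral_Re[OF lap_integrable[OF f, of \<zeta>]] by simp
  then have "Re (f x) = 0"
    using lap by (intro test_function_eq_0[of "\<lambda>x. Re (f x)"] ctest_of_real t) auto
  moreover have "(\<integral>x. Im (f x) * exp (\<zeta> \<bullet> x) \<partial>lborel) = Im (lap f \<zeta>)" for \<zeta>
    unfolding lap_def using integral_Im[OF lap_integrable[OF f, of \<zeta>]] by simp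
  then have "Im (f x) = 0"
    using lap by (intro test_function_eq_0[of "\<lambda>x. Im (f x)"] ctest_of_real t) auto
  ultimately show ?thesis by (simp add: complex_eq_iff)
qed

text \<open>The integrand is continuous, nonnegative, and positive at 0.\<close>

lemma lap_bump_nonzero:
  fixes \<zeta> :: "real^'n::finite"
  shows "lap (\<lambda>x. of_real (bump x)) \<zeta> \<noteq> 0"
proof
  assume 0: "lap (\<lambda>x. of_real (bump x)) \<zeta> = 0"
  have c: "continuous_on UNIV (bump :: real^'n \<Rightarrow> real)"
    using bump_test by (auto simp: test_functions_iff intro: smoothD)
  have i: "integrable lborel (\<lambda>x. complex_of_real (bump x * exp (\<zeta> \<bullet> x)))"
    using lap_integrable[OF ctest_of_real[OF bump_test], of \<zeta>] by simp
  note i = i[unfolded complex_of_real_integrable_eq]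
  have "complex_of_real (\<integral>x. bump x * exp (\<zeta> \<bullet> x) \<partial>lborel) = 0"
    using 0 unfolding lap_def by (simp add: integral_complex_of_real[symmetric] del: integral_complex_of_real)
  then have "bump (0 :: real^'n) * exp (\<zeta> \<bullet> 0) = 0"
    using c i bump_nonneg
    by (intro continuous_integral_eq_0[of "\<lambda>x. bump x * exp (\<zeta> \<bullet> x)" 0])
       (auto intro!: continuous_intros mult_nonneg_nonneg)
  then show False using bump_0 by (metis exp_not_eq_zero less_irrefl mult_eq_0_iff)
qed

text \<open>The components are w_k(\<partial>) applied to the bump function, with \<open>w\<close>
  the polynomial kernel field. The transform of the system is
  \<open>symbol E (- \<zeta>) *v w (- \<zeta>)\<close> times the transform of the bump, hence 0, and
  the transform is injective.\<close>

lemma singular_imp_test_solution: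
  fixes E :: "'n::finite \<Rightarrow> complex^'m^'m::finite"
  assumes sing: "\<And>\<xi>. det (symbol E \<xi>) = 0"
  obtains v :: "real^'n \<Rightarrow> complex^'m" and x0
  where "\<And>i. (\<lambda>x. v x $ i) \<in> ctest" "v x0 \<noteq> 0"
    "\<And>x i. (\<Sum>j\<in>UNIV. \<Sum>k\<in>UNIV. E j $ i $ k * dd (axis j 1) (\<lambda>x. v x $ k) x) = 0"
proof -
  obtain w :: "real^'n \<Rightarrow> complex^'m" and \<xi>0 where w: "\<And>i. (\<lambda>\<xi>. w \<xi> $ i) \<in> cpoly"
    "\<And>\<xi>. symbol E \<xi> *v w \<xi> = 0" "w \<xi>0 \<noteq> 0"
    using singular_imp_polynomial_kernel[of "symbol E", OF cpoly_symbol sing] by blast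
  let ?b = "\<lambda>x::real^'n. complex_of_real (bump x)"
  have b: "?b \<in> ctest" by (intro ctest_of_real bump_test)
  have "\<forall>k. \<exists>g\<in>ctest. \<forall>\<zeta>. lap g \<zeta> = w (- \<zeta>) $ k * lap ?b \<zeta>"
    using cpoly_differential_operator[OF w(1) b] by blast
  then obtain g where g: "\<And>k. g k \<in> ctest" "\<And>k \<zeta>. lap (g k) \<zeta> = w (- \<zeta>) $ k * lap ?b \<zeta>"
    by metis
  show thesis
  proof
    let ?v = "\<lambda>x. \<chi> k. g k x"
    show "(\<lambda>x. ?v x $ i) \<in> ctest" for i using g by simp
    obtain k where k: "w \<xi>0 $ k \<noteq> 0" using w(3) by (auto simp: vec_eq_iff)
    have "\<exists>x. g k x \<noteq> 0"
    proof (rule ccontr)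
      assume "\<nexists>x. g k x \<noteq> 0"
      then have "g k = (\<lambda>_. 0)" by auto
      \<comment> \<open>At -\<xi>0 the transform of \<open>g k\<close> is the k-th component of
        \<open>w \<xi>0\<close> times the transform of the bump, and neither factor
        vanishes.\<close>
      then show False using g(2)[of k "- \<xi>0"] k lap_bump_nonzero by (auto simp: lap_zero)
    qed
    then obtain x where "g k x \<noteq> 0" by auto
    then have "?v x \<noteq> 0" by (auto simp: vec_eq_iff)
    then show "?v (SOME x. ?v x \<noteq> 0) \<noteq> 0" by (rule someI)
    fix x i
    have c: "(\<lambda>x. E j $ i $ k * dd (axis j 1) (g k) x) \<in> ctest" for j k
      by (intro ctest_cmult ctest_dd g)
    have "lap (\<lambda>x. \<Sum>j\<in>UNIV. \<Sum>k\<in>UNIV. E j $ i $ k * dd (axis j 1) (g k) x) \<zeta> = 0" for \<zeta>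
    proof -
      have "lap (\<lambda>x. \<Sum>j\<in>UNIV. \<Sum>k\<in>UNIV. E j $ i $ k * dd (axis j 1) (g k) x) \<zeta>
        = (\<Sum>j\<in>UNIV. \<Sum>k\<in>UNIV. E j $ i $ k * (- of_real (\<zeta> $ j) * (w (- \<zeta>) $ k * lap ?b \<zeta>)))"
        by (simp add: lap_sum ctest_sum c lap_cmult lap_dd g inner_axis)
      also have "\<dots> = (symbol E (- \<zeta>) *v w (- \<zeta>)) $ i * lap ?b \<zeta>"
      proof -
        have "symbol E (- \<zeta>) $ i $ k = (\<Sum>j\<in>UNIV. - of_real (\<zeta> $ j) * E j $ i $ k)" for k
          by (simp add: symbol_def) (simp add: scaleR_conv_of_real)
        then show ?thesis
          by (subst sum.swap) (simp add: matrix_vector_mult_def sum_distrib_left sum_distrib_right mult_ac)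
      qed
      finally show ?thesis by (simp add: w(2))
    qed
    then have "(\<Sum>j\<in>UNIV. \<Sum>k\<in>UNIV. E j $ i $ k * dd (axis j 1) (g k) x) = 0"
      by (intro lap_eq_0[of "\<lambda>x. \<Sum>j\<in>UNIV. \<Sum>k\<in>UNIV. E j $ i $ k * dd (axis j 1) (g k) x"] ctest_sum c)
    then show "(\<Sum>j\<in>UNIV. \<Sum>k\<in>UNIV. E j $ i $ k * dd (axis j 1) (\<lambda>x. ?v x $ k) x) = 0"
      by simp
  qed
qed

section \<open>Gaussians\<close>

lemma
  fixes f :: "'a::euclidean_space \<Rightarrow> 'b::{banach, second_countable_topology}"
  assumes [measurable]: "f \<in> borel_measurable borel" and c: "c \<noteq> 0"
  shows lborel_integral_affine: "(\<integral>x. f x \<partial>lborel) = \<bar>c\<bar>^DIM('a) *\<^sub>R (\<integral>x. f (t + c *\<^sub>R x) \<partial>lborel)"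
    and lborel_integrable_affine: "integrable lborel (\<lambda>x. f (t + c *\<^sub>R x)) \<longleftrightarrow> integrable lborel f"
proof -
  show "(\<integral>x. f x \<partial>lborel) = \<bar>c\<bar>^DIM('a) *\<^sub>R (\<integral>x. f (t + c *\<^sub>R x) \<partial>lborel)"
    by (subst lborel_affine[OF c, of t]) (simp add: integral_density integral_distr)
  show "integrable lborel (\<lambda>x. f (t + c *\<^sub>R x)) \<longleftrightarrow> integrable lborel f"
  proof -
    have "integrable lborel f \<longleftrightarrow> integrable lborel (\<lambda>x. (\<bar>c\<bar> ^ DIM('a)) *\<^sub>R f (t + c *\<^sub>R x))" (is "_ \<longleftrightarrow> integrable _ ?g")
      by (subst lborel_affine[OF c, of t]) (simp add: integrable_density integrable_distr_eq)
    moreover have "integrable lborel (\<lambda>x. f (t + c *\<^sub>R x))" if "integrable lborel ?g"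
      using integrable_scaleR_right[OF that, of "1 / \<bar>c\<bar> ^ DIM('a)"] c by simp
    ultimately show ?thesis by auto
  qed
qed

text \<open>Lebesgue measure is the image of a product of one-dimensional measures under the
  coordinate map, so a product of one-variable functions integrates factor by factor.\<close>

lemma
  fixes \<phi> :: "'a::euclidean_space \<Rightarrow> real \<Rightarrow> complex"
  assumes i: "\<And>b. b \<in> Basis \<Longrightarrow> integrable lborel (\<phi> b)"
  shows lborel_integrable_prod: "integrable lborel (\<lambda>x. \<Prod>b\<in>Basis. \<phi> b (x \<bullet> b))"
    and lborel_integral_prod: "(\<integral>x. (\<Prod>b\<in>Basis. \<phi> b (x \<bullet> b)) \<partial>lborel) = (\<Prod>b\<in>Basis. \<integral>t. \<phi> b t \<partial>lborel)"
proof -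
  interpret product_sigma_finite "\<lambda>_::'a. lborel :: real measure" ..
  have [measurable]: "\<phi> b \<in> borel_measurable borel" if "b \<in> Basis" for b
    using borel_measurable_integrable[OF i[OF that]] by simp
  have l: "(lborel :: 'a measure) = distr (\<Pi>\<^sub>M b\<in>Basis. lborel) borel (\<lambda>f. \<Sum>b\<in>Basis. f b *\<^sub>R b)"
    by (subst lborel_def) (simp add: lborel_eq_real)
  have eq: "(\<Prod>b\<in>Basis. \<phi> b ((\<Sum>b\<in>Basis. f b *\<^sub>R b) \<bullet> b)) = (\<Prod>b\<in>Basis. \<phi> b (f b))" for f :: "'a \<Rightarrow> real"
    by (intro prod.cong) (auto simp: inner_sum_left inner_Basis if_distrib cong: if_cong)
  have [measurable]: "(\<lambda>x::'a. \<Prod>b\<in>Basis. \<phi> b (x \<bullet> b)) \<in> borel_measurable borel"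
    by measurable
  have [measurable]: "(\<lambda>f. \<Sum>b\<in>Basis. f b *\<^sub>R b :: 'a) \<in> borel_measurable (\<Pi>\<^sub>M b\<in>Basis. (lborel :: real measure))"
    by measurable
  show "integrable lborel (\<lambda>x. \<Prod>b\<in>Basis. \<phi> b (x \<bullet> b))"
    using product_integrable_prod[OF finite_Basis i] by (subst l) (simp add: integrable_distr_eq eq)
  show "(\<integral>x. (\<Prod>b\<in>Basis. \<phi> b (x \<bullet> b)) \<partial>lborel) = (\<Prod>b\<in>Basis. \<integral>t. \<phi> b t \<partial>lborel)"
    using product_integral_prod[OF finite_Basis i] by (subst l) (simp add: integral_distr eq)
qed

definition gauss :: "'a::euclidean_space \<Rightarrow> real" where
  "gauss x = exp (- (norm x)\<^sup>2 / 2)"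

lemma gauss_measurable [measurable]: "gauss \<in> borel_measurable borel"
  unfolding gauss_def[abs_def] by measurable

lemma gauss_pos: "0 < gauss x" and gauss_le_1: "gauss x \<le> 1"
  by (auto simp: gauss_def)

text \<open>The Fourier transform of the Gaussian is read off from the characteristic function of
  the standard normal distribution; \<open>sqrt (2 * pi)\<close> is the normalising constant of its
  density.\<close>

lemma cis_gauss_real:
  "integrable lborel (\<lambda>t::real. cis (t * x) * of_real (exp (- t\<^sup>2 / 2)))"
  "(\<integral>t. cis (t * x) * of_real (exp (- t\<^sup>2 / 2)) \<partial>lborel) = of_real (sqrt (2 * pi) * exp (- x\<^sup>2 / 2))"
proof -
  have n: "exp (- t\<^sup>2 / 2) = sqrt (2 * pi) * std_normal_density t" for t
    by (simp add: std_normal_density_def)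
  have i: "integrable lborel std_normal_density"
    using integrable_normal_moment[of 1 0 0] by simp
  have i': "integrable lborel (\<lambda>t. complex_of_real (sqrt (2 * pi) * std_normal_density t))"
    using i by (simp only: complex_of_real_integrable_eq) simp
  have [measurable]: "cis \<in> borel_measurable borel"
    by (intro borel_measurable_continuous_onI continuous_intros)
  show "integrable lborel (\<lambda>t::real. cis (t * x) * of_real (exp (- t\<^sup>2 / 2)))"
    by (rule Bochner_Integration.integrable_bound[OF i']) (auto simp: n[symmetric] norm_mult)
  have "cis (t * x) * of_real (exp (- t\<^sup>2 / 2)) = of_real (sqrt (2 * pi)) * (std_normal_density t *\<^sub>R iexp (x * t))" for t
    by (simp only: n) (simp add: scaleR_conv_of_real cis_conv_exp mult_ac)
  then have "(\<integral>t. cis (t * x) * of_real (exp (- t\<^sup>2 / 2)) \<partial>lborel) = of_real (sqrt (2 * pi)) * (\<integral>t. std_normal_density t *\<^sub>R iexp (x * t) \<partial>lborel)"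
    by (simp only: integral_mult_right_zero)
  also have "(\<integral>t. std_normal_density t *\<^sub>R iexp (x * t) \<partial>lborel) = char std_normal_distribution x"
    by (simp add: char_def integral_density)
  finally show "(\<integral>t. cis (t * x) * of_real (exp (- t\<^sup>2 / 2)) \<partial>lborel) = of_real (sqrt (2 * pi) * exp (- x\<^sup>2 / 2))"
    by (simp add: char_std_normal_distribution)
qed

lemma
  fixes x :: "'a::euclidean_space"
  shows cis_gauss_integrable: "integrable lborel (\<lambda>\<xi>::'a. cis (\<xi> \<bullet> x) * of_real (gauss \<xi>))"
    and cis_gauss_integral: "(\<integral>\<xi>. cis (\<xi> \<bullet> x) * of_real (gauss \<xi>) \<partial>lborel) = of_real (sqrt (2 * pi) ^ DIM('a) * gauss x)"
proof -
  define \<phi> where "\<phi> b t = cis (t * (x \<bullet> b)) * of_real (exp (- t\<^sup>2 / 2))" for b t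
  have cis_sum: "cis (sum f S) = (\<Prod>b\<in>S. cis (f b))" for f and S :: "'a set"
    by (induction S rule: infinite_finite_induct) (auto simp: cis_mult[symmetric])
  have g: "gauss y = (\<Prod>b\<in>Basis. exp (- (y \<bullet> b)\<^sup>2 / 2))" for y :: 'a
    by (simp add: gauss_def norm_eq_sqrt_inner euclidean_inner[of y y] exp_sum[symmetric]
        power2_eq_square sum_divide_distrib sum_negf sum_nonneg)
  have eq: "cis (\<xi> \<bullet> x) * of_real (gauss \<xi>) = (\<Prod>b\<in>Basis. \<phi> b (\<xi> \<bullet> b))" for \<xi>
    unfolding \<phi>_def prod.distrib cis_sum[symmetric] g euclidean_inner[of \<xi> x] by simp
  have i: "integrable lborel (\<phi> b)" for b unfolding \<phi>_def by (rule cis_gauss_real)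
  show "integrable lborel (\<lambda>\<xi>::'a. cis (\<xi> \<bullet> x) * of_real (gauss \<xi>))"
    unfolding eq by (rule lborel_integrable_prod[OF i])
  have "(\<integral>\<xi>. cis (\<xi> \<bullet> x) * of_real (gauss \<xi>) \<partial>lborel) = (\<Prod>b\<in>Basis. complex_of_real (sqrt (2 * pi) * exp (- (x \<bullet> b)\<^sup>2 / 2)))"
    unfolding eq lborel_integral_prod[OF i] unfolding \<phi>_def cis_gauss_real(2) ..
  also have "\<dots> = of_real (sqrt (2 * pi) ^ DIM('a) * gauss x)"
    unfolding g of_real_prod[symmetric] prod.distrib by simp
  finally show "(\<integral>\<xi>. cis (\<xi> \<bullet> x) * of_real (gauss \<xi>) \<partial>lborel) = of_real (sqrt (2 * pi) ^ DIM('a) * gauss x)" .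
qed

lemma gauss_integrable: "integrable lborel (gauss :: 'a::euclidean_space \<Rightarrow> real)"
  and gauss_integral: "(\<integral>x. gauss (x::'a) \<partial>lborel) = sqrt (2 * pi) ^ DIM('a)"
proof -
  have i: "integrable lborel (\<lambda>x::'a. complex_of_real (gauss x))"
    using cis_gauss_integrable[of "0::'a"] by simp
  then show "integrable lborel (gauss :: 'a \<Rightarrow> real)"
    by (simp only: complex_of_real_integrable_eq)
  have "complex_of_real (\<integral>x. gauss (x::'a) \<partial>lborel) = of_real (sqrt (2 * pi) ^ DIM('a))"
    using cis_gauss_integral[of "0::'a"] by (simp add: gauss_def)
  then show "(\<integral>x. gauss (x::'a) \<partial>lborel) = sqrt (2 * pi) ^ DIM('a)"
    by (simp only: of_real_eq_iff)
qed

section \<open>A Liouville theorem for elliptic systems\<close>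

text \<open>\<open>weak_null Dh U\<close> says that $\sum_j \hat D_j\partial_j U = 0$ as distributions.\<close>

definition weak_null :: "('n::finite \<Rightarrow> complex^'m^'m) \<Rightarrow> (real^'n \<Rightarrow> complex^'m::finite) \<Rightarrow> bool" where
  "weak_null Dh U \<longleftrightarrow> (\<forall>\<phi>\<in>test_functions. \<forall>i.
     (\<Sum>j\<in>UNIV. \<Sum>k\<in>UNIV. Dh j $ i $ k * (\<integral>x. of_real (dd (axis j 1) \<phi> x) * U x $ k \<partial>lborel)) = 0)"

text \<open>The equation D U = W tested coordinate by coordinate, for functions instead of classes.
  The factor is \<i> because integration by parts moves the derivative in -\<i> \<partial>_j to the
  test function with a change of sign.\<close>

definition weak_sol ::
    "('n::finite \<Rightarrow> complex^'m^'m) \<Rightarrow> (real^'n \<Rightarrow> complex^'m::finite) \<Rightarrow> (real^'n \<Rightarrow> complex^'m) \<Rightarrow> bool" where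
  "weak_sol Dh U W \<longleftrightarrow> (\<forall>\<phi>\<in>test_functions. \<forall>i.
     (\<integral>x. of_real (\<phi> x) * W x $ i \<partial>lborel) =
     \<i> * (\<Sum>j\<in>UNIV. \<Sum>k\<in>UNIV. Dh j $ i $ k * (\<integral>x. of_real (dd (axis j 1) \<phi> x) * U x $ k \<partial>lborel)))"

lemma weak_null_iff_weak_sol: "weak_null Dh U \<longleftrightarrow> weak_sol Dh U (\<lambda>_. 0)"
  by (simp add: weak_null_def weak_sol_def)

text \<open>Both sides are complex linear in the test function, so the identity extends from the
  real and imaginary parts.\<close>

lemma weak_sol_ctest:
  assumes w: "weak_sol Dh U W" and U: "\<And>k. loc_integrable (\<lambda>x. U x $ k)"
    and W: "\<And>k. loc_integrable (\<lambda>x. W x $ k)" and f: "f \<in> ctest"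
  shows "(\<integral>x. f x * W x $ i \<partial>lborel) =
     \<i> * (\<Sum>j\<in>UNIV. \<Sum>k\<in>UNIV. Dh j $ i $ k * (\<integral>x. dd (axis j 1) f x * U x $ k \<partial>lborel))"
proof -
  define r where "r = (\<lambda>x. Re (f x))"
  define s where "s = (\<lambda>x. Im (f x))"
  have t: "r \<in> test_functions" "s \<in> test_functions"
    using f by (auto simp: ctest_iff r_def s_def)
  have i: "integrable lborel (\<lambda>x. of_real (dd h \<phi> x) * U x $ k)" if "\<phi> \<in> test_functions" for h \<phi> k
    using ctest_times_integrable[OF ctest_dd[OF ctest_of_real[OF that]] U[of k]] that
    by (simp add: dd_of_real test_functions_iff)
  have eqU: "(\<integral>x. dd h f x * U x $ k \<partial>lborel) =
    (\<integral>x. of_real (dd h r x) * U x $ k \<partial>lborel) + \<i> * (\<integral>x. of_real (dd h s x) * U x $ k \<partial>lborel)" for h k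
  proof -
    have "dd h f x * U x $ k = of_real (dd h r x) * U x $ k + \<i> * (of_real (dd h s x) * U x $ k)" for x
      unfolding csmoothD(4)[OF ctest_csmooth[OF f]] r_def s_def by (simp add: Complex_eq distrib_right mult.assoc)
    then show ?thesis using i[OF t(1)] i[OF t(2)] by simp
  qed
  have "f x * W x $ i = of_real (r x) * W x $ i + \<i> * (of_real (s x) * W x $ i)" for x
  proof -
    have "f x = of_real (r x) + \<i> * of_real (s x)" unfolding r_def s_def by (rule complex_eq)
    then show ?thesis by (simp only: distrib_right mult.assoc)
  qed
  then have "(\<integral>x. f x * W x $ i \<partial>lborel) = (\<integral>x. of_real (r x) * W x $ i \<partial>lborel) + \<i> * (\<integral>x. of_real (s x) * W x $ i \<partial>lborel)"
    using ctest_times_integrable[OF ctest_of_real[OF t(1)] W[of i]] ctest_times_integrable[OF ctest_of_real[OF t(2)] W[of i]]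
    by simp
  also have "\<dots> = \<i> * (\<Sum>j\<in>UNIV. \<Sum>k\<in>UNIV. Dh j $ i $ k * (\<integral>x. dd (axis j 1) f x * U x $ k \<partial>lborel))"
    unfolding eqU using w t by (simp add: weak_sol_def distrib_left sum.distrib sum_distrib_left mult_ac)
  finally show ?thesis .
qed

lemma weak_null_ctest:
  assumes w: "weak_null Dh U" and U: "\<And>k. loc_integrable (\<lambda>x. U x $ k)" and f: "f \<in> ctest"
  shows "(\<Sum>j\<in>UNIV. \<Sum>k\<in>UNIV. Dh j $ i $ k * (\<integral>x. dd (axis j 1) f x * U x $ k \<partial>lborel)) = 0"
  using weak_sol_ctest[of Dh U "\<lambda>_. 0" f i] w U f loc_integrable_bounded[of "\<lambda>_. 0" 0]
  by (simp add: weak_null_iff_weak_sol)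

section \<open>Decay of the localised Fourier transform\<close>

lemma norm_matrix_vector_bound:
  fixes A :: "complex^'k^'m"
  obtains L where "0 \<le> L" "\<And>e. norm (A *v e) \<le> L * norm e"
proof -
  have "linear ((*v) A)"
    by (auto simp: linear_iff matrix_vector_right_distrib) (simp add: matrix_vector_mult_def vec_eq_iff scaleR_sum_right)
  then obtain B where "0 < B" "\<And>e. norm (A *v e) \<le> B * norm e"
    using linear_bounded_pos by blast
  then show ?thesis by (intro that[of B]) auto
qed

text \<open>The Fourier transform of \<open>U\<close>, cut off by \<open>\<eta>\<close>.\<close>

definition cutFT :: "(real^'n::finite \<Rightarrow> complex^'m::finite) \<Rightarrow> (real^'n \<Rightarrow> complex) \<Rightarrow> real^'n \<Rightarrow> complex^'m" where
  "cutFT U \<eta> \<xi> = (\<chi> k. \<integral>x. cis (\<xi> \<bullet> x) * \<eta> x * U x $ k \<partial>lborel)"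

text \<open>The weak equation tested with the character \<open>cis (\<xi> \<bullet> x)\<close> times
  \<eta>: the derivative of the character produces the symbol, the derivatives of \<eta> produce the
  remaining sum.\<close>

lemma cutFT_identity:
  assumes w: "weak_null Dh U" and U: "\<And>k. loc_integrable (\<lambda>x. U x $ k)" and \<eta>: "\<eta> \<in> ctest"
  shows "\<i> *s (symbol Dh \<xi> *v cutFT U \<eta> \<xi>) + (\<Sum>j\<in>UNIV. Dh j *v cutFT U (dd (axis j 1) \<eta>) \<xi>) = 0"
proof -
  define f where "f x = cis (\<xi> \<bullet> x) * \<eta> x" for x
  have c: "csmooth (\<lambda>x. cis (\<xi> \<bullet> x))" by (rule csmooth_intros)
  have f: "f \<in> ctest" unfolding f_def by (intro ctest_mult \<eta> c)
  have dcis: "dd h (\<lambda>x. cis (\<xi> \<bullet> x)) x = \<i> * of_real (\<xi> \<bullet> h) * cis (\<xi> \<bullet> x)" for h x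
  proof (rule dd_eqI)
    show "((\<lambda>x. cis (\<xi> \<bullet> x)) has_derivative (\<lambda>h. \<i> * of_real (\<xi> \<bullet> h) * cis (\<xi> \<bullet> x))) (at x)"
      unfolding cis_conv_exp
      by (rule has_derivative_eq_rhs[OF has_derivative_compose[OF _ DERIV_exp[unfolded has_field_derivative_def], of "\<lambda>x. \<i> * of_real (\<xi> \<bullet> x)"]])
        (auto intro!: derivative_eq_intros simp: mult_ac)
  qed
  have df: "dd h f x = \<i> * of_real (\<xi> \<bullet> h) * (cis (\<xi> \<bullet> x) * \<eta> x) + cis (\<xi> \<bullet> x) * dd h \<eta> x" for h x
  proof -
    have "(f has_derivative (\<lambda>h. cis (\<xi> \<bullet> x) * dd h \<eta> x + dd h (\<lambda>x. cis (\<xi> \<bullet> x)) x * \<eta> x)) (at x)"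
      unfolding f_def by (intro has_derivative_mult csmoothD c ctest_csmooth \<eta>)
    from dd_eqI[OF this, of h] show ?thesis by (simp add: dcis mult.assoc)
  qed
  have i1: "integrable lborel (\<lambda>x. cis (\<xi> \<bullet> x) * g x * U x $ k)" if "g \<in> ctest" for g k
    by (intro ctest_times_integrable U ctest_mult c that)
  have int: "(\<integral>x. dd h f x * U x $ k \<partial>lborel) = \<i> * of_real (\<xi> \<bullet> h) * cutFT U \<eta> \<xi> $ k + cutFT U (dd h \<eta>) \<xi> $ k" for h k
    using i1[OF \<eta>, of k] i1[OF ctest_dd[OF \<eta>], of h k]
    by (simp add: df cutFT_def distrib_right mult.assoc)
  have "(\<i> *s (symbol Dh \<xi> *v cutFT U \<eta> \<xi>) + (\<Sum>j\<in>UNIV. Dh j *v cutFT U (dd (axis j 1) \<eta>) \<xi>)) $ i = 0" for i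
  proof -
    have "symbol Dh \<xi> $ i $ k = (\<Sum>j\<in>UNIV. of_real (\<xi> $ j) * Dh j $ i $ k)" for k
      by (simp add: symbol_def) (simp add: scaleR_conv_of_real)
    then have "(\<i> *s (symbol Dh \<xi> *v cutFT U \<eta> \<xi>)) $ i
      = (\<Sum>j\<in>UNIV. \<Sum>k\<in>UNIV. Dh j $ i $ k * (\<i> * of_real (\<xi> $ j) * cutFT U \<eta> \<xi> $ k))"
      by (subst sum.swap) (simp add: matrix_vector_mult_def sum_distrib_left sum_distrib_right mult_ac)
    then show ?thesis
      using weak_null_ctest[OF w U f, of i]
      by (simp add: int inner_axis distrib_left sum.distrib matrix_vector_mult_def)
  qed
  then show ?thesis by (simp add: vec_eq_iff)
qed

lemma dd_scaled:
  assumes "csmooth \<eta>"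
  shows "dd h (\<lambda>x. \<eta> (\<epsilon> *\<^sub>R x)) = (\<lambda>x. of_real \<epsilon> * dd h \<eta> (\<epsilon> *\<^sub>R x))"
proof
  fix x
  have "((\<lambda>x. \<eta> (\<epsilon> *\<^sub>R x)) has_derivative (\<lambda>h. dd (\<epsilon> *\<^sub>R h) \<eta> (\<epsilon> *\<^sub>R x))) (at x)"
    by (rule has_derivative_compose[OF _ csmoothD(1)[OF assms], of "\<lambda>x. \<epsilon> *\<^sub>R x"]) (auto intro!: derivative_eq_intros)
  moreover have "linear (\<lambda>v. dd v \<eta> (\<epsilon> *\<^sub>R x))"
    using csmoothD(1)[OF assms] has_derivative_linear by blast
  ultimately have "dd h (\<lambda>x. \<eta> (\<epsilon> *\<^sub>R x)) x = \<epsilon> *\<^sub>R dd h \<eta> (\<epsilon> *\<^sub>R x)"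
    by (metis dd_eqI linear_scale)
  then show "dd h (\<lambda>x. \<eta> (\<epsilon> *\<^sub>R x)) x = of_real \<epsilon> * dd h \<eta> (\<epsilon> *\<^sub>R x)"
    by (metis scaleR_conv_of_real)
qed

text \<open>Ellipticity turns each derivative of the cut-off into a factor \<open>\<epsilon> / norm \<xi>\<close>.\<close>

lemma cutFT_decay:
  fixes U :: "real^'n::finite \<Rightarrow> complex^'m::finite"
  assumes w: "weak_null Dh U" and [measurable]: "U \<in> borel_measurable borel"
    and bd: "\<And>x. norm (U x) \<le> b"
    and ell: "0 < \<kappa>" "\<And>\<xi> e. \<kappa> * norm \<xi> * norm e \<le> norm (symbol Dh \<xi> *v e)"
    and \<eta>: "\<eta> \<in> ctest"
  shows "\<exists>K\<ge>0. \<forall>\<epsilon> \<xi>. 0 < \<epsilon> \<longrightarrow> \<xi> \<noteq> 0 \<longrightarrow>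
    norm (cutFT U (\<lambda>x. \<eta> (\<epsilon> *\<^sub>R x)) \<xi>) \<le> K * (\<epsilon> / norm \<xi>)^M / \<epsilon>^CARD('n)"
proof -
  have bd': "cmod (U x $ k) \<le> b" for x k
    by (rule order_trans[OF Finite_Cartesian_Product.norm_nth_le bd])
  show ?thesis
    using \<eta>
  \<comment> \<open>\<eta> is generalised because each step replaces it by its partial
    derivatives.\<close>
  proof (induction M arbitrary: \<eta>)
    case 0
    have [measurable]: "\<eta> \<in> borel_measurable borel" using 0 by (intro csmoothD ctest_csmooth)
    define I where "I = (\<integral>x. cmod (\<eta> x) \<partial>lborel)"
    have b0: "0 \<le> b" using order_trans[OF norm_ge_zero bd] .
    show ?case
    proof (intro exI[of _ "real CARD('m) * (b * I)"] conjI allI impI)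
      show "0 \<le> real CARD('m) * (b * I)" using b0 by (simp add: I_def)
      fix \<epsilon> :: real and \<xi> :: "real^'n" assume e: "0 < \<epsilon>"
      have i: "integrable lborel (\<lambda>x. cmod (\<eta> (\<epsilon> *\<^sub>R x)))"
        using ctest_integrable[OF ctest_affine[OF 0, of \<epsilon> 0]] e by (intro integrable_norm) simp
      \<comment> \<open>The factor \<epsilon>^(-n) is the growth of the volume of the support. It is
        the loss that the powers of \<epsilon> have to overcome.\<close>
      have I: "(\<integral>x. cmod (\<eta> (\<epsilon> *\<^sub>R x)) \<partial>lborel) = I / \<epsilon>^CARD('n)"
        using lborel_integral_affine[of "\<lambda>x. cmod (\<eta> x)" \<epsilon> 0] e by (simp add: I_def field_simps)
      have comp: "cmod (cutFT U (\<lambda>x. \<eta> (\<epsilon> *\<^sub>R x)) \<xi> $ k) \<le> b * I / \<epsilon>^CARD('n)" for k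
      proof -
        have "cmod (cutFT U (\<lambda>x. \<eta> (\<epsilon> *\<^sub>R x)) \<xi> $ k) \<le> (\<integral>x. b * cmod (\<eta> (\<epsilon> *\<^sub>R x)) \<partial>lborel)"
          unfolding cutFT_def vec_lambda_beta
        proof (rule order_trans[OF integral_norm_bound integral_mono])
          show "norm (cis (\<xi> \<bullet> x) * \<eta> (\<epsilon> *\<^sub>R x) * U x $ k) \<le> b * cmod (\<eta> (\<epsilon> *\<^sub>R x))" for x
            using bd'[of x k] unfolding norm_mult norm_cis
            by (simp add: mult.commute mult_right_mono)
          show "integrable lborel (\<lambda>x. b * cmod (\<eta> (\<epsilon> *\<^sub>R x)))" using i by simp
          show "integrable lborel (\<lambda>x. norm (cis (\<xi> \<bullet> x) * \<eta> (\<epsilon> *\<^sub>R x) * U x $ k))"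
            using ctest_affine[OF 0, of \<epsilon> 0] e bd'
            by (intro integrable_norm ctest_times_integrable ctest_mult csmooth_intros loc_integrable_bounded[of _ b]) auto
        qed
        then show ?thesis by (simp add: I)
      qed
      have "norm (cutFT U (\<lambda>x. \<eta> (\<epsilon> *\<^sub>R x)) \<xi>) \<le> (\<Sum>k\<in>UNIV. cmod (cutFT U (\<lambda>x. \<eta> (\<epsilon> *\<^sub>R x)) \<xi> $ k))"
        unfolding norm_vec_def by (rule L2_set_le_sum) auto
      also have "\<dots> \<le> (\<Sum>k\<in>(UNIV :: 'm set). b * I / \<epsilon>^CARD('n))"
        by (intro sum_mono comp)
      finally show "norm (cutFT U (\<lambda>x. \<eta> (\<epsilon> *\<^sub>R x)) \<xi>) \<le> real CARD('m) * (b * I) * (\<epsilon> / norm \<xi>)^0 / \<epsilon>^CARD('n)"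
        by simp
    qed
  next
    case (Suc M)
    have "\<forall>j. \<exists>K\<ge>0. \<forall>\<epsilon> \<xi>. 0 < \<epsilon> \<longrightarrow> \<xi> \<noteq> 0 \<longrightarrow>
      norm (cutFT U (\<lambda>x. dd (axis j 1) \<eta> (\<epsilon> *\<^sub>R x)) \<xi>) \<le> K * (\<epsilon> / norm \<xi>)^M / \<epsilon>^CARD('n)"
      using Suc.IH[OF ctest_dd[OF Suc.prems]] by blast
    then obtain K where K: "\<And>j. 0 \<le> K j" "\<And>j \<epsilon> \<xi>. 0 < \<epsilon> \<Longrightarrow> \<xi> \<noteq> 0 \<Longrightarrow>
      norm (cutFT U (\<lambda>x. dd (axis j 1) \<eta> (\<epsilon> *\<^sub>R x)) \<xi>) \<le> K j * (\<epsilon> / norm \<xi>)^M / \<epsilon>^CARD('n)"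
      by metis
    have "\<forall>j. \<exists>L\<ge>0. \<forall>e. norm (Dh j *v e) \<le> L * norm e"
      using norm_matrix_vector_bound by metis
    then obtain L where L: "\<And>j. 0 \<le> L j" "\<And>j e. norm (Dh j *v e) \<le> L j * norm e"
      by metis
    show ?case
    proof (intro exI[of _ "(\<Sum>j\<in>UNIV. L j * K j) / \<kappa>"] conjI allI impI)
      show "0 \<le> (\<Sum>j\<in>UNIV. L j * K j) / \<kappa>" using L K ell(1) by (intro divide_nonneg_pos sum_nonneg mult_nonneg_nonneg) auto
      fix \<epsilon> :: real and \<xi> :: "real^'n" assume e: "0 < \<epsilon>" and \<xi>: "\<xi> \<noteq> 0"
      let ?\<eta> = "\<lambda>x. \<eta> (\<epsilon> *\<^sub>R x)"
      have t: "?\<eta> \<in> ctest" using ctest_affine[OF Suc.prems, of \<epsilon> 0] e by simp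
      have sc: "cutFT U (\<lambda>x. of_real \<epsilon> * g x) \<xi> = of_real \<epsilon> *s cutFT U g \<xi>" for g
        by (simp add: cutFT_def vec_eq_iff mult.left_commute[of _ "of_real \<epsilon>"] mult.assoc)
      have ll: "loc_integrable (\<lambda>x. U x $ k)" for k
        using bd' by (intro loc_integrable_bounded[of _ b]) auto
      have "\<i> *s (symbol Dh \<xi> *v cutFT U ?\<eta> \<xi>) = - (\<Sum>j\<in>UNIV. Dh j *v cutFT U (dd (axis j 1) ?\<eta>) \<xi>)"
        using cutFT_identity[OF w ll t, of \<xi>] by (simp add: eq_neg_iff_add_eq_0)
      then have "norm (\<i> *s (symbol Dh \<xi> *v cutFT U ?\<eta> \<xi>)) = norm (\<Sum>j\<in>UNIV. Dh j *v cutFT U (dd (axis j 1) ?\<eta>) \<xi>)"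
        by simp
      then have "norm (symbol Dh \<xi> *v cutFT U ?\<eta> \<xi>) = norm (\<Sum>j\<in>UNIV. Dh j *v cutFT U (dd (axis j 1) ?\<eta>) \<xi>)"
        by simp
      also have "\<dots> \<le> (\<Sum>j\<in>UNIV. norm (Dh j *v cutFT U (dd (axis j 1) ?\<eta>) \<xi>))" by (rule norm_sum)
      also have "\<dots> \<le> (\<Sum>j\<in>UNIV. L j * (\<epsilon> * (K j * (\<epsilon> / norm \<xi>)^M / \<epsilon>^CARD('n))))"
      proof (rule sum_mono)
        fix j
        \<comment> \<open>The chain rule yields the new factor \<epsilon>; the induction hypothesis
          applies to the derivative of the unscaled \<eta>.\<close>
        have "norm (cutFT U (dd (axis j 1) ?\<eta>) \<xi>) \<le> \<epsilon> * (K j * (\<epsilon> / norm \<xi>)^M / \<epsilon>^CARD('n))"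
          unfolding dd_scaled[OF ctest_csmooth[OF Suc.prems]] sc
          using mult_left_mono[OF K(2)[OF e \<xi>, of j], of \<epsilon>] e by simp
        then show "norm (Dh j *v cutFT U (dd (axis j 1) ?\<eta>) \<xi>) \<le> L j * (\<epsilon> * (K j * (\<epsilon> / norm \<xi>)^M / \<epsilon>^CARD('n)))"
          using L by (meson mult_left_mono order_trans)
      qed
      also have "\<dots> = (\<Sum>j\<in>UNIV. L j * K j) * (\<epsilon> * (\<epsilon> / norm \<xi>)^M / \<epsilon>^CARD('n))"
        unfolding sum_distrib_right by (intro sum.cong) simp_all
      finally have "\<kappa> * norm \<xi> * norm (cutFT U ?\<eta> \<xi>) \<le> (\<Sum>j\<in>UNIV. L j * K j) * (\<epsilon> * (\<epsilon> / norm \<xi>)^M / \<epsilon>^CARD('n))"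
        using ell(2)[of \<xi> "cutFT U ?\<eta> \<xi>"] by linarith
      moreover have "0 < \<kappa> * norm \<xi>" using ell(1) \<xi> by simp
      ultimately have "norm (cutFT U ?\<eta> \<xi>) \<le> (\<Sum>j\<in>UNIV. L j * K j) * (\<epsilon> * (\<epsilon> / norm \<xi>)^M / \<epsilon>^CARD('n)) / (\<kappa> * norm \<xi>)"
        by (simp only: pos_le_divide_eq mult.commute)
      also have "\<dots> = (\<Sum>j\<in>UNIV. L j * K j) / \<kappa> * (\<epsilon> / norm \<xi>)^Suc M / \<epsilon>^CARD('n)"
        by (simp add: mult_ac)
      finally show "norm (cutFT U ?\<eta> \<xi>) \<le> (\<Sum>j\<in>UNIV. L j * K j) / \<kappa> * (\<epsilon> / norm \<xi>)^Suc M / \<epsilon>^CARD('n)" .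
    qed
  qed
qed

text \<open>A nonintegrable \<open>f\<close> has integral 0 by default, and \<open>g\<close> is
  nonnegative almost everywhere, so the bound holds in that case too.\<close>

lemma norm_integral_le_AE:
  fixes f :: "'a \<Rightarrow> 'b::{banach, second_countable_topology}"
  assumes g: "integrable M g" and le: "AE x in M. norm (f x) \<le> g x"
  shows "norm (\<integral>x. f x \<partial>M) \<le> (\<integral>x. g x \<partial>M)"
proof (cases "integrable M f")
  case True
  then show ?thesis
    using g le by (intro order_trans[OF integral_norm_bound integral_mono_AE]) auto
next
  case False
  have "AE x in M. 0 \<le> g x" using le by eventually_elim (metis norm_ge_zero order_trans)
  then show ?thesis using False by (simp add: not_integrable_integral_eq integral_nonneg_AE)
qed

text \<open>The bounded kernel \<open>h\<close> leaves f(x) g(y) h(x, y) integrable over the product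
  space. In the application \<open>h\<close> is the Fourier kernel.\<close>

lemma Fubini_product:
  fixes f :: "'a::euclidean_space \<Rightarrow> complex" and g :: "'b::euclidean_space \<Rightarrow> complex" and h :: "'a \<times> 'b \<Rightarrow> complex"
  assumes f: "integrable lborel f" and g: "integrable lborel g"
    and hm: "h \<in> borel_measurable borel" and h: "\<And>z. cmod (h z) \<le> 1"
  shows "(\<integral>x. f x * (\<integral>y. g y * h (x, y) \<partial>lborel) \<partial>lborel) = (\<integral>y. g y * (\<integral>x. f x * h (x, y) \<partial>lborel) \<partial>lborel)"
proof -
  have [measurable]: "f \<in> borel_measurable borel" "g \<in> borel_measurable borel"
    using f g borel_measurable_integrable by auto
  have [measurable]: "h \<in> borel_measurable (borel \<Otimes>\<^sub>M borel)"
    using hm by (simp add: borel_prod)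
  have m: "(\<lambda>(x, y). f x * g y * h (x, y)) \<in> borel_measurable (lborel \<Otimes>\<^sub>M lborel)"
    by measurable
  have iy: "integrable lborel (\<lambda>y. f x * g y * h (x, y))" for x
  proof (rule Bochner_Integration.integrable_bound)
    show "integrable lborel (\<lambda>y. f x * g y)" using g by simp
    show "AE y in lborel. norm (f x * g y * h (x, y)) \<le> norm (f x * g y)"
      using h by (intro AE_I2) (simp add: norm_mult mult_left_le)
    show "(\<lambda>y. f x * g y * h (x, y)) \<in> borel_measurable lborel" by measurable
  qed
  have i: "integrable lborel (\<lambda>x. \<integral>y. norm (f x * g y * h (x, y)) \<partial>lborel)"
  proof (rule Bochner_Integration.integrable_bound)
    show "integrable lborel (\<lambda>x. cmod (f x) * (\<integral>y. cmod (g y) \<partial>lborel))" using f by simp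
    show "(\<lambda>x. \<integral>y. norm (f x * g y * h (x, y)) \<partial>lborel) \<in> borel_measurable lborel"
      by (intro lborel.borel_measurable_lebesgue_integral) measurable
    have "(\<integral>y. norm (f x * g y * h (x, y)) \<partial>lborel) \<le> (\<integral>y. cmod (f x) * cmod (g y) \<partial>lborel)" for x
      using integrable_norm[OF iy] g h by (intro integral_mono) (auto simp: norm_mult mult_left_le)
    then show "AE x in lborel. norm (\<integral>y. norm (f x * g y * h (x, y)) \<partial>lborel) \<le> norm (cmod (f x) * (\<integral>y. cmod (g y) \<partial>lborel))"
      by (intro AE_I2) (simp add: abs_of_nonneg)
  qed
  have F: "integrable (lborel \<Otimes>\<^sub>M lborel) (\<lambda>(x, y). f x * g y * h (x, y))"
    using i iy by (intro lborel_pair.Fubini_integrable m) auto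
  have "f x * g y * h (x, y) = g y * (f x * h (x, y))" for x y by (simp add: mult_ac)
  then have "(\<integral>y. g y * (\<integral>x. f x * h (x, y) \<partial>lborel) \<partial>lborel) = (\<integral>y. (\<integral>x. f x * g y * h (x, y) \<partial>lborel) \<partial>lborel)"
    by (simp only: integral_mult_right_zero)
  also have "\<dots> = (\<integral>x. (\<integral>y. f x * g y * h (x, y) \<partial>lborel) \<partial>lborel)"
    by (rule lborel_pair.Fubini_integral) (use F in \<open>simp add: case_prod_beta'\<close>)
  also have "\<dots> = (\<integral>x. f x * (\<integral>y. g y * h (x, y) \<partial>lborel) \<partial>lborel)"
    by (simp only: integral_mult_right_zero mult.assoc)
  finally show "(\<integral>x. f x * (\<integral>y. g y * h (x, y) \<partial>lborel) \<partial>lborel) = (\<integral>y. g y * (\<integral>x. f x * h (x, y) \<partial>lborel) \<partial>lborel)" ..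
qed

lemma cis_inner_measurable:
  "(\<lambda>(\<xi>, x). cis (\<xi> \<bullet> x)) \<in> borel_measurable (borel :: ('a::euclidean_space \<times> 'a) measure)"
  unfolding case_prod_beta' by (intro borel_measurable_continuous_onI continuous_intros)

text \<open>The distributional Fourier transform of \<open>U\<close> is supported at the origin, so it vanishes on
  integrable \<open>\<psi>\<close> that are sufficiently flat there.\<close>

lemma weak_null_orthogonal:
  fixes U :: "real^'n::finite \<Rightarrow> complex^'m::finite"
  assumes w: "weak_null Dh U" and [measurable]: "U \<in> borel_measurable borel"
    and bd: "\<And>x. norm (U x) \<le> b"
    and ell: "0 < \<kappa>" "\<And>\<xi> e. \<kappa> * norm \<xi> * norm e \<le> norm (symbol Dh \<xi> *v e)"
    and \<psi>: "integrable lborel \<psi>" "integrable lborel \<beta>" "\<And>\<xi>. cmod (\<psi> \<xi>) \<le> norm \<xi>^(CARD('n) + 1) * \<beta> \<xi>"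
    and g: "\<And>x. g x = (\<integral>\<xi>. \<psi> \<xi> * cis (\<xi> \<bullet> x) \<partial>lborel)" "integrable lborel g"
  shows "(\<integral>x. g x * U x $ k \<partial>lborel) = 0"
proof -
  let ?b = "\<lambda>x::real^'n. complex_of_real (bump x)"
  have bt: "?b \<in> ctest" by (intro ctest_of_real bump_test)
  \<comment> \<open>Decay order n + 1: after the loss \<epsilon>^(-n) one power of \<epsilon>
    survives, and the matching negative power of |\<xi>| is absorbed by the flatness of
    \<psi>.\<close>
  obtain K where K: "0 \<le> K" "\<And>\<epsilon> \<xi>. 0 < \<epsilon> \<Longrightarrow> \<xi> \<noteq> 0 \<Longrightarrow>
    norm (cutFT U (\<lambda>x. ?b (\<epsilon> *\<^sub>R x)) \<xi>) \<le> K * (\<epsilon> / norm \<xi>)^(CARD('n) + 1) / \<epsilon>^CARD('n)"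
    using cutFT_decay[OF w _ bd ell bt, of "CARD('n) + 1"] by auto
  obtain Mb where Mb: "0 < Mb" "\<And>x. cmod (?b x) \<le> Mb" using ctest_bounded[OF bt] by blast
  have bm[measurable]: "(bump :: real^'n \<Rightarrow> real) \<in> borel_measurable borel"
    using bump_test by (auto simp: test_functions_iff intro!: borel_measurable_continuous_onI smoothD)
  have bd': "cmod (U x $ k) \<le> b" for x k
    by (rule order_trans[OF Finite_Cartesian_Product.norm_nth_le bd])
  define \<epsilon> where "\<epsilon> i = 1 / real (Suc i)" for i
  have \<epsilon>: "0 < \<epsilon> i" for i by (simp add: \<epsilon>_def)
  have \<epsilon>0: "\<epsilon> \<longlonglongrightarrow> 0"
    unfolding \<epsilon>_def using LIMSEQ_inverse_real_of_nat by (simp add: inverse_eq_divide)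
  have cism[measurable]: "cis \<in> borel_measurable borel"
    by (intro borel_measurable_continuous_onI continuous_intros)
  have nb: "norm (\<integral>x. ?b (\<epsilon> i *\<^sub>R x) * (g x * U x $ k) \<partial>lborel) \<le> K * (\<integral>\<xi>. \<beta> \<xi> \<partial>lborel) * \<epsilon> i" for i
  proof -
    have ib: "integrable lborel (\<lambda>x. ?b (\<epsilon> i *\<^sub>R x) * U x $ k)"
      using ctest_affine[OF bt, of "\<epsilon> i" 0] \<epsilon>[of i] bd'
      by (intro ctest_times_integrable loc_integrable_bounded[of _ b]) auto
    \<comment> \<open>Fubini moves the Fourier transform from \<psi> to the truncated
      \<open>U\<close>; the truncation is what makes that factor integrable.\<close>
    have "(\<integral>\<xi>. \<psi> \<xi> * (\<integral>x. ?b (\<epsilon> i *\<^sub>R x) * U x $ k * cis (\<xi> \<bullet> x) \<partial>lborel) \<partial>lborel)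
      = (\<integral>x. ?b (\<epsilon> i *\<^sub>R x) * U x $ k * (\<integral>\<xi>. \<psi> \<xi> * cis (\<xi> \<bullet> x) \<partial>lborel) \<partial>lborel)"
      using Fubini_product[OF \<psi>(1) ib, of "\<lambda>(\<xi>, x). cis (\<xi> \<bullet> x)"] cis_inner_measurable by auto
    then have "(\<integral>x. ?b (\<epsilon> i *\<^sub>R x) * (g x * U x $ k) \<partial>lborel) = (\<integral>\<xi>. \<psi> \<xi> * cutFT U (\<lambda>x. ?b (\<epsilon> i *\<^sub>R x)) \<xi> $ k \<partial>lborel)"
      by (simp add: g(1)[symmetric] cutFT_def mult_ac)
    also have "norm \<dots> \<le> (\<integral>\<xi>. K * \<epsilon> i * \<beta> \<xi> \<partial>lborel)"
    proof (rule norm_integral_le_AE)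
      show "integrable lborel (\<lambda>\<xi>. K * \<epsilon> i * \<beta> \<xi>)" using \<psi>(2) by simp
      have "cmod (\<psi> \<xi> * cutFT U (\<lambda>x. ?b (\<epsilon> i *\<^sub>R x)) \<xi> $ k) \<le> K * \<epsilon> i * \<beta> \<xi>" if \<xi>: "\<xi> \<noteq> 0" for \<xi>
      proof -
        have "cmod (\<psi> \<xi> * cutFT U (\<lambda>x. ?b (\<epsilon> i *\<^sub>R x)) \<xi> $ k) \<le> (norm \<xi>^(CARD('n) + 1) * \<beta> \<xi>) * (K * (\<epsilon> i / norm \<xi>)^(CARD('n) + 1) / \<epsilon> i^CARD('n))"
          unfolding norm_mult
          using \<psi>(3)[of \<xi>] order_trans[OF Finite_Cartesian_Product.norm_nth_le K(2)[OF \<epsilon> \<xi>]]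
          by (intro mult_mono) (auto intro: order_trans[OF norm_ge_zero])
        also have "\<dots> = K * \<epsilon> i * \<beta> \<xi>"
          using \<xi> \<epsilon>[of i] by (simp add: power_divide)
        finally show ?thesis .
      qed
      then show "AE \<xi> in lborel. norm (\<psi> \<xi> * cutFT U (\<lambda>x. ?b (\<epsilon> i *\<^sub>R x)) \<xi> $ k) \<le> K * \<epsilon> i * \<beta> \<xi>"
        by (rule eventually_mono[OF AE_lborel_singleton[of 0]])
    qed
    finally show ?thesis by (simp add: mult_ac)
  qed
  have "(\<lambda>i. K * (\<integral>\<xi>. \<beta> \<xi> \<partial>lborel) * \<epsilon> i) \<longlonglongrightarrow> 0"
    by (rule tendsto_mult_right_zero[OF \<epsilon>0])
  then have l0: "(\<lambda>i. \<integral>x. ?b (\<epsilon> i *\<^sub>R x) * (g x * U x $ k) \<partial>lborel) \<longlonglongrightarrow> 0"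
    by (rule Lim_null_comparison[OF always_eventually[OF allI[OF nb]]])
  \<comment> \<open>As \<epsilon> tends to 0 the cut-off tends pointwise to the constant
    \<open>bump 0\<close>, which is positive, so the vanishing limit is a positive multiple of the
    integral sought.\<close>
  have "(\<lambda>i. \<integral>x. ?b (\<epsilon> i *\<^sub>R x) * (g x * U x $ k) \<partial>lborel) \<longlonglongrightarrow> (\<integral>x. ?b 0 * (g x * U x $ k) \<partial>lborel)"
  proof (rule integral_dominated_convergence[where w = "\<lambda>x. Mb * (cmod (g x) * b)"])
    show "integrable lborel (\<lambda>x. Mb * (cmod (g x) * b))" using g(2) by simp
    have [measurable]: "g \<in> borel_measurable borel" using borel_measurable_integrable[OF g(2)] by simp
    show "(\<lambda>x. ?b 0 * (g x * U x $ k)) \<in> borel_measurable lborel"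
      "(\<lambda>x. ?b (\<epsilon> i *\<^sub>R x) * (g x * U x $ k)) \<in> borel_measurable lborel" for i by measurable
    show "AE x in lborel. norm (?b (\<epsilon> i *\<^sub>R x) * (g x * U x $ k)) \<le> Mb * (cmod (g x) * b)" for i
      unfolding norm_mult using Mb bd' by (intro AE_I2 mult_mono) (auto simp del: norm_of_real)
    have "isCont ?b 0" using csmoothD(3)[OF ctest_csmooth[OF bt], of UNIV] by (simp add: continuous_on_eq_continuous_at)
    then have "(\<lambda>i. ?b (\<epsilon> i *\<^sub>R x)) \<longlonglongrightarrow> ?b 0" for x
      using tendsto_scaleR[OF \<epsilon>0 tendsto_const[of x]] by (intro isCont_tendsto_compose[of 0 ?b]) auto
    then show "AE x in lborel. (\<lambda>i. ?b (\<epsilon> i *\<^sub>R x) * (g x * U x $ k)) \<longlonglongrightarrow> ?b 0 * (g x * U x $ k)"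
      by (intro AE_I2 tendsto_mult_right)
  qed
  with l0 have "?b 0 * (\<integral>x. g x * U x $ k \<partial>lborel) = 0"
    using LIMSEQ_unique by fastforce
  then show ?thesis using bump_0[where ?'a = 'n] by simp
qed

text \<open>\<open>flat_gauss k t\<close> is flat of order \<open>2 k\<close> at the origin, and its Fourier transform is a
  \<open>k\<close>-fold difference in \<open>t\<close> of Gaussians.\<close>

definition flat_gauss :: "nat \<Rightarrow> real \<Rightarrow> 'a::euclidean_space \<Rightarrow> real" where
  "flat_gauss k t \<xi> = gauss (sqrt t *\<^sub>R \<xi>) * (1 - gauss \<xi>)^k"

text \<open>The Gaussian of parameter \<open>t\<close> times the unit Gaussian is the Gaussian of
  parameter \<open>t + 1\<close>, so each factor 1 - gauss acts as a unit difference in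
  \<open>t\<close>.\<close>

lemma flat_gauss_Suc:
  "0 < t \<Longrightarrow> flat_gauss (Suc k) t \<xi> = flat_gauss k t \<xi> - flat_gauss k (t + 1) \<xi>"
proof -
  assume "0 < t"
  then have "gauss (sqrt (t + 1) *\<^sub>R \<xi>) = gauss (sqrt t *\<^sub>R \<xi>) * gauss \<xi>"
    by (simp add: gauss_def exp_add[symmetric] power_mult_distrib add_divide_distrib distrib_right)
  then show ?thesis by (simp add: flat_gauss_def algebra_simps)
qed

text \<open>Flatness of order \<open>k\<close> is recorded in a form valid for all \<xi>. With s =
  |\<xi>|^2 / 2, the number 1 - exp(-s) is at most s \<le> |\<xi>| inside the unit ball and at most
  1 \<le> |\<xi>| outside it.\<close>

lemma flat_gauss_bound:
  assumes "0 < t"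
  shows "\<bar>flat_gauss k t \<xi>\<bar> \<le> norm \<xi>^k * gauss (sqrt t *\<^sub>R \<xi>)"
proof -
  define s where "s = (norm \<xi>)\<^sup>2 / 2"
  have s: "0 \<le> s" by (simp add: s_def)
  have "1 - exp (- s) \<le> norm \<xi>"
  proof (cases "norm \<xi> \<le> 1")
    case True
    have "1 - exp (- s) \<le> s" using exp_ge_add_one_self[of "- s"] by simp
    also have "\<dots> \<le> norm \<xi>"
      using True mult_right_mono[OF True norm_ge_zero[of \<xi>]] norm_ge_zero[of \<xi>]
      unfolding s_def power2_eq_square by linarith
    finally show ?thesis .
  next
    case False
    then show ?thesis using exp_ge_zero[of "- s"] by linarith
  qed
  then have "(1 - gauss \<xi>)^k \<le> norm \<xi>^k"
    using gauss_le_1[of \<xi>] by (intro power_mono) (auto simp: gauss_def s_def)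
  moreover have "0 \<le> (1 - gauss \<xi>)^k" using gauss_le_1[of \<xi>] by simp
  ultimately show ?thesis
    using gauss_pos[of "sqrt t *\<^sub>R \<xi>"] by (simp add: flat_gauss_def abs_mult mult.commute mult_left_mono)
qed

lemma gauss_scaled_integrable: "0 < c \<Longrightarrow> integrable lborel (\<lambda>x::'a::euclidean_space. gauss (c *\<^sub>R x))"
  using lborel_integrable_affine[of "gauss :: 'a \<Rightarrow> real" c 0] gauss_integrable by simp

lemma flat_gauss_integrable: "0 < t \<Longrightarrow> integrable lborel (flat_gauss k t :: 'a::euclidean_space \<Rightarrow> real)"
proof (induction k arbitrary: t)
  case 0
  then show ?case using gauss_scaled_integrable[of "sqrt t"] by (simp add: flat_gauss_def[abs_def])
next
  case (Suc k)
  have "(flat_gauss (Suc k) t :: 'a \<Rightarrow> real) = (\<lambda>\<xi>. flat_gauss k t \<xi> - flat_gauss k (t + 1) \<xi>)"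
    using flat_gauss_Suc[OF Suc.prems] by (rule ext)
  then show ?case
    using Suc.IH[of t] Suc.IH[of "t + 1"] Suc.prems by simp
qed

definition flat_gauss_FT :: "nat \<Rightarrow> real \<Rightarrow> 'a::euclidean_space \<Rightarrow> complex" where
  "flat_gauss_FT k t x = (\<integral>\<xi>. of_real (flat_gauss k t \<xi>) * cis (\<xi> \<bullet> x) \<partial>lborel)"

lemma flat_gauss_cis_integrable:
  assumes "0 < t"
  shows "integrable lborel (\<lambda>\<xi>. of_real (flat_gauss k t \<xi>) * cis (\<xi> \<bullet> x))"
proof -
  have [measurable]: "cis \<in> borel_measurable borel"
    by (intro borel_measurable_continuous_onI continuous_intros)
  have [measurable]: "flat_gauss k t \<in> borel_measurable borel"
    using borel_measurable_integrable[OF flat_gauss_integrable[OF assms]] by simp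
  show ?thesis
    by (rule Bochner_Integration.integrable_bound[OF integrable_norm[OF flat_gauss_integrable[OF assms, of k]]])
      (auto simp: norm_mult)
qed

lemma flat_gauss_FT_Suc:
  assumes "0 < t"
  shows "flat_gauss_FT (Suc k) t x = flat_gauss_FT k t x - flat_gauss_FT k (t + 1) x"
  using assms flat_gauss_cis_integrable[of t k x] flat_gauss_cis_integrable[of "t + 1" k x]
  by (simp add: flat_gauss_FT_def flat_gauss_Suc left_diff_distrib)

lemma flat_gauss_FT_0:
  fixes x :: "'a::euclidean_space"
  assumes t: "0 < t"
  shows "flat_gauss_FT 0 t x = of_real ((sqrt (2 * pi) / sqrt t) ^ DIM('a) * gauss (x /\<^sub>R sqrt t))"
proof -
  have [measurable]: "cis \<in> borel_measurable borel"
    by (intro borel_measurable_continuous_onI continuous_intros)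
  have "flat_gauss_FT 0 t x = (\<integral>\<xi>. of_real (gauss (sqrt t *\<^sub>R \<xi>)) * cis (\<xi> \<bullet> x) \<partial>lborel)"
    by (simp add: flat_gauss_FT_def flat_gauss_def)
  also have "\<dots> = \<bar>1 / sqrt t\<bar>^DIM('a) *\<^sub>R (\<integral>\<xi>. of_real (gauss (sqrt t *\<^sub>R (0 + (1 / sqrt t) *\<^sub>R \<xi>))) * cis ((0 + (1 / sqrt t) *\<^sub>R \<xi>) \<bullet> x) \<partial>lborel)"
    using t by (intro lborel_integral_affine) auto
  also have "\<dots> = \<bar>1 / sqrt t\<bar>^DIM('a) *\<^sub>R (\<integral>\<xi>. cis (\<xi> \<bullet> (x /\<^sub>R sqrt t)) * of_real (gauss \<xi>) \<partial>lborel)"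
    using t by (simp add: divide_inverse mult.commute)
  also have "\<dots> = of_real ((sqrt (2 * pi) / sqrt t) ^ DIM('a) * gauss (x /\<^sub>R sqrt t))"
    using t unfolding cis_gauss_integral by (simp add: scaleR_conv_of_real power_divide)
  finally show ?thesis .
qed

lemma flat_gauss_FT_integrable: "0 < t \<Longrightarrow> integrable lborel (flat_gauss_FT k t :: 'a::euclidean_space \<Rightarrow> complex)"
proof (induction k arbitrary: t)
  case 0
  have "integrable lborel (\<lambda>x::'a. complex_of_real ((sqrt (2 * pi) / sqrt t) ^ DIM('a) * gauss (x /\<^sub>R sqrt t)))"
    using gauss_scaled_integrable[of "inverse (sqrt t)"] 0
    by (simp only: complex_of_real_integrable_eq) simp
  moreover have "(flat_gauss_FT 0 t :: 'a \<Rightarrow> complex) = (\<lambda>x. of_real ((sqrt (2 * pi) / sqrt t) ^ DIM('a) * gauss (x /\<^sub>R sqrt t)))"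
    using flat_gauss_FT_0[OF 0] by (rule ext)
  ultimately show ?case by (simp only:)
next
  case (Suc k)
  have "flat_gauss_FT (Suc k) t = (\<lambda>x::'a. flat_gauss_FT k t x - flat_gauss_FT k (t + 1) x)"
    using flat_gauss_FT_Suc[OF Suc.prems] by auto
  then show ?case using Suc.IH[of t] Suc.IH[of "t + 1"] Suc.prems by simp
qed

text \<open>\<open>H j t\<close> pairs a component of \<open>U\<close> with the Fourier transform of
  \<open>flat_gauss j t\<close>. For j = n + 1 it vanishes by flatness. If \<open>H (Suc j)\<close>
  vanishes, then \<open>H j\<close> has period 1 in \<open>t\<close>, while the decay of
  \<open>U\<close> makes it tend to 0 along t + i; so it vanishes as well. Finally
  \<open>H 0\<close> is a multiple of the average of \<open>U\<close> over a Gaussian of width sqrt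
  t, which tends to a multiple of \<open>U 0\<close> as t tends to 0.\<close>

lemma bounded_elliptic_Liouville:
  fixes U :: "real^'n::finite \<Rightarrow> complex^'m::finite"
  assumes w: "weak_null Dh U" and cont: "continuous_on UNIV U"
    and bd: "\<And>x. norm (U x) \<le> b" and lim: "(U \<longlongrightarrow> 0) at_infinity"
    and ell: "0 < \<kappa>" "\<And>\<xi> e. \<kappa> * norm \<xi> * norm e \<le> norm (symbol Dh \<xi> *v e)"
  shows "U 0 = 0"
proof -
  have [measurable]: "U \<in> borel_measurable borel" using cont by (rule borel_measurable_continuous_onI)
  have bd': "cmod (U x $ k) \<le> b" for x k
    by (rule order_trans[OF Finite_Cartesian_Product.norm_nth_le bd])
  have "U 0 $ k = 0" for k
  proof -
    define H where "H j t = (\<integral>x. flat_gauss_FT j t x * U x $ k \<partial>lborel)" for j t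
    have i: "integrable lborel (\<lambda>x. flat_gauss_FT j t x * U x $ k)" if "0 < t" for j t
    proof (rule Bochner_Integration.integrable_bound)
      show "integrable lborel (\<lambda>x::real^'n. cmod (flat_gauss_FT j t x) * b)"
        by (intro integrable_mult_left integrable_norm flat_gauss_FT_integrable that)
      have [measurable]: "(flat_gauss_FT j t :: real^'n \<Rightarrow> complex) \<in> borel_measurable borel"
        using borel_measurable_integrable[OF flat_gauss_FT_integrable[OF that]] by simp
      show "(\<lambda>x. flat_gauss_FT j t x * U x $ k) \<in> borel_measurable lborel" by measurable
      show "AE x in lborel. norm (flat_gauss_FT j t x * U x $ k) \<le> norm (cmod (flat_gauss_FT j t x) * b)"
        using bd' order_trans[OF norm_ge_zero bd] by (intro AE_I2) (auto simp: norm_mult intro!: mult_left_mono)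
    qed
    have HSuc: "H (Suc j) t = H j t - H j (t + 1)" if "0 < t" for j t
      using that i[OF that, of j] i[of "t + 1" j] by (simp add: H_def flat_gauss_FT_Suc left_diff_distrib)
    define G where "G s = (\<integral>y. of_real (gauss y) * U (s *\<^sub>R y) $ k \<partial>lborel)" for s
    \<comment> \<open>Rescaling by sqrt t turns the pairing into an average against a fixed
      Gaussian, from which both limits, t large and t small, follow by dominated
      convergence.\<close>
    have H0: "H 0 t = of_real (sqrt (2 * pi) ^ CARD('n)) * G (sqrt t)" if "0 < t" for t
    proof -
      have [measurable]: "(flat_gauss_FT 0 t :: real^'n \<Rightarrow> complex) \<in> borel_measurable borel"
        using borel_measurable_integrable[OF flat_gauss_FT_integrable[OF that]] by simp
      have "H 0 t = \<bar>sqrt t\<bar>^CARD('n) *\<^sub>R (\<integral>x. flat_gauss_FT 0 t (0 + sqrt t *\<^sub>R x) * U (0 + sqrt t *\<^sub>R x) $ k \<partial>lborel)"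
        unfolding H_def using that by (subst lborel_integral_affine[of _ "sqrt t" 0]) auto
      also have "(\<lambda>x. flat_gauss_FT 0 t (0 + sqrt t *\<^sub>R x) * U (0 + sqrt t *\<^sub>R x) $ k) =
        (\<lambda>x. of_real ((sqrt (2 * pi) / sqrt t) ^ CARD('n)) * (of_real (gauss x) * U (sqrt t *\<^sub>R x) $ k))"
        using that by (simp add: flat_gauss_FT_0 fun_eq_iff)
      finally show ?thesis
        using that by (simp add: G_def scaleR_conv_of_real power_divide)
    qed
    have gi: "integrable lborel (\<lambda>y::real^'n. b * gauss y)" by (intro integrable_mult_right gauss_integrable)
    have dom: "norm (of_real (gauss y) * U z $ k) \<le> b * gauss y" for y :: "real^'n" and z
      using bd'[of z k] gauss_pos[of y] by (simp add: norm_mult mult.commute mult_right_mono)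
    have Ginf: "(G \<longlongrightarrow> (\<integral>y. 0 \<partial>(lborel :: (real^'n) measure))) at_top"
      unfolding G_def
    proof (rule integral_dominated_convergence_at_top[where w = "\<lambda>y. b * gauss y"])
      show "AE y in lborel. ((\<lambda>s. of_real (gauss y) * U (s *\<^sub>R y) $ k) \<longlongrightarrow> 0) at_top"
      proof (rule eventually_mono[OF AE_lborel_singleton[of 0]])
        \<comment> \<open>For y \<noteq> 0 the points s y leave every ball, so the decay of
          \<open>U\<close> applies; the single point y = 0 is a null set.\<close>
        fix y :: "real^'n" assume y: "y \<noteq> 0"
        have "filterlim (\<lambda>s. s *\<^sub>R y) at_infinity at_top"
          unfolding filterlim_at_infinity[OF order_refl]
        proof (intro allI impI)
          fix r :: real assume "0 < r"
          show "\<forall>\<^sub>F s in at_top. r \<le> norm (s *\<^sub>R y)"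
            using eventually_ge_at_top[of "r / norm y"]
            by eventually_elim (use y \<open>0 < r\<close> in \<open>auto simp: field_simps abs_mult intro: order_trans[OF _ mult_right_mono[OF abs_ge_self]]\<close>)
        qed
        from filterlim_compose[OF lim this] have "((\<lambda>s. U (s *\<^sub>R y) $ k) \<longlongrightarrow> 0 $ k) at_top"
          by (rule tendsto_vec_nth)
        then show "((\<lambda>s. of_real (gauss y) * U (s *\<^sub>R y) $ k) \<longlongrightarrow> 0) at_top"
          by (intro tendsto_mult_right_zero) simp
      qed
    qed (use gi dom in auto)
    have Gzero: "((\<lambda>i. G (1 / real (Suc i))) \<longlonglongrightarrow> (\<integral>y. of_real (gauss y) * U 0 $ k \<partial>(lborel :: (real^'n) measure)))"
      unfolding G_def
    proof (rule integral_dominated_convergence[where w = "\<lambda>y. b * gauss y"])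
      show "AE y in lborel. (\<lambda>i. of_real (gauss y) * U ((1 / real (Suc i)) *\<^sub>R y) $ k) \<longlonglongrightarrow> of_real (gauss y) * U 0 $ k"
      proof (intro AE_I2 tendsto_mult_left tendsto_vec_nth)
        fix y :: "real^'n"
        have "(\<lambda>i. (1 / real (Suc i)) *\<^sub>R y) \<longlonglongrightarrow> 0 *\<^sub>R y"
          using LIMSEQ_inverse_real_of_nat by (intro tendsto_scaleR) (auto simp: inverse_eq_divide)
        then show "(\<lambda>i. U ((1 / real (Suc i)) *\<^sub>R y)) \<longlonglongrightarrow> U 0"
          using cont by (intro isCont_tendsto_compose[of 0 U]) (auto simp: continuous_on_eq_continuous_at)
      qed
    qed (use gi dom in auto)
    have Hlim: "(\<lambda>i. H j (t + real i)) \<longlonglongrightarrow> 0" if "0 < t" for j t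
      using that
    proof (induction j arbitrary: t)
      case 0
      have "filterlim (\<lambda>i. sqrt (t + real i)) at_top sequentially"
        by (intro filterlim_compose[OF sqrt_at_top] filterlim_tendsto_add_at_top[OF tendsto_const] filterlim_real_sequentially)
      from filterlim_compose[OF Ginf this] have "(\<lambda>i. of_real (sqrt (2 * pi) ^ CARD('n)) * G (sqrt (t + real i))) \<longlonglongrightarrow> 0"
        by (intro tendsto_mult_right_zero) simp
      then show ?case using 0 by (simp add: H0)
    next
      case (Suc j)
      have "(\<lambda>i. H j (t + real i) - H j (t + 1 + real i)) \<longlonglongrightarrow> 0 - 0"
        using Suc by (intro tendsto_diff Suc.IH) auto
      then show ?case using Suc.prems by (simp add: HSuc add_ac)
    qed
    have top: "H (CARD('n) + 1) t = 0" if t: "0 < t" for t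
      unfolding H_def
    proof (rule weak_null_orthogonal[OF w _ bd ell])
      show "integrable lborel (\<lambda>\<xi>::real^'n. complex_of_real (flat_gauss (CARD('n) + 1) t \<xi>))"
        unfolding complex_of_real_integrable_eq by (rule flat_gauss_integrable[OF t])
      show "integrable lborel (\<lambda>\<xi>::real^'n. gauss (sqrt t *\<^sub>R \<xi>))" using t by (intro gauss_scaled_integrable) simp
      show "cmod (complex_of_real (flat_gauss (CARD('n) + 1) t \<xi>)) \<le> norm \<xi>^(CARD('n) + 1) * gauss (sqrt t *\<^sub>R \<xi>)" for \<xi> :: "real^'n"
        using flat_gauss_bound[OF t, of "CARD('n) + 1" \<xi>] by (simp only: norm_of_real)
      show "integrable lborel (flat_gauss_FT (CARD('n) + 1) t :: real^'n \<Rightarrow> complex)"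
        by (rule flat_gauss_FT_integrable[OF t])
    qed (simp_all add: flat_gauss_FT_def)
    have down: "H j t = 0" if step: "\<And>t. 0 < t \<Longrightarrow> H (Suc j) t = 0" and t: "0 < t" for j t
    proof -
      have "H j (t + real i) = H j t" for i
      proof (induction i)
        case (Suc i)
        then show ?case using step[of "t + real i"] HSuc[of "t + real i" j] t by (simp add: add_ac)
      qed simp
      with Hlim[OF t, of j] show ?thesis by (simp add: LIMSEQ_const_iff)
    qed
    have all: "0 < t \<longrightarrow> H j t = 0" if "j \<le> CARD('n) + 1" for j t
      using that
    proof (induction j arbitrary: t rule: inc_induct)
      case base
      then show ?case using top by blast
    next
      case (step j)
      then show ?case using down by blast
    qed
    \<comment> \<open>The parameter t = (1 / (i + 1))^2 has the width sqrt t = 1 / (i + 1).\<close>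
    have "G (1 / real (Suc i)) = 0" for i
      using H0[of "(1 / real (Suc i))\<^sup>2"] all[of 0 "(1 / real (Suc i))\<^sup>2"] by (simp add: real_sqrt_divide)
    then have "(\<integral>y. of_real (gauss y) * U 0 $ k \<partial>(lborel :: (real^'n) measure)) = 0"
      using Gzero by (simp add: LIMSEQ_const_iff)
    then have "of_real (sqrt (2 * pi) ^ CARD('n)) * U 0 $ k = 0"
      by (simp add: gauss_integral)
    then show ?thesis by simp
  qed
  then show ?thesis by (simp add: vec_eq_iff)
qed

text \<open>The continuous functions min 1 (i dist(x, C)), with \<open>C\<close> the complement of
  the box, are supported in the box and increase to its indicator.\<close>

lemma integral_box_eq_0:
  fixes f :: "real^'n::finite \<Rightarrow> real"
  assumes f: "\<And>R. set_integrable lborel (cball 0 R) f"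
    and 0: "\<And>\<phi>. continuous_on UNIV \<phi> \<Longrightarrow> bounded {x. \<phi> x \<noteq> 0} \<Longrightarrow> (\<integral>x. \<phi> x * f x \<partial>lborel) = 0"
  shows "(LINT x:box a b|lborel. f x) = 0"
proof -
  obtain R where "\<forall>x\<in>box a b. norm x \<le> R"
    using bounded_box[of a b] unfolding bounded_iff by blast
  then have R: "box a b \<subseteq> cball 0 R" by (simp add: subset_iff)
  have i: "integrable lborel (\<lambda>x. indicator (cball 0 R) x *\<^sub>R f x)"
    using f by (simp add: set_integrable_def)
  define C where "C = - box a b"
  have "box a b \<noteq> UNIV"
    using bounded_box[of a b] not_bounded_UNIV by metis
  then have "- box a b \<noteq> {}" by (metis Compl_UNIV_eq double_compl)
  then have C: "closed C" "C \<noteq> {}"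
    by (auto simp: C_def)
  define \<phi> where "\<phi> i x = min 1 (real i * infdist x C)" for i x
  have \<phi>: "0 \<le> \<phi> i x" "\<phi> i x \<le> 1" for i x by (auto simp: \<phi>_def infdist_nonneg)
  have \<phi>0: "\<phi> i x = 0" if "x \<notin> box a b" for i x using that by (simp add: \<phi>_def C_def)
  have cont: "continuous_on UNIV (\<phi> i)" for i unfolding \<phi>_def by (intro continuous_intros)
  have [measurable]: "\<phi> i \<in> borel_measurable borel" for i using cont by (rule borel_measurable_continuous_onI)
  have eq: "\<phi> i x * f x = \<phi> i x * (indicator (cball 0 R) x *\<^sub>R f x)" for i x
    using \<phi>0[of x i] R by (cases "x \<in> box a b") auto
  have "(\<lambda>i. \<integral>x. \<phi> i x * f x \<partial>lborel) \<longlonglongrightarrow> (\<integral>x. indicator (box a b) x *\<^sub>R f x \<partial>lborel)"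
    unfolding eq
  proof (rule integral_dominated_convergence[where w = "\<lambda>x. \<bar>indicator (cball 0 R) x *\<^sub>R f x\<bar>"])
    have "(\<lambda>x. indicator (box a b) x *\<^sub>R f x) = (\<lambda>x. indicator (box a b) x *\<^sub>R (indicator (cball 0 R) x *\<^sub>R f x))"
      using R by (auto simp: indicator_def fun_eq_iff)
    then show "(\<lambda>x. indicator (box a b) x *\<^sub>R f x) \<in> borel_measurable lborel"
      using borel_measurable_integrable[OF i] by simp
    show "(\<lambda>x. \<phi> i x * (indicator (cball 0 R) x *\<^sub>R f x)) \<in> borel_measurable lborel" for i
      using borel_measurable_integrable[OF i] by measurable
    show "integrable lborel (\<lambda>x. \<bar>indicator (cball 0 R) x *\<^sub>R f x\<bar>)" using i by (rule integrable_abs)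
    show "AE x in lborel. norm (\<phi> i x * (indicator (cball 0 R) x *\<^sub>R f x)) \<le> \<bar>indicator (cball 0 R) x *\<^sub>R f x\<bar>" for i
      using \<phi>[of i] by (intro AE_I2) (simp add: abs_mult mult_left_le_one_le)
    show "AE x in lborel. (\<lambda>i. \<phi> i x * (indicator (cball 0 R) x *\<^sub>R f x)) \<longlonglongrightarrow> indicator (box a b) x *\<^sub>R f x"
    proof (rule AE_I2)
      fix x
      show "(\<lambda>i. \<phi> i x * (indicator (cball 0 R) x *\<^sub>R f x)) \<longlonglongrightarrow> indicator (box a b) x *\<^sub>R f x"
      proof (cases "x \<in> box a b")
        case True
        then have "infdist x C \<noteq> 0"
          using in_closed_iff_infdist_zero[OF C] by (auto simp: C_def)
        then have d: "0 < infdist x C" using infdist_nonneg[of x C] by simp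
        obtain k where k: "1 < real k * infdist x C"
          using reals_Archimedean3[OF d] by blast
        have "\<forall>\<^sub>F i in sequentially. \<phi> i x = 1"
          using eventually_ge_at_top[of k]
        proof eventually_elim
          case (elim i)
          then have "real k * infdist x C \<le> real i * infdist x C" using d by (intro mult_right_mono) auto
          with k show ?case by (simp add: \<phi>_def)
        qed
        then have "(\<lambda>i. \<phi> i x) \<longlonglongrightarrow> 1" by (rule tendsto_eventually)
        then have "(\<lambda>i. \<phi> i x * f x) \<longlonglongrightarrow> 1 * f x" by (intro tendsto_intros)
        then show ?thesis using True R by (auto simp: indicator_def)
      qed (simp add: \<phi>0)
    qed
  qed
  moreover have "(\<integral>x. \<phi> i x * f x \<partial>lborel) = 0" for i
  proof (rule 0[OF cont])
    have "{x. \<phi> i x \<noteq> 0} \<subseteq> box a b" using \<phi>0[of _ i] by blast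
    then show "bounded {x. \<phi> i x \<noteq> 0}" using bounded_box bounded_subset by blast
  qed
  ultimately show ?thesis by (simp add: set_lebesgue_integral_def LIMSEQ_const_iff)
qed

text \<open>Boxes are stable under intersection and generate the Borel sets, so vanishing on boxes
  spreads to all Borel sets. Restricting \<open>f\<close> to one box first makes it integrable, as
  complements and countable unions require.\<close>

lemma AE_eq_0_if_integral_boxes_0:
  fixes f :: "real^'n::finite \<Rightarrow> real"
  assumes f: "\<And>R. set_integrable lborel (cball 0 R) f"
    and 0: "\<And>a b. (LINT x:box a b|lborel. f x) = 0"
  shows "AE x in lborel. f x = 0"
proof -
  have *: "AE x in lborel. indicator (box a b) x * f x = 0" for a b
  proof -
    obtain R where "\<forall>x\<in>box a b. norm x \<le> R"
      using bounded_box[of a b] unfolding bounded_iff by blast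
    then have R: "box a b \<subseteq> cball 0 R" by (simp add: subset_iff)
    have sib: "set_integrable lborel (box a b) f"
      by (rule set_integrable_subset[OF f[of R] _ R]) simp
    define g where "g x = indicator (box a b) x * f x" for x
    have ig: "integrable lborel g" using sib by (simp add: set_integrable_def g_def[abs_def])
    have sig: "set_integrable lborel A g" if "A \<in> sets borel" for A
      using integrable_mult_indicator[OF _ ig, of A] that by (simp add: set_integrable_def)
    have g_UNIV: "(\<integral>x. g x \<partial>lborel) = 0"
      using 0[of a b] by (simp add: g_def set_lebesgue_integral_def)
    have G: "Int_stable (range (\<lambda>(a, b). box a b :: (real^'n) set))"
      by (auto simp: Int_stable_def box_Int_box)
    have "(LINT x:A|lborel. g x) = 0" if "A \<in> sets borel" for A
    proof -
      have subset_Pow_UNIV: "range (\<lambda>(a, b). box a b :: (real^'n) set) \<subseteq> Pow UNIV" by simp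
      have A: "A \<in> sigma_sets UNIV (range (\<lambda>(a, b). box a b))"
        using that by (simp add: borel_eq_box)
      have sb: "sigma_sets UNIV (range (\<lambda>(a, b). box a b)) = sets (borel :: (real^'n) measure)"
        by (simp add: borel_eq_box)
      show ?thesis
        using G subset_Pow_UNIV A
      proof (induction rule: sigma_sets_induct_disjoint)
        case (basic A)
        then obtain c d where A: "A = box c d" by auto
        obtain e k where "box c d \<inter> box a b = box e k" using box_Int_box[of c d a b] by blast
        then have "indicator (box c d) x *\<^sub>R g x = indicator (box e k) x *\<^sub>R f x" for x
          unfolding g_def by (auto simp: indicator_def split: if_splits)
        then show ?case using 0[of e k] by (simp add: A set_lebesgue_integral_def)
      next
        case (compl A)
        have A: "A \<in> sets borel" using compl(1) by (simp add: sb)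
        have "indicator (UNIV - A) x *\<^sub>R g x = g x - indicator A x *\<^sub>R g x" for x
          by (auto simp: indicator_def)
        then show ?case
          using sig[OF A] ig compl(2) g_UNIV by (simp add: set_lebesgue_integral_def set_integrable_def)
      next
        case (union A)
        then show ?case
          by (subst lebesgue_integral_countable_add) (auto simp: disjoint_family_on_def sb intro!: sig)
      qed (auto simp: set_lebesgue_integral_def)
    qed
    then have "AE x in lborel. g x = (\<lambda>_. 0) x"
      using ig by (intro density_unique_real) (auto simp: set_lebesgue_integral_def)
    then show ?thesis by (simp add: g_def)
  qed
  define c :: "nat \<Rightarrow> real^'n" where "c N = (\<chi> i. real N)" for N
  have "AE x in lborel. \<forall>N. indicator (box (- c N) (c N)) x * f x = 0"
    unfolding AE_all_countable by (intro allI *)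
  then show ?thesis
  proof eventually_elim
    case (elim x)
    obtain N where N: "norm x < real N" using reals_Archimedean2 by blast
    have "x \<in> box (- c N) (c N)"
      using component_le_norm_cart[of x] N by (auto simp: mem_box_cart c_def abs_less_iff intro: le_less_trans) (smt (verit) N)+
    then show ?case using elim[rule_format, of N] by simp
  qed
qed

lemma norm_powr_indicator_integrable:
  fixes u :: "'a::euclidean_space \<Rightarrow> 'b::real_normed_vector"
  assumes "integrable lborel (\<lambda>x. norm (u x) powr r)"
  shows "integrable lborel (\<lambda>x. indicat_real (cball a R) x * (s + t * norm (u x) powr r))"
proof -
  have "integrable lborel (\<lambda>x. s * indicat_real (cball a R) x + t * (indicat_real (cball a R) x *\<^sub>R norm (u x) powr r))"
    by (intro Bochner_Integration.integrable_add integrable_mult_right integrable_real_indicator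
        integrable_mult_indicator[OF _ assms])
       (simp_all add: emeasure_lborel_cball_finite[unfolded infinity_ennreal_def])
  then show ?thesis by (simp add: algebra_simps)
qed

text \<open>Where |v| > \<delta> one has |v| = |v|^(1 - r) |v|^r, and the first factor is at most
  \<delta>^(1 - r). The free parameter \<delta> later makes the first term uniformly small on balls
  of fixed radius.\<close>

lemma norm_le_add_powr:
  assumes "1 \<le> r" "0 < \<delta>"
  shows "norm v \<le> \<delta> + \<delta> powr (1 - r) * norm v powr r"
proof (cases "norm v \<le> \<delta>")
  case False
  then have "norm v powr (1 - r) \<le> \<delta> powr (1 - r)"
    using assms by (intro powr_mono2') auto
  then have "norm v powr (1 - r) * norm v powr r \<le> \<delta> powr (1 - r) * norm v powr r"
    by (intro mult_right_mono) auto
  moreover have "norm v powr (1 - r) * norm v powr r = norm v"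
    using False assms by (simp add: powr_add[symmetric])
  ultimately show ?thesis using assms by linarith
qed (use assms in \<open>auto intro: order_trans\<close>)

lemma norm_powr_loc_integrable:
  fixes u :: "real^'n::finite \<Rightarrow> complex^'m::finite"
  assumes [measurable]: "u \<in> borel_measurable borel" and r: "1 \<le> r"
    and ur: "integrable lborel (\<lambda>x. norm (u x) powr r)"
  shows "loc_integrable (\<lambda>x. u x $ k)"
  unfolding loc_integrable_def set_integrable_def
proof
  fix R
  have [measurable]: "cball (0 :: real^'n) R \<in> sets borel" by simp
  have [measurable]: "(\<lambda>x. u x $ k) \<in> borel_measurable borel" by measurable
  have le: "cmod (u x $ k) \<le> 1 + norm (u x) powr r" for x
    using order_trans[OF Finite_Cartesian_Product.norm_nth_le norm_le_add_powr[OF r, of 1 "u x"]] by simp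
  show "integrable lborel (\<lambda>x. indicat_real (cball 0 R) x *\<^sub>R (u x $ k))"
  proof (rule Bochner_Integration.integrable_bound[OF norm_powr_indicator_integrable[OF ur, of 0 R 1 1]])
    show "AE x in lborel. norm (indicat_real (cball 0 R) x *\<^sub>R (u x $ k)) \<le> norm (indicat_real (cball 0 R) x * (1 + 1 * norm (u x) powr r))"
      using le by (intro AE_I2) (auto simp: indicator_def)
  qed measurable
qed

text \<open>Mollification reduces the \<open>L\<^sup>r\<close> case to the bounded one.\<close>

lemma Lr_elliptic_Liouville:
  fixes u :: "real^'n::finite \<Rightarrow> complex^'m::finite"
  assumes um: "u \<in> borel_measurable borel" and r: "1 \<le> r"
    and ur: "integrable lborel (\<lambda>x. norm (u x) powr r)"
    and w: "weak_null Dh u"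
    and ell: "0 < \<kappa>" "\<And>\<xi> e. \<kappa> * norm \<xi> * norm e \<le> norm (symbol Dh \<xi> *v e)"
  shows "AE x in lborel. u x = 0"
proof -
  let ?W = "\<lambda>x. norm (u x) powr r"
  note [measurable] = um
  have ucm[measurable]: "(\<lambda>x. u x $ k) \<in> borel_measurable borel" for k by measurable
  have [measurable]: "cball a R \<in> sets borel" for a :: "real^'n" and R by simp
  have le: "norm (u x) \<le> \<delta> + \<delta> powr (1 - r) * ?W x" if "0 < \<delta>" for \<delta> x
    using r that by (rule norm_le_add_powr)
  have le1: "norm (u x) \<le> 1 + ?W x" for x using le[of 1 x] by simp
  have cle: "cmod (u x $ k) \<le> norm (u x)" for x k by (rule Finite_Cartesian_Product.norm_nth_le)
  note iind = norm_powr_indicator_integrable[OF ur]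
  have lu: "loc_integrable (\<lambda>x. u x $ k)" for k
    using um r ur by (rule norm_powr_loc_integrable)
  \<comment> \<open>The integral is the value at 0 of the convolution of \<phi> with
    \<open>u\<close>, called \<open>U\<close> below, which explains the reflected argument. The
    bounded theorem, applied to \<open>U\<close>, gives exactly this value.\<close>
  have test0: "integrable lborel (\<lambda>x. of_real (\<phi> (- x)) * u x $ k) \<and> (\<integral>x. of_real (\<phi> (- x)) * u x $ k \<partial>lborel) = 0"
    if cont: "continuous_on UNIV \<phi>" and bs: "bounded {x. \<phi> x \<noteq> 0}" for \<phi> :: "real^'n \<Rightarrow> real" and k
  proof -
    have [measurable]: "\<phi> \<in> borel_measurable borel" using cont by (rule borel_measurable_continuous_onI)
    obtain R where R: "0 < R" "\<And>x. R < norm x \<Longrightarrow> \<phi> x = 0"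
      using bs unfolding bounded_pos by (force simp: not_less[symmetric])
    have "bounded (\<phi> ` cball 0 R)"
      by (intro compact_imp_bounded compact_continuous_image continuous_on_subset[OF cont]) auto
    then obtain m where m0: "0 < m" "\<And>x. x \<in> cball 0 R \<Longrightarrow> \<bar>\<phi> x\<bar> \<le> m"
      by (auto simp: bounded_pos)
    have m: "\<bar>\<phi> x\<bar> \<le> m" for x
      using m0(2)[of x] R(2)[of x] m0(1) by (cases "norm x \<le> R") auto
    have pw: "cmod (of_real (\<phi> (a - x)) * u x $ k) \<le> m * (indicat_real (cball a R) x * norm (u x))" for a x k
    proof (cases "x \<in> cball a R")
      case True
      then show ?thesis using mult_mono[OF m cle] m0 by (simp add: norm_mult)
    next
      case False
      then show ?thesis using R(2)[of "a - x"] by (simp add: dist_norm)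
    qed
    define U where "U a = (\<chi> k. \<integral>x. of_real (\<phi> (a - x)) * u x $ k \<partial>lborel)" for a
    define V where "V = measure lborel (cball (0::real^'n) R)"
    define T where "T S = (\<integral>x. indicat_real {x. S < norm x} x * ?W x \<partial>lborel)" for S
    have i: "integrable lborel (\<lambda>x. of_real (\<phi> (a - x)) * u x $ k)" for a k
    proof (rule Bochner_Integration.integrable_bound[OF integrable_mult_right[OF iind[of a R 1 1], of m]])
      show "AE x in lborel. norm (of_real (\<phi> (a - x)) * u x $ k) \<le> norm (m * (indicat_real (cball a R) x * (1 + 1 * ?W x)))"
      proof (rule AE_I2)
        fix x
        have "m * (indicat_real (cball a R) x * norm (u x)) \<le> m * (indicat_real (cball a R) x * (1 + 1 * ?W x))"
          using m0(1) le1[of x] by (intro mult_left_mono) auto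
        then show "norm (of_real (\<phi> (a - x)) * u x $ k) \<le> norm (m * (indicat_real (cball a R) x * (1 + 1 * ?W x)))"
          using pw[of a x k] by simp
      qed
    qed measurable
    have nbound: "(\<integral>x. cmod (of_real (\<phi> (a - x)) * u x $ k) \<partial>lborel) \<le> m * (\<delta> * V + \<delta> powr (1 - r) * (\<integral>x. indicat_real (cball a R) x * ?W x \<partial>lborel))"
      if \<delta>: "0 < \<delta>" for a k \<delta>
    proof -
      have "(\<integral>x. cmod (of_real (\<phi> (a - x)) * u x $ k) \<partial>lborel) \<le> (\<integral>x. m * (indicat_real (cball a R) x * (\<delta> + \<delta> powr (1 - r) * ?W x)) \<partial>lborel)"
      proof (rule integral_mono_AE)
        show "integrable lborel (\<lambda>x. cmod (of_real (\<phi> (a - x)) * u x $ k))"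
          using i by (rule integrable_norm)
        show "integrable lborel (\<lambda>x. m * (indicat_real (cball a R) x * (\<delta> + \<delta> powr (1 - r) * ?W x)))"
          by (intro integrable_mult_right iind)
        show "AE x in lborel. norm (of_real (\<phi> (a - x)) * u x $ k) \<le> m * (indicat_real (cball a R) x * (\<delta> + \<delta> powr (1 - r) * ?W x))"
          using m0(1) le[OF \<delta>] by (intro AE_I2 order_trans[OF pw] mult_left_mono) auto
      qed
      also have "\<dots> = m * (\<integral>x. \<delta> * indicat_real (cball a R) x + \<delta> powr (1 - r) * (indicat_real (cball a R) x * ?W x) \<partial>lborel)"
        unfolding integral_mult_right_zero by (simp only: distrib_left mult.left_commute mult.commute)
      also have "\<dots> = m * (\<delta> * V + \<delta> powr (1 - r) * (\<integral>x. indicat_real (cball a R) x * ?W x \<partial>lborel))"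
      proof -
        have "integrable lborel (\<lambda>x. indicat_real (cball a R) x)" "integrable lborel (\<lambda>x. indicat_real (cball a R) x * ?W x)"
          using iind[of a R 1 0] iind[of a R 0 1] by auto
        moreover have "measure lborel (cball a R) = V"
          using R(1) by (simp add: V_def content_cball)
        ultimately show ?thesis by simp
      qed
      finally show ?thesis .
    qed
    have ubound: "cmod (U a $ k) \<le> m * (\<delta> * V + \<delta> powr (1 - r) * (\<integral>x. indicat_real (cball a R) x * ?W x \<partial>lborel))"
      if \<delta>: "0 < \<delta>" for a k \<delta>
      using nbound[OF that, of a k] unfolding U_def vec_lambda_beta by (rule order_trans[OF integral_norm_bound])
    have iT: "integrable lborel (\<lambda>x. indicat_real {x. S < norm x} x * ?W x)" for S
      using integrable_mult_indicator[OF _ ur, of "{x. S < norm x}"] by simp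
    have ball_le: "(\<integral>x. indicat_real (cball a R) x * ?W x \<partial>lborel) \<le> T S" if "S + R < norm a" for a S
      unfolding T_def
    proof (rule integral_mono[OF _ iT])
      show "integrable lborel (\<lambda>x. indicat_real (cball a R) x * ?W x)" using iind[of a R 0 1] by simp
      have "S < norm x" if "x \<in> cball a R" for x
        using that \<open>S + R < norm a\<close> norm_triangle_ineq2[of a x] by (simp add: dist_norm)
      then show "indicat_real (cball a R) x * ?W x \<le> indicat_real {x. S < norm x} x * ?W x" for x
        by (auto simp: indicator_def)
    qed
    have Tlim: "(\<lambda>i. T (real i)) \<longlonglongrightarrow> 0"
    proof -
      have "(\<lambda>i. T (real i)) \<longlonglongrightarrow> (\<integral>x. 0 \<partial>(lborel :: (real^'n) measure))"
        unfolding T_def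
      proof (rule integral_dominated_convergence[OF _ _ ur])
        show "AE x in lborel. (\<lambda>i. indicat_real {x. real i < norm x} x * ?W x) \<longlonglongrightarrow> 0"
        proof (intro AE_I2 tendsto_eventually)
          fix x
          obtain N where "norm (x::real^'n) < real N" using reals_Archimedean2 by blast
          then show "\<forall>\<^sub>F i in sequentially. indicat_real {x. real i < norm x} x * ?W x = 0"
            by (intro eventually_sequentiallyI[of N]) (auto simp: indicator_def)
        qed
        show "AE x in lborel. norm (indicat_real {x. real i < norm x} x * ?W x) \<le> ?W x" for i
          by (intro AE_I2) (auto simp: indicator_def)
      qed measurable
      then show ?thesis by simp
    qed
    have comp_lim: "((\<lambda>a. U a $ k) \<longlongrightarrow> 0) at_infinity" for k
    proof (rule tendstoI)
      fix e :: real assume e: "0 < e"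
      \<comment> \<open>\<delta> makes \<open>m * (\<delta> * V)\<close> at most e / 2. The other
        half is left to the mass of |u|^r outside a large ball. Adding 1 to \<open>V\<close> keeps
        the denominator positive.\<close>
      define \<delta> where "\<delta> = e / (2 * m * (V + 1))"
      have V: "0 \<le> V" by (simp add: V_def)
      have \<delta>: "0 < \<delta>" using e m0 V by (simp add: \<delta>_def)
      have "m * (\<delta> * V) = e / 2 * (V / (V + 1))" using m0 V by (simp add: \<delta>_def)
      also have "\<dots> \<le> e / 2 * 1" using e V by (intro mult_left_mono) auto
      finally have d1: "m * (\<delta> * V) \<le> e / 2" by simp
      have "(\<lambda>i. m * (\<delta> powr (1 - r) * T (real i))) \<longlonglongrightarrow> 0"
        using Tlim by (intro tendsto_mult_right_zero)
      then have "\<forall>\<^sub>F i in sequentially. m * (\<delta> powr (1 - r) * T (real i)) < e / 2"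
        using e by (intro order_tendstoD) auto
      then obtain i where i: "m * (\<delta> powr (1 - r) * T (real i)) < e / 2"
        by (auto simp: eventually_sequentially)
      show "\<forall>\<^sub>F a in at_infinity. dist (U a $ k) 0 < e"
        unfolding eventually_at_infinity
      proof (intro exI[of _ "real i + R + 1"] allI impI)
        fix a :: "real^'n" assume a: "real i + R + 1 \<le> norm a"
        have "m * (\<delta> powr (1 - r) * (\<integral>x. indicat_real (cball a R) x * ?W x \<partial>lborel)) \<le> m * (\<delta> powr (1 - r) * T (real i))"
          using a m0 by (intro mult_left_mono ball_le) auto
        then show "dist (U a $ k) 0 < e"
          using ubound[OF \<delta>, of a k] d1 i by (simp add: distrib_left)
      qed
    qed
    have lim: "(U \<longlongrightarrow> 0) at_infinity"
      using comp_lim by (intro vec_tendstoI) simp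
    define b where "b = m * (V + (\<integral>x. ?W x \<partial>lborel))"
    have nb: "(\<integral>x. cmod (of_real (\<phi> (a - x)) * u x $ k) \<partial>lborel) \<le> b" for a k
    proof -
      have "(\<integral>x. indicat_real (cball a R) x * ?W x \<partial>lborel) \<le> (\<integral>x. ?W x \<partial>lborel)"
        using iind[of a R 0 1] ur by (intro integral_mono) (auto simp: indicator_def)
      then have "m * (V + (\<integral>x. indicat_real (cball a R) x * ?W x \<partial>lborel)) \<le> b"
        unfolding b_def using m0(1) by (intro mult_left_mono add_left_mono) auto
      with nbound[of 1 a k] show ?thesis by simp
    qed
    have cb: "cmod (U a $ k) \<le> b" for a k
      using nb[of a k] unfolding U_def vec_lambda_beta by (rule order_trans[OF integral_norm_bound])
    have bd: "norm (U a) \<le> real CARD('m) * b" for a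
    proof -
      have "norm (U a) \<le> (\<Sum>k\<in>UNIV. cmod (U a $ k))"
        unfolding norm_vec_def by (rule L2_set_le_sum) auto
      also have "\<dots> \<le> (\<Sum>k\<in>(UNIV::'m set). b)" by (intro sum_mono cb)
      finally show ?thesis by simp
    qed
    \<comment> \<open>The sequence \<open>xs\<close> is bounded, so the translated kernels are
      supported in one common ball and a single integrable majorant serves for dominated
      convergence.\<close>
    have contU: "continuous_on UNIV U"
      unfolding continuous_on_sequentially
    proof (intro allI impI ballI)
      fix xs :: "nat \<Rightarrow> real^'n" and a assume "(\<forall>n. xs n \<in> UNIV) \<and> xs \<longlonglongrightarrow> a"
      then have xs: "xs \<longlonglongrightarrow> a" by simp
      then obtain S where S: "\<And>n. norm (xs n) \<le> S"
        using convergent_imp_Bseq[of xs] by (auto simp: convergent_def Bseq_def)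
      show "(U \<circ> xs) \<longlonglongrightarrow> U a"
        unfolding o_def
      proof (rule vec_tendstoI)
        fix k
        show "(\<lambda>n. U (xs n) $ k) \<longlonglongrightarrow> U a $ k"
          unfolding U_def vec_lambda_beta
        proof (rule integral_dominated_convergence[where w = "\<lambda>x. m * (indicat_real (cball 0 (S + R)) x * (1 + 1 * ?W x))"])
          show "integrable lborel (\<lambda>x. m * (indicat_real (cball 0 (S + R)) x * (1 + 1 * ?W x)))"
            by (intro integrable_mult_right iind)
          show "AE x in lborel. (\<lambda>n. of_real (\<phi> (xs n - x)) * u x $ k) \<longlonglongrightarrow> of_real (\<phi> (a - x)) * u x $ k"
            using cont xs
            by (intro AE_I2 tendsto_mult_right tendsto_of_real isCont_tendsto_compose[of _ \<phi>] tendsto_diff tendsto_const)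
               (auto simp: continuous_on_eq_continuous_at)
          show "AE x in lborel. norm (of_real (\<phi> (xs n - x)) * u x $ k) \<le> m * (indicat_real (cball 0 (S + R)) x * (1 + 1 * ?W x))" for n
          proof (rule AE_I2)
            fix x
            have "indicat_real (cball (xs n) R) x \<le> indicat_real (cball 0 (S + R)) x"
              using S[of n] norm_triangle_ineq2[of x "xs n"] by (auto simp: indicator_def dist_norm norm_minus_commute)
            then have "m * (indicat_real (cball (xs n) R) x * norm (u x)) \<le> m * (indicat_real (cball 0 (S + R)) x * (1 + 1 * ?W x))"
              using m0(1) le1[of x] by (intro mult_left_mono mult_mono) auto
            with pw[of "xs n" x k] show "norm (of_real (\<phi> (xs n - x)) * u x $ k) \<le> m * (indicat_real (cball 0 (S + R)) x * (1 + 1 * ?W x))"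
              by linarith
          qed
        qed measurable
      qed
    qed
    \<comment> \<open>The equation is translation invariant, so the convolution satisfies it: after
      Fubini, the inner integral for fixed \<open>y\<close> is the weak equation of \<open>u\<close>
      tested with a translate of \<eta>.\<close>
    have wU: "weak_null Dh U"
      unfolding weak_null_def
    proof (intro ballI allI)
      fix \<eta> :: "real^'n \<Rightarrow> real" and i0 assume \<eta>: "\<eta> \<in> test_functions"
      have sm: "smooth \<eta>" using \<eta> by (simp add: test_functions_iff)
      define d where "d j a = complex_of_real (dd (axis j 1) \<eta> a)" for j a
      have dt: "d j \<in> ctest" for j
        using ctest_dd[OF ctest_of_real[OF \<eta>], of "axis j 1"] unfolding d_def dd_of_real[OF sm, abs_def] .
      have [measurable]: "d j \<in> borel_measurable borel" for j using ctest_csmooth[OF dt] by (rule csmoothD)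
      have um': "(\<lambda>x. u x $ k) \<in> borel_measurable borel" for k by measurable
      define g where "g k a y = of_real (\<phi> y) * u (a - y) $ k" for k a y
      have gm[measurable]: "(\<lambda>(a, y). g k a y) \<in> borel_measurable (borel \<Otimes>\<^sub>M borel)" for k
        unfolding g_def by measurable
      have gaff: "g k a y = of_real (\<phi> (a - (a + (-1) *\<^sub>R y))) * u (a + (-1) *\<^sub>R y) $ k" for k a y
        by (simp add: g_def)
      have ig: "integrable lborel (g k a)" for k a
        unfolding gaff[abs_def] using i[of a k] by (subst lborel_integrable_affine) auto
      have Ug: "U a $ k = (\<integral>y. g k a y \<partial>lborel)" for a k
        unfolding gaff U_def vec_lambda_beta by (subst lborel_integral_affine[of _ "-1" a]) auto
      have ng: "(\<integral>y. cmod (g k a y) \<partial>lborel) \<le> b" for k a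
        using nb[of a k] unfolding gaff by (subst (asm) lborel_integral_affine[of _ "-1" a]) auto
      define F where "F a y = (\<Sum>j\<in>UNIV. \<Sum>k\<in>UNIV. Dh j $ i0 $ k * (d j a * g k a y))" for a y
      have iF1: "integrable (lborel \<Otimes>\<^sub>M lborel) (\<lambda>(a, y). d j a * g k a y)" for j k
      proof (rule lborel_pair.Fubini_integrable)
        show "(\<lambda>(a, y). d j a * g k a y) \<in> borel_measurable (lborel \<Otimes>\<^sub>M lborel)" by measurable
        show "AE a in lborel. integrable lborel (\<lambda>y. (\<lambda>(a, y). d j a * g k a y) (a, y))"
          using ig by (intro AE_I2) simp
        show "integrable lborel (\<lambda>a. \<integral>y. norm ((\<lambda>(a, y). d j a * g k a y) (a, y)) \<partial>lborel)"
        proof (rule Bochner_Integration.integrable_bound[OF integrable_mult_right[OF integrable_norm[OF ctest_integrable[OF dt[of j]]], of b]])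
          show "(\<lambda>a. \<integral>y. norm ((\<lambda>(a, y). d j a * g k a y) (a, y)) \<partial>lborel) \<in> borel_measurable lborel"
            by (intro lborel.borel_measurable_lebesgue_integral) measurable
          show "AE a in lborel. norm (\<integral>y. norm ((\<lambda>(a, y). d j a * g k a y) (a, y)) \<partial>lborel) \<le> norm (b * norm (d j a))"
          proof (rule AE_I2)
            fix a
            have "0 \<le> b" using order_trans[OF norm_ge_zero cb[of 0]] .
            then show "norm (\<integral>y. norm ((\<lambda>(a, y). d j a * g k a y) (a, y)) \<partial>lborel) \<le> norm (b * norm (d j a))"
              using mult_left_mono[OF ng[of k a] norm_ge_zero[of "d j a"]]
              by (simp add: norm_mult abs_mult mult.commute)
          qed
        qed
      qed
      have iF: "integrable (lborel \<Otimes>\<^sub>M lborel) (\<lambda>(a, y). F a y)"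
        using iF1 unfolding F_def case_prod_beta' by (intro Bochner_Integration.integrable_sum integrable_mult_right)
      have Fa: "(\<integral>y. F a y \<partial>lborel) = (\<Sum>j\<in>UNIV. \<Sum>k\<in>UNIV. Dh j $ i0 $ k * (d j a * U a $ k))" for a
        unfolding F_def Ug using ig by (simp add: Bochner_Integration.integral_sum)
      have Fy: "(\<integral>a. F a y \<partial>lborel) = 0" for y
      proof -
        have lin: "d j (y + x) = of_real (dd (axis j 1) (\<lambda>x. 1 * \<eta> (1 *\<^sub>R x + y)) x)" for j x
        proof -
          have "((\<lambda>x. \<eta> (x + y)) has_derivative (\<lambda>h. dd h \<eta> (x + y))) (at x)"
            by (rule has_derivative_compose[OF _ smoothD(4)[OF sm], of "\<lambda>x. x + y"]) (auto intro!: derivative_eq_intros)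
          from dd_eqI[OF this] show ?thesis by (simp add: d_def add.commute)
        qed
        have t: "(\<lambda>x. 1 * \<eta> (1 *\<^sub>R x + y)) \<in> test_functions"
          using ctest_affine[OF ctest_of_real[OF \<eta>], of 1 y] by (simp add: ctest_iff)
        have ix: "integrable lborel (\<lambda>x. d j (y + x) * u x $ k)" for j k
          using ctest_times_integrable[OF ctest_affine[OF dt[of j], of 1 y] lu[of k]] by (simp add: add.commute)
        have ia: "integrable lborel (\<lambda>a. d j a * u (a - y) $ k)" for j k
          using lborel_integrable_affine[of "\<lambda>a. d j a * u (a - y) $ k" 1 y] ix[of j k] by simp
        have ea: "(\<integral>a. d j a * u (a - y) $ k \<partial>lborel) = (\<integral>x. d j (y + x) * u x $ k \<partial>lborel)" for j k
          using lborel_integral_affine[of "\<lambda>a. d j a * u (a - y) $ k" 1 y] by simp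
        have Fe: "F a y = of_real (\<phi> y) * (\<Sum>j\<in>UNIV. \<Sum>k\<in>UNIV. Dh j $ i0 $ k * (d j a * u (a - y) $ k))" for a
          by (simp add: F_def g_def sum_distrib_left mult_ac)
        have "(\<integral>a. F a y \<partial>lborel) = of_real (\<phi> y) * (\<Sum>j\<in>UNIV. \<Sum>k\<in>UNIV. Dh j $ i0 $ k * (\<integral>a. d j a * u (a - y) $ k \<partial>lborel))"
          unfolding Fe using ia by (simp add: Bochner_Integration.integral_sum)
        also have "\<dots> = 0"
          using w t unfolding weak_null_def ea lin by simp
        finally show ?thesis .
      qed
      have "(\<Sum>j\<in>UNIV. \<Sum>k\<in>UNIV. Dh j $ i0 $ k * (\<integral>a. d j a * U a $ k \<partial>lborel)) = (\<integral>a. (\<integral>y. F a y \<partial>lborel) \<partial>lborel)"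
      proof -
        have "integrable lborel (\<lambda>a. d j a * U a $ k)" for j k
          using lborel_pair.integrable_fst[OF iF1[of j k]] by (simp add: Ug)
        then show ?thesis unfolding Fa by (simp add: Bochner_Integration.integral_sum)
      qed
      also have "\<dots> = (\<integral>y. (\<integral>a. F a y \<partial>lborel) \<partial>lborel)"
        by (rule lborel_pair.Fubini_integral[OF iF, symmetric])
      finally show "(\<Sum>j\<in>UNIV. \<Sum>k\<in>UNIV. Dh j $ i0 $ k * (\<integral>a. of_real (dd (axis j 1) \<eta> a) * U a $ k \<partial>lborel)) = 0"
        by (simp add: Fy d_def)
    qed
    have "U 0 = 0"
      by (rule bounded_elliptic_Liouville[OF wU contU bd lim ell])
    then have "U 0 $ k = 0" by simp
    then show ?thesis using i[of 0 k] by (simp add: U_def)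
  qed
  have comp: "AE x in lborel. Re (u x $ k) = 0 \<and> Im (u x $ k) = 0" for k
  proof -
    have si: "set_integrable lborel (cball 0 R) (\<lambda>x. u x $ k)" for R
      using lu[of k] by (simp add: loc_integrable_def)
    have i: "integrable lborel (\<lambda>x. of_real (\<phi> x) * u x $ k)" "(\<integral>x. of_real (\<phi> x) * u x $ k \<partial>lborel) = 0"
      if \<phi>: "continuous_on UNIV \<phi>" "bounded {x. \<phi> x \<noteq> 0}" for \<phi> :: "real^'n \<Rightarrow> real"
    proof -
      have "continuous_on UNIV (\<lambda>x. \<phi> (- x))"
        by (intro continuous_on_compose2[OF \<phi>(1)] continuous_intros) auto
      moreover have "{x. \<phi> (- x) \<noteq> 0} = uminus ` {x. \<phi> x \<noteq> 0}"
        by (auto simp: image_iff) (metis minus_minus)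
      then have "bounded {x. \<phi> (- x) \<noteq> 0}"
        using \<phi>(2) by (simp add: bounded_uminus)
      ultimately show "integrable lborel (\<lambda>x. of_real (\<phi> x) * u x $ k)" "(\<integral>x. of_real (\<phi> x) * u x $ k \<partial>lborel) = 0"
        using test0[of "\<lambda>x. \<phi> (- x)" k] by simp_all
    qed
    have "AE x in lborel. Re (u x $ k) = 0"
    proof (rule AE_eq_0_if_integral_boxes_0)
      show s: "set_integrable lborel (cball 0 R) (\<lambda>x. Re (u x $ k))" for R
        using integrable_Re[OF si[of R, unfolded set_integrable_def]] by (simp add: set_integrable_def)
      show "(LINT x:box a b|lborel. Re (u x $ k)) = 0" for a b
      proof (rule integral_box_eq_0[OF s])
        show "(\<integral>x. \<phi> x * Re (u x $ k) \<partial>lborel) = 0" if "continuous_on UNIV \<phi>" "bounded {x. \<phi> x \<noteq> 0}" for \<phi>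
          using integral_Re[OF i(1)[OF that]] i(2)[OF that] by simp
      qed
    qed
    moreover have "AE x in lborel. Im (u x $ k) = 0"
    proof (rule AE_eq_0_if_integral_boxes_0)
      show s: "set_integrable lborel (cball 0 R) (\<lambda>x. Im (u x $ k))" for R
        using integrable_Im[OF si[of R, unfolded set_integrable_def]] by (simp add: set_integrable_def)
      show "(LINT x:box a b|lborel. Im (u x $ k)) = 0" for a b
      proof (rule integral_box_eq_0[OF s])
        show "(\<integral>x. \<phi> x * Im (u x $ k) \<partial>lborel) = 0" if "continuous_on UNIV \<phi>" "bounded {x. \<phi> x \<noteq> 0}" for \<phi>
          using integral_Im[OF i(1)[OF that]] i(2)[OF that] by simp
      qed
    qed
    ultimately show ?thesis by eventually_elim simp
  qed
  then have "AE x in lborel. \<forall>k. Re (u x $ k) = 0 \<and> Im (u x $ k) = 0"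
    by (intro AE_all_countable[THEN iffD2] allI) auto
  then show ?thesis by eventually_elim (simp add: vec_eq_iff complex_eq_iff)
qed

section \<open>The operators in weak form\<close>

text \<open>Serves to pass from the vector-valued integrals of \<open>weak_D\<close> to the
  coordinate form of the equation.\<close>

lemma
  fixes f :: "'a \<Rightarrow> complex^'k"
  assumes i: "\<And>k. integrable M (\<lambda>x. f x $ k)"
  shows integrable_vecI: "integrable M f"
    and integral_vec_nth: "(\<integral>x. f x \<partial>M) $ k = (\<integral>x. f x $ k \<partial>M)"
proof -
  have "bounded_linear (\<lambda>c::complex. axis k c :: complex^'k)" for k
    by (intro linear_conv_bounded_linear[THEN iffD1] linearI) (auto simp: vec_eq_iff axis_def)
  then have "integrable M (\<lambda>x. axis k (f x $ k) :: complex^'k)" for k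
    by (rule integrable_bounded_linear[OF _ i])
  then have "integrable M (\<lambda>x. \<Sum>k\<in>UNIV. axis k (f x $ k) :: complex^'k)" by auto
  moreover have "(\<Sum>k\<in>UNIV. axis k (v $ k)) = v" for v :: "complex^'k"
    by (simp add: vec_eq_iff axis_def if_distrib cong: if_cong)
  ultimately show "integrable M f" by simp
  then show "(\<integral>x. f x \<partial>M) $ k = (\<integral>x. f x $ k \<partial>M)"
    by (rule integral_bounded_linear[OF bounded_linear_vec_nth, symmetric])
qed

lemma Lp_loc_integrable:
  assumes "1 \<le> p" "u \<in> Lp p"
  shows "loc_integrable (\<lambda>x. rep_vfun u x $ k)"
  using norm_powr_loc_integrable[OF rep_vfun_measurable assms(1) LpD[OF assms(2)]] .

lemma weak_D_iff_weak_sol: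
  assumes p: "1 \<le> p" and u: "u \<in> Lp p" and w: "w \<in> Lp p"
  shows "weak_D Dh u w \<longleftrightarrow> weak_sol Dh (rep_vfun u) (rep_vfun w)"
proof -
  have "(\<integral>x. \<phi> x *\<^sub>R rep_vfun w x \<partial>lborel) =
     (\<integral>x. (\<Sum>j\<in>UNIV. dd (axis j 1) \<phi> x *\<^sub>R (\<i> *s (Dh j *v rep_vfun u x))) \<partial>lborel) \<longleftrightarrow>
     (\<forall>i. (\<integral>x. of_real (\<phi> x) * rep_vfun w x $ i \<partial>lborel) =
     \<i> * (\<Sum>j\<in>UNIV. \<Sum>k\<in>UNIV. Dh j $ i $ k * (\<integral>x. of_real (dd (axis j 1) \<phi> x) * rep_vfun u x $ k \<partial>lborel)))"
    if \<phi>: "\<phi> \<in> test_functions" for \<phi>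
  proof -
    have sm: "smooth \<phi>" using \<phi> by (simp add: test_functions_iff)
    have iw: "integrable lborel (\<lambda>x. of_real (\<phi> x) * rep_vfun w x $ i)" for i
      by (intro ctest_times_integrable ctest_of_real \<phi> Lp_loc_integrable[OF p w])
    have iu: "integrable lborel (\<lambda>x. of_real (dd h \<phi> x) * rep_vfun u x $ k)" for h k
      using ctest_times_integrable[OF ctest_dd[OF ctest_of_real[OF \<phi>]] Lp_loc_integrable[OF p u, of k]]
      by (simp add: dd_of_real[OF sm])
    have eq: "(\<Sum>j\<in>UNIV. dd (axis j 1) \<phi> x *\<^sub>R (\<i> *s (Dh j *v rep_vfun u x))) $ i =
      \<i> * (\<Sum>j\<in>UNIV. \<Sum>k\<in>UNIV. Dh j $ i $ k * (of_real (dd (axis j 1) \<phi> x) * rep_vfun u x $ k))" for x i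
      by (simp add: matrix_vector_mult_def scaleR_conv_of_real[where 'a = complex] sum_distrib_left mult_ac)
    have "(\<integral>x. \<phi> x *\<^sub>R rep_vfun w x \<partial>lborel) $ i = (\<integral>x. of_real (\<phi> x) * rep_vfun w x $ i \<partial>lborel)" for i
      by (subst integral_vec_nth) (use iw in \<open>auto simp: scaleR_conv_of_real[where 'a = complex]\<close>)
    moreover have "(\<integral>x. (\<Sum>j\<in>UNIV. dd (axis j 1) \<phi> x *\<^sub>R (\<i> *s (Dh j *v rep_vfun u x))) \<partial>lborel) $ i =
      \<i> * (\<Sum>j\<in>UNIV. \<Sum>k\<in>UNIV. Dh j $ i $ k * (\<integral>x. of_real (dd (axis j 1) \<phi> x) * rep_vfun u x $ k \<partial>lborel))" for i
    proof -
      have "integrable lborel (\<lambda>x. (\<Sum>j\<in>UNIV. dd (axis j 1) \<phi> x *\<^sub>R (\<i> *s (Dh j *v rep_vfun u x))) $ i)" for i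
        unfolding eq using iu by (intro integrable_mult_right Bochner_Integration.integrable_sum)
      then have "(\<integral>x. (\<Sum>j\<in>UNIV. dd (axis j 1) \<phi> x *\<^sub>R (\<i> *s (Dh j *v rep_vfun u x))) \<partial>lborel) $ i =
        (\<integral>x. (\<Sum>j\<in>UNIV. dd (axis j 1) \<phi> x *\<^sub>R (\<i> *s (Dh j *v rep_vfun u x))) $ i \<partial>lborel)"
        by (rule integral_vec_nth)
      then show ?thesis unfolding eq using iu by (simp add: Bochner_Integration.integral_sum)
    qed
    ultimately show ?thesis by (simp add: vec_eq_iff)
  qed
  then show ?thesis unfolding weak_D_def weak_sol_def by blast
qed

text \<open>The representative of a class is determined only almost everywhere; this allows an
  explicit function in its place.\<close>

lemma weak_sol_cong_AE:
  assumes "AE x in lborel. U x = U' x" "AE x in lborel. W x = W' x"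
    and [measurable]: "U \<in> borel_measurable borel" "U' \<in> borel_measurable borel" "W \<in> borel_measurable borel" "W' \<in> borel_measurable borel"
  shows "weak_sol Dh U W \<longleftrightarrow> weak_sol Dh U' W'"
proof -
  have U: "(\<integral>x. of_real (dd h \<phi> x) * U x $ k \<partial>lborel) = (\<integral>x. of_real (dd h \<phi> x) * U' x $ k \<partial>lborel)"
    if "\<phi> \<in> test_functions" for \<phi> h k
  proof (rule integral_cong_AE)
    have [measurable]: "dd h \<phi> \<in> borel_measurable borel"
      using that by (intro borel_measurable_continuous_onI smoothD(3) smoothD(2)) (simp add: test_functions_iff)
    show "(\<lambda>x. of_real (dd h \<phi> x) * U x $ k) \<in> borel_measurable lborel"
      "(\<lambda>x. of_real (dd h \<phi> x) * U' x $ k) \<in> borel_measurable lborel" by measurable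
  qed (use assms(1) in \<open>eventually_elim, simp\<close>)
  have W: "(\<integral>x. of_real (\<phi> x) * W x $ k \<partial>lborel) = (\<integral>x. of_real (\<phi> x) * W' x $ k \<partial>lborel)"
    if "\<phi> \<in> test_functions" for \<phi> k
  proof (rule integral_cong_AE)
    have [measurable]: "\<phi> \<in> borel_measurable borel"
      using that by (intro borel_measurable_continuous_onI smoothD(3)) (simp add: test_functions_iff)
    show "(\<lambda>x. of_real (\<phi> x) * W x $ k) \<in> borel_measurable lborel"
      "(\<lambda>x. of_real (\<phi> x) * W' x $ k) \<in> borel_measurable lborel" by measurable
  qed (use assms(2) in \<open>eventually_elim, simp\<close>)
  show ?thesis unfolding weak_sol_def using U W by simp
qed

lemma weak_sol_zero: "weak_sol Dh (\<lambda>_. 0) (\<lambda>_. 0)"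
  by (simp add: weak_sol_def)

lemma zero_in_op_D:
  fixes Dh :: "'n::finite \<Rightarrow> complex^'m^'m::finite"
  assumes "1 \<le> p"
  shows "(0, 0) \<in> op_D Dh p"
proof -
  have "AE x in lborel. rep_vfun (0 :: ('n, 'm) vfun) x = 0" by (rule rep_zero_vfun)
  then have "weak_sol Dh (rep_vfun 0) (rep_vfun 0) \<longleftrightarrow> weak_sol Dh (\<lambda>_. 0) (\<lambda>_. 0)"
    by (intro weak_sol_cong_AE) auto
  then show ?thesis
    using assms by (simp add: op_D_def weak_D_iff_weak_sol weak_sol_zero)
qed

lemma matmult_zero:
  fixes B :: "real^'n::finite \<Rightarrow> complex^'m^'m::finite"
  assumes "B \<in> borel_measurable borel"
  shows "matmult B (0 :: ('n, 'm) vfun) = 0"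
proof (rule vfun_eqI)
  have "AE x in lborel. rep_vfun (0 :: ('n, 'm) vfun) x = 0" by (rule rep_zero_vfun)
  then show "AE x in lborel. rep_vfun (matmult B 0) x = rep_vfun (0 :: ('n, 'm) vfun) x"
    using rep_matmult[OF assms, of "0 :: ('n, 'm) vfun"] by eventually_elim simp
qed

lemma null_space_op_D_elliptic:
  fixes Dh :: "'n::finite \<Rightarrow> complex^'m^'m::finite"
  assumes p: "1 \<le> p" and ell: "0 < \<kappa>" "\<And>\<xi> e. \<kappa> * norm \<xi> * norm e \<le> norm (symbol Dh \<xi> *v e)"
    and u: "(u, 0) \<in> op_D Dh p"
  shows "u = 0"
proof -
  have L: "u \<in> Lp p" "weak_sol Dh (rep_vfun u) (rep_vfun 0)"
    using u p by (auto simp: op_D_def weak_D_iff_weak_sol)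
  have z: "AE x in lborel. rep_vfun (0 :: ('n, 'm) vfun) x = 0" by (rule rep_zero_vfun)
  then have "weak_sol Dh (rep_vfun u) (rep_vfun 0) \<longleftrightarrow> weak_sol Dh (rep_vfun u) (\<lambda>_. 0)"
    by (intro weak_sol_cong_AE) auto
  then have "AE x in lborel. rep_vfun u x = 0"
    using L by (intro Lr_elliptic_Liouville[OF _ p LpD _ ell]) (auto simp: weak_null_iff_weak_sol)
  with z have "AE x in lborel. rep_vfun u x = rep_vfun 0 x"
    by eventually_elim simp
  then show ?thesis by (rule vfun_eqI)
qed

text \<open>\<open>B\<close> is bounded below on the closure of the range of \<open>D\<close>, so B
  D u = 0 implies D u = 0.\<close>

lemma null_space_op_BD:
  assumes p: "0 < p" and B: "B_lower Dh B p" and u: "u \<in> null_space (op_BD Dh B p)"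
  shows "(u, 0) \<in> op_D Dh p"
proof -
  obtain w where w: "(u, w) \<in> op_D Dh p" "matmult B w = 0"
    using u by (auto simp: null_space_def op_BD_def)
  have wL: "w \<in> Lp p" using w by (simp add: op_D_def)
  obtain c where c: "0 < c" "\<And>u. u \<in> Lp_closure p (Range (op_D Dh p)) \<Longrightarrow> c * lpnorm p u \<le> lpnorm p (matmult B u)"
    using B by (auto simp: B_lower_def)
  have "Range (op_D Dh p) \<subseteq> Lp p" by (auto simp: op_D_def)
  then have "w \<in> Lp_closure p (Range (op_D Dh p))"
    using subset_Lp_closure w(1) by blast
  from c(2)[OF this] have "lpnorm p w = 0"
    using c(1) w(2) lpnorm_nonneg[of p w] by (simp add: mult_le_0_iff)
  then have "w = 0" using p wL by (intro lpnorm_eq_0D)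
  with w(1) show ?thesis by simp
qed

lemma null_space_op_DB:
  "u \<in> null_space (op_DB Dh B p) \<longleftrightarrow> u \<in> Lp p \<and> (matmult B u, 0) \<in> op_D Dh p"
  by (simp add: null_space_def op_DB_def)

text \<open>The p-th powers of |us k - u| tend to 0 in L1, and L1 convergence provides a subsequence
  that converges almost everywhere.\<close>

lemma Lp_lim_AE_subseq:
  assumes p: "1 \<le> p" and l: "Lp_lim p us u"
  obtains s :: "nat \<Rightarrow> nat" where "AE x in lborel. (\<lambda>k. rep_vfun (us (s k)) x) \<longlonglongrightarrow> rep_vfun u x"
proof -
  define d where "d k x = norm (rep_vfun (us k - u) x) powr p" for k x
  have L: "us k - u \<in> Lp p" for k
    using l p by (intro Lp_diff) (auto simp: Lp_lim_def)
  have id: "integrable lborel (d k)" for k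
    unfolding d_def by (rule LpD[OF L])
  have "(\<lambda>k. lpnorm p (us k - u) powr p) \<longlonglongrightarrow> 0 powr p"
    using l p by (intro tendsto_powr') (auto simp: Lp_lim_def)
  moreover have "lpnorm p (us k - u) powr p = (\<integral>x. norm (d k x) \<partial>lborel)" for k
    using p by (simp add: lpnorm_powr d_def)
  ultimately have "(\<lambda>k. \<integral>x. norm (d k x) \<partial>lborel) \<longlonglongrightarrow> 0" using p by simp
  from tendsto_L1_AE_subseq[OF id this] obtain s :: "nat \<Rightarrow> nat"
    where s: "AE x in lborel. (\<lambda>k. d (s k) x) \<longlonglongrightarrow> 0" by blast
  have "AE x in lborel. \<forall>k. rep_vfun (us k - u) x = rep_vfun (us k) x - rep_vfun u x"
    unfolding AE_all_countable by (intro allI rep_minus_vfun)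
  with s have "AE x in lborel. (\<lambda>k. rep_vfun (us (s k)) x) \<longlonglongrightarrow> rep_vfun u x"
  proof eventually_elim
    case (elim x)
    have "(\<lambda>k. (d (s k) x) powr (1 / p)) \<longlonglongrightarrow> 0 powr (1 / p)"
      using elim(1) p by (intro tendsto_powr') (auto simp: d_def)
    then have "(\<lambda>k. norm (rep_vfun (us (s k)) x - rep_vfun u x)) \<longlonglongrightarrow> 0"
      using p elim(2) by (simp add: d_def powr_powr)
    then have "(\<lambda>k. rep_vfun (us (s k)) x - rep_vfun u x) \<longlonglongrightarrow> 0"
      by (rule tendsto_norm_zero_cancel)
    then show ?case by (rule LIM_zero_cancel)
  qed
  then show thesis by (rule that)
qed

lemma kernel_range_decomposition_obtain:
  assumes "kernel_range_decomposition p T" "u \<in> Lp p"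
  obtains a b where "a \<in> null_space T" "b \<in> Lp_closure p (Range T)" "u = a + b"
proof -
  have "\<exists>!(a, b). a \<in> null_space T \<and> b \<in> Lp_closure p (Range T) \<and> u = a + b"
    using assms by (simp add: kernel_range_decomposition_def)
  from ex1_implies_ex[OF this] show thesis using that by auto
qed

text \<open>If \<open>BD\<close> is injective, the range of \<open>BD\<close> is dense, so \<open>B x\<close> is surjective for almost
  every \<open>x\<close>, hence injective.\<close>

lemma null_space_op_DB_trivial:
  fixes B :: "real^'n::finite \<Rightarrow> complex^'m^'m::finite"
  assumes p: "1 \<le> p" and B: "B \<in> borel_measurable borel"
    and kr: "kernel_range_decomposition p (op_BD Dh B p)"
    and BD: "null_space (op_BD Dh B p) = {0}"
    and D: "\<And>u. (u, 0) \<in> op_D Dh p \<Longrightarrow> u = 0"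
    and u: "u \<in> null_space (op_DB Dh B p)"
  shows "u = 0"
proof -
  have Bu: "matmult B u = 0"
    using u D by (auto simp: null_space_op_DB)
  have surj: "AE x in lborel. x \<in> cball 0 (real N) \<longrightarrow> axis i 1 \<in> range ((*v) (B x))" for i N
  proof -
    \<comment> \<open>A unit vector, constant on a ball, defines an element of L^p. As the null
      space of \<open>BD\<close> is trivial, the decomposition puts it into the closure of the
      range, so almost everywhere it is a limit of vectors in the range of
      \<open>B x\<close>.\<close>
    define g :: "real^'n \<Rightarrow> complex^'m" where "g x = indicat_real (cball 0 (real N)) x *\<^sub>R axis i 1" for x
    have cb: "cball (0::real^'n) (real N) \<in> sets borel" by simp
    have gm: "g \<in> borel_measurable borel"
      unfolding g_def using cb by (intro borel_measurable_scaleR borel_measurable_indicator) auto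
    have ga: "AE x in lborel. rep_vfun (abs_vfun g) x = g x" using gm by (rule rep_abs_vfun)
    have "abs_vfun g \<in> Lp p"
    proof -
      have "integrable lborel (\<lambda>x. norm (rep_vfun (abs_vfun g) x) powr p) \<longleftrightarrow> integrable lborel (\<lambda>x. indicat_real (cball (0::real^'n) (real N)) x)"
      proof (rule integrable_cong_AE)
        show "AE x in lborel. norm (rep_vfun (abs_vfun g) x) powr p = indicat_real (cball 0 (real N)) x"
          using ga by eventually_elim (auto simp: g_def indicator_def)
        show "(\<lambda>x. norm (rep_vfun (abs_vfun g) x) powr p) \<in> borel_measurable lborel"
          "(\<lambda>x. indicat_real (cball (0::real^'n) (real N)) x) \<in> borel_measurable lborel" using cb by measurable
      qed
      then show ?thesis
        by (simp add: Lp_def integrable_real_indicator emeasure_lborel_cball_finite[unfolded infinity_ennreal_def])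
    qed
    then obtain a b where ab: "a \<in> null_space (op_BD Dh B p)" "b \<in> Lp_closure p (Range (op_BD Dh B p))" "abs_vfun g = a + b"
      using kernel_range_decomposition_obtain[OF kr] by blast
    then have "abs_vfun g \<in> Lp_closure p (Range (op_BD Dh B p))" using BD by simp
    then obtain us where us: "\<And>k. us k \<in> Range (op_BD Dh B p)" "Lp_lim p us (abs_vfun g)"
      unfolding Lp_closure_def by blast
    have "\<forall>k. \<exists>w. us k = matmult B w" using us(1) by (auto simp: op_BD_def)
    then obtain w where w: "\<And>k. us k = matmult B (w k)" by metis
    obtain s :: "nat \<Rightarrow> nat" where s: "AE x in lborel. (\<lambda>k. rep_vfun (us (s k)) x) \<longlonglongrightarrow> rep_vfun (abs_vfun g) x"
      using Lp_lim_AE_subseq[OF p us(2)] by blast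
    have "AE x in lborel. \<forall>k. rep_vfun (us k) x = B x *v rep_vfun (w k) x"
      unfolding AE_all_countable w by (intro allI rep_matmult B)
    with s ga show ?thesis
    proof eventually_elim
      case (elim x)
      show ?case
      proof
        assume "x \<in> cball 0 (real N)"
        then have l: "(\<lambda>k. B x *v rep_vfun (w (s k)) x) \<longlonglongrightarrow> axis i 1"
          using elim by (simp add: g_def)
        have "linear ((*v) (B x))"
          by (auto simp: linear_iff matrix_vector_right_distrib) (simp add: matrix_vector_mult_def vec_eq_iff scaleR_sum_right)
        \<comment> \<open>The range of \<open>B x\<close> is a subspace of a finite-dimensional
          space, hence closed, and so contains the limit.\<close>
        then have "closed (range ((*v) (B x)))"
          by (intro closed_subspace linear_subspace_image) auto
        from closed_sequentially[OF this _ l] show "axis i 1 \<in> range ((*v) (B x))" by blast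
      qed
    qed
  qed
  have "AE x in lborel. \<forall>N i. x \<in> cball 0 (real N) \<longrightarrow> axis i 1 \<in> range ((*v) (B x))"
    unfolding AE_all_countable by (intro allI surj)
  moreover have "AE x in lborel. rep_vfun (0 :: ('n, 'm) vfun) x = 0" by (rule rep_zero_vfun)
  moreover note rep_matmult[OF B, of u]
  ultimately have "AE x in lborel. rep_vfun u x = rep_vfun 0 x"
    unfolding Bu
  proof eventually_elim
    case (elim x)
    obtain N where "norm x \<le> real N" using real_arch_simple by blast
    then have ax: "axis i 1 \<in> range ((*v) (B x))" for i using elim(1) by auto
    then obtain y where y: "\<And>i. axis i 1 = B x *v y i" unfolding image_iff by metis
    \<comment> \<open>Preimages of the unit vectors are the columns of a right inverse, which for a
      square matrix is also a left inverse.\<close>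
    have "B x ** (\<chi> k i. y i $ k) = mat 1"
    proof -
      have "(B x ** (\<chi> k i. y i $ k)) $ k $ i = (B x *v y i) $ k" for k i
        by (simp add: matrix_matrix_mult_def matrix_vector_mult_def)
      then show ?thesis by (simp add: vec_eq_iff y[symmetric] mat_def axis_def)
    qed
    then have "(\<chi> k i. y i $ k) ** B x = mat 1" by (simp add: matrix_left_right_inverse)
    moreover have "B x *v rep_vfun u x = 0" using elim by simp
    ultimately have "rep_vfun u x = 0"
      by (metis matrix_left_invertible_ker)
    then show ?case using elim by simp
  qed
  then show ?thesis by (rule vfun_eqI)
qed

section \<open>Dilations of a compactly supported solution\<close>

definition dilate :: "(real^'n::finite \<Rightarrow> complex^'m::finite) \<Rightarrow> real \<Rightarrow> ('n, 'm) vfun" where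
  "dilate v t = abs_vfun (\<lambda>x. v (t *\<^sub>R x))"

lemma ctest_vec_measurable:
  assumes "\<And>i. (\<lambda>x. v x $ i) \<in> ctest"
  shows "v \<in> borel_measurable borel" "continuous_on UNIV v"
proof -
  show c: "continuous_on UNIV v"
    using continuous_on_vec_lambda[of UNIV "\<lambda>i x. v x $ i", OF csmoothD(3)[OF ctest_csmooth[OF assms]]] by simp
  show "v \<in> borel_measurable borel" using c by (rule borel_measurable_continuous_onI)
qed

lemma rep_dilate:
  assumes v: "\<And>i. (\<lambda>x. v x $ i) \<in> ctest"
  shows "AE x in lborel. rep_vfun (dilate v t) x = v (t *\<^sub>R x)"
proof -
  have [measurable]: "v \<in> borel_measurable borel" by (rule ctest_vec_measurable[OF v])
  show ?thesis unfolding dilate_def by (rule rep_abs_vfun) measurable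
qed

text \<open>The constant \<open>a\<close> is the norm of \<open>v\<close> itself, positive because
  \<open>v\<close> is continuous and not identically 0. The power of \<open>t\<close> is the
  Jacobian of the dilation.\<close>

lemma lpnorm_dilate:
  fixes v :: "real^'n::finite \<Rightarrow> complex^'m::finite"
  assumes v: "\<And>i. (\<lambda>x. v x $ i) \<in> ctest" and v0: "v x0 \<noteq> 0" and p: "0 < p"
  obtains a where "0 < a" "\<And>t. 0 < t \<Longrightarrow> dilate v t \<in> Lp p \<and> lpnorm p (dilate v t) = a * t powr (- (real CARD('n) / p))"
proof -
  note vm[measurable] = ctest_vec_measurable(1)[OF v]
  define N where "N x = norm (v x) powr p" for x
  have cN: "continuous_on UNIV N"
    unfolding N_def using ctest_vec_measurable(2)[OF v] p by (intro continuous_on_powr' continuous_intros) auto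
  have Nm[measurable]: "N \<in> borel_measurable borel" using cN by (rule borel_measurable_continuous_onI)
  have "\<forall>i. \<exists>R. \<forall>x. R < norm x \<longrightarrow> v x $ i = 0" using ctest_supp[OF v] by metis
  then obtain R where R: "\<And>i x. R i < norm x \<Longrightarrow> v x $ i = 0" by metis
  define S where "S = Max (range R)"
  have S: "N x = 0" if "S < norm x" for x
  proof -
    have "R i \<le> S" for i unfolding S_def by (intro Max_ge) auto
    then have "v x $ i = 0" for i using R that by (meson le_less_trans)
    then have "v x = 0" by (simp add: vec_eq_iff)
    then show ?thesis using p by (simp add: N_def)
  qed
  have iN: "integrable lborel N"
  proof -
    have "integrable lborel (\<lambda>x. indicat_real (cball 0 S) x *\<^sub>R N x)"
      by (rule borel_integrable_compact) (auto intro: continuous_on_subset[OF cN])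
    moreover have "(\<lambda>x. indicat_real (cball 0 S) x *\<^sub>R N x) = N"
      using S by (auto simp: fun_eq_iff indicator_def not_le)
    ultimately show ?thesis by simp
  qed
  define I where "I = (\<integral>x. N x \<partial>lborel)"
  have "I \<noteq> 0"
  proof
    assume "I = 0"
    then have "N x0 = 0" using continuous_integral_eq_0[OF cN _ iN] by (simp add: I_def N_def)
    then show False using v0 p by (simp add: N_def)
  qed
  moreover have "0 \<le> I" unfolding I_def by (intro integral_nonneg_AE) (simp add: N_def)
  ultimately have I: "0 < I" by simp
  show thesis
  proof
    show "0 < I powr (1 / p)" using I by simp
    fix t :: real assume t: "0 < t"
    have ae: "AE x in lborel. norm (rep_vfun (dilate v t) x) powr p = N (t *\<^sub>R x)"
      using rep_dilate[OF v, of t] by eventually_elim (simp add: N_def)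
    have "integrable lborel (\<lambda>x. norm (rep_vfun (dilate v t) x) powr p) \<longleftrightarrow> integrable lborel (\<lambda>x. N (t *\<^sub>R x))"
      by (rule integrable_cong_AE) (use ae in auto)
    then have L: "dilate v t \<in> Lp p"
      using lborel_integrable_affine[of N t 0] iN t by (simp add: Lp_def)
    have "(\<integral>x. norm (rep_vfun (dilate v t) x) powr p \<partial>lborel) = (\<integral>x. N (t *\<^sub>R x) \<partial>lborel)"
      by (rule integral_cong_AE) (use ae in auto)
    also have "\<dots> = I * t powr (- real CARD('n))"
      using lborel_integral_affine[of N t 0] t by (simp add: I_def powr_minus powr_realpow field_simps)
    finally have "lpnorm p (dilate v t) = I powr (1 / p) * t powr (- (real CARD('n) / p))"
      using t I by (simp add: lpnorm_def powr_mult powr_powr)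
    with L show "dilate v t \<in> Lp p \<and> lpnorm p (dilate v t) = I powr (1 / p) * t powr (- (real CARD('n) / p))" ..
  qed
qed

lemma ctest_dilate:
  fixes v :: "real^'n::finite \<Rightarrow> complex^'m::finite"
  assumes "\<And>i. (\<lambda>x. v x $ i) \<in> ctest" "t \<noteq> 0"
  shows "(\<lambda>x. v (t *\<^sub>R x) $ i) \<in> ctest"
  using ctest_affine[of "\<lambda>x. v x $ i" t 0] assms by simp

lemma dd_dilate:
  assumes "\<And>i. (\<lambda>x. v x $ i) \<in> ctest"
  shows "dd h (\<lambda>x. v (t *\<^sub>R x) $ i) x = of_real t * dd h (\<lambda>x. v x $ i) (t *\<^sub>R x)"
  by (rule fun_cong[OF dd_scaled[OF ctest_csmooth[OF assms]]])

lemma integral_by_parts: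
  assumes f: "f \<in> ctest" and g: "g \<in> ctest"
  shows "(\<integral>x. dd h f x * g x \<partial>lborel) = - (\<integral>x. f x * dd h g x \<partial>lborel)"
proof -
  have "((\<lambda>x. f x * g x) has_derivative (\<lambda>h. f x * dd h g x + dd h f x * g x)) (at x)" for x
    by (intro has_derivative_mult csmoothD ctest_csmooth f g)
  from dd_eqI[OF this] have "dd h (\<lambda>x. f x * g x) x = f x * dd h g x + dd h f x * g x" for x .
  moreover have "(\<integral>x. dd h (\<lambda>x. f x * g x) x \<partial>lborel) = 0"
    by (intro integral_dd_eq_0 ctest_mult f ctest_csmooth g)
  moreover have "integrable lborel (\<lambda>x. f x * dd h g x)" "integrable lborel (\<lambda>x. dd h f x * g x)"
    by (intro ctest_integrable ctest_mult ctest_dd ctest_csmooth f g)+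
  ultimately show ?thesis by (simp add: eq_neg_iff_add_eq_0 add.commute)
qed

text \<open>The system is of first order with constant coefficients, so by the chain rule a dilation
  only multiplies it by \<open>t\<close>. Integration by parts turns the pointwise equation into the
  weak one.\<close>

lemma dilate_in_op_D:
  fixes v :: "real^'n::finite \<Rightarrow> complex^'m::finite"
  assumes v: "\<And>i. (\<lambda>x. v x $ i) \<in> ctest" and t: "0 < t" and p: "1 \<le> p" and L: "dilate v t \<in> Lp p"
    and sol: "\<And>x i. (\<Sum>j\<in>UNIV. \<Sum>k\<in>UNIV. Dh j $ i $ k * dd (axis j 1) (\<lambda>x. v x $ k) x) = 0"
  shows "(dilate v t, 0) \<in> op_D Dh p"
proof -
  let ?v = "\<lambda>x. v (t *\<^sub>R x)"
  have vt: "(\<lambda>x. ?v x $ k) \<in> ctest" for k using ctest_dilate[OF v] t by simp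
  have [measurable]: "v \<in> borel_measurable borel" by (rule ctest_vec_measurable[OF v])
  have "weak_sol Dh ?v (\<lambda>_. 0)"
    unfolding weak_sol_def
  proof (intro ballI allI)
    fix \<phi> :: "real^'n \<Rightarrow> real" and i assume \<phi>: "\<phi> \<in> test_functions"
    let ?\<phi> = "\<lambda>x. complex_of_real (\<phi> x)"
    have sm: "smooth \<phi>" using \<phi> by (simp add: test_functions_iff)
    have ibp: "(\<integral>x. of_real (dd h \<phi> x) * ?v x $ k \<partial>lborel) = - (\<integral>x. ?\<phi> x * dd h (\<lambda>x. ?v x $ k) x \<partial>lborel)" for h k
      using integral_by_parts[OF ctest_of_real[OF \<phi>] vt] by (simp add: dd_of_real[OF sm])
    have i: "integrable lborel (\<lambda>x. ?\<phi> x * dd h (\<lambda>x. ?v x $ k) x)" for h k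
      by (intro ctest_integrable ctest_mult ctest_of_real \<phi> ctest_csmooth ctest_dd vt)
    have "(\<Sum>j\<in>UNIV. \<Sum>k\<in>UNIV. Dh j $ i $ k * (\<integral>x. of_real (dd (axis j 1) \<phi> x) * ?v x $ k \<partial>lborel))
      = - (\<Sum>j\<in>UNIV. \<Sum>k\<in>UNIV. Dh j $ i $ k * (\<integral>x. ?\<phi> x * dd (axis j 1) (\<lambda>x. ?v x $ k) x \<partial>lborel))"
      unfolding ibp by (simp add: sum_negf)
    also have "(\<Sum>j\<in>UNIV. \<Sum>k\<in>UNIV. Dh j $ i $ k * (\<integral>x. ?\<phi> x * dd (axis j 1) (\<lambda>x. ?v x $ k) x \<partial>lborel))
      = (\<integral>x. (\<Sum>j\<in>UNIV. \<Sum>k\<in>UNIV. Dh j $ i $ k * (?\<phi> x * dd (axis j 1) (\<lambda>x. ?v x $ k) x)) \<partial>lborel)"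
      using i by (simp add: Bochner_Integration.integral_sum)
    also have "\<dots> = (\<integral>x. of_real t * ?\<phi> x * (\<Sum>j\<in>UNIV. \<Sum>k\<in>UNIV. Dh j $ i $ k * dd (axis j 1) (\<lambda>x. v x $ k) (t *\<^sub>R x)) \<partial>lborel)"
      by (simp add: dd_dilate[OF v] sum_distrib_left mult_ac)
    also have "\<dots> = 0" by (simp add: sol)
    finally show "(\<integral>x. of_real (\<phi> x) * 0 $ i \<partial>lborel) = \<i> * (\<Sum>j\<in>UNIV. \<Sum>k\<in>UNIV. Dh j $ i $ k * (\<integral>x. of_real (dd (axis j 1) \<phi> x) * ?v x $ k \<partial>lborel))"
      by simp
  qed
  moreover have "weak_sol Dh (rep_vfun (dilate v t)) (rep_vfun 0) \<longleftrightarrow> weak_sol Dh ?v (\<lambda>_. 0)"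
  proof (rule weak_sol_cong_AE)
    show "AE x in lborel. rep_vfun (dilate v t) x = ?v x" by (rule rep_dilate[OF v])
    show "AE x in lborel. rep_vfun (0 :: ('n, 'm) vfun) x = 0" by (rule rep_zero_vfun)
    show "?v \<in> borel_measurable borel" by measurable
  qed auto
  ultimately show ?thesis
    using p L by (simp add: op_D_def weak_D_iff_weak_sol)
qed

section \<open>Duality with the adjoint system\<close>

lemma det_cadjoint: "det (cadjoint A) = cnj (det A)"
proof -
  have "det (cadjoint A) = det (transpose (\<chi> i j. cnj (A $ i $ j)))"
    by (simp add: cadjoint_def transpose_def)
  also have "\<dots> = cnj (det A)"
    unfolding det_transpose by (simp add: det_def)
  finally show ?thesis .
qed

lemma symbol_cadjoint: "symbol (\<lambda>j. cadjoint (Dh j)) \<xi> = cadjoint (symbol Dh \<xi>)"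
  by (simp add: symbol_def cadjoint_def vec_eq_iff)

lemma dd_cnj:
  assumes "csmooth f"
  shows "dd h (\<lambda>x. cnj (f x)) x = cnj (dd h f x)"
  by (intro dd_eqI has_derivative_compose[OF csmoothD(1)[OF assms] bounded_linear_imp_has_derivative[OF bounded_linear_cnj]])

text \<open>The weak equation for \<open>(u, w)\<close> is tested with the conjugated components of
  the dilated field. Exchanging the sums turns the coefficients into those of the adjoint system,
  which annihilates the field.\<close>

lemma pairing_range_op_D:
  fixes v :: "real^'n::finite \<Rightarrow> complex^'m::finite"
  assumes v: "\<And>i. (\<lambda>x. v x $ i) \<in> ctest" and t: "0 < t" and p: "1 \<le> p" and uw: "(u, w) \<in> op_D Dh p"
    and sol: "\<And>x i. (\<Sum>j\<in>UNIV. \<Sum>k\<in>UNIV. cadjoint (Dh j) $ i $ k * dd (axis j 1) (\<lambda>x. v x $ k) x) = 0"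
  shows "pairing w (dilate v t) = 0"
proof -
  let ?c = "\<lambda>i x. cnj (v (t *\<^sub>R x) $ i)"
  have [measurable]: "v \<in> borel_measurable borel" by (rule ctest_vec_measurable[OF v])
  have c: "?c i \<in> ctest" for i using ctest_dilate[OF v] t by (intro ctest_cnj) simp
  have uL: "u \<in> Lp p" and wL: "w \<in> Lp p" and s: "weak_sol Dh (rep_vfun u) (rep_vfun w)"
    using uw p by (auto simp: op_D_def weak_D_iff_weak_sol)
  have iw: "integrable lborel (\<lambda>x. ?c i x * rep_vfun w x $ i)" for i
    by (intro ctest_times_integrable c Lp_loc_integrable[OF p wL])
  have iu: "integrable lborel (\<lambda>x. dd h (?c i) x * rep_vfun u x $ k)" for h i k
    by (intro ctest_times_integrable c ctest_dd Lp_loc_integrable[OF p uL])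
  have "pairing w (dilate v t) = (\<integral>x. (\<Sum>i\<in>UNIV. ?c i x * rep_vfun w x $ i) \<partial>lborel)"
    unfolding pairing_def
  proof (rule integral_cong_AE)
    show "AE x in lborel. (\<Sum>i\<in>UNIV. rep_vfun w x $ i * cnj (rep_vfun (dilate v t) x $ i)) = (\<Sum>i\<in>UNIV. ?c i x * rep_vfun w x $ i)"
      using rep_dilate[OF v, of t] by eventually_elim (simp add: mult.commute)
  qed measurable
  also have "\<dots> = (\<Sum>i\<in>UNIV. \<i> * (\<Sum>j\<in>UNIV. \<Sum>k\<in>UNIV. Dh j $ i $ k * (\<integral>x. dd (axis j 1) (?c i) x * rep_vfun u x $ k \<partial>lborel)))"
    using iw weak_sol_ctest[OF s Lp_loc_integrable[OF p uL] Lp_loc_integrable[OF p wL] c]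
    by (simp add: Bochner_Integration.integral_sum)
  also have "\<dots> = (\<integral>x. (\<Sum>i\<in>UNIV. \<i> * (\<Sum>j\<in>UNIV. \<Sum>k\<in>UNIV. Dh j $ i $ k * (dd (axis j 1) (?c i) x * rep_vfun u x $ k))) \<partial>lborel)"
    using iu by (simp add: Bochner_Integration.integral_sum)
  also have "\<dots> = (\<integral>x. 0 \<partial>(lborel :: (real^'n) measure))"
  proof (rule Bochner_Integration.integral_cong[OF refl])
    fix x :: "real^'n"
    have d: "dd (axis j 1) (?c i) x = of_real t * cnj (dd (axis j 1) (\<lambda>x. v x $ i) (t *\<^sub>R x))" for i j
    proof -
      have "csmooth (\<lambda>x. v (t *\<^sub>R x) $ i)" using ctest_dilate[OF v] t by (intro ctest_csmooth) simp
      then show ?thesis by (simp add: dd_cnj dd_dilate[OF v])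
    qed
    have "(\<Sum>i\<in>UNIV. \<Sum>j\<in>UNIV. \<Sum>k\<in>UNIV. Dh j $ i $ k * (dd (axis j 1) (?c i) x * rep_vfun u x $ k))
      = (\<Sum>k\<in>UNIV. \<Sum>j\<in>UNIV. \<Sum>i\<in>UNIV. Dh j $ i $ k * (dd (axis j 1) (?c i) x * rep_vfun u x $ k))"
      by (subst sum.swap, subst sum.swap[of _ UNIV UNIV]) (intro sum.cong refl sum.swap)
    also have "\<dots> = (\<Sum>k\<in>UNIV. of_real t * rep_vfun u x $ k * cnj (\<Sum>j\<in>UNIV. \<Sum>i\<in>UNIV. cadjoint (Dh j) $ k $ i * dd (axis j 1) (\<lambda>x. v x $ i) (t *\<^sub>R x)))"
      by (simp add: d cadjoint_def sum_distrib_left mult_ac)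
    also have "\<dots> = 0" by (simp only: sol) simp
    finally show "(\<Sum>i\<in>UNIV. \<i> * (\<Sum>j\<in>UNIV. \<Sum>k\<in>UNIV. Dh j $ i $ k * (dd (axis j 1) (?c i) x * rep_vfun u x $ k))) = 0"
      by (simp add: sum_distrib_left[symmetric])
  qed
  finally show ?thesis by simp
qed

text \<open>The value t = (K + 1)^(1/s) refutes the bound for either sign of \<open>s\<close>, so
  growth at infinity and growth at 0 are handled together.\<close>

lemma powr_not_bounded:
  fixes s :: real
  assumes "\<And>t. 0 < t \<Longrightarrow> t powr s \<le> K" "s \<noteq> 0"
  shows False
proof -
  have "1 \<le> K" using assms(1)[of 1] by simp
  then have "((K + 1) powr (1 / s)) powr s = K + 1" using assms(2) by (simp add: powr_powr)
  then show False using assms(1)[of "(K + 1) powr (1 / s)"] \<open>1 \<le> K\<close> by simp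
qed

theorem proposition3p22:
  fixes Dh :: "'n::finite \<Rightarrow> complex^'m^'m::finite"
    and B :: "real^'n \<Rightarrow> complex^'m^'m"
    and T :: "real \<Rightarrow> ('n, 'm) graph"
    and \<omega> \<nu> :: real and I2 I :: "real set"
    and f :: "complex \<Rightarrow> complex"
  assumes "standing_assumption Dh B \<omega>"
    and "is_I2 Dh B I2"
    and "is_I_DB Dh B \<omega> I2 I"
    and "T = op_DB Dh B \<or> T = op_BD Dh B"
    and "\<omega> < \<nu>" and "\<nu> < pi / 2"
    and "\<exists>r\<in>I. null_space (T r) \<noteq> {0}"
    and "f \<in> Hinf0 \<nu>" and "f 0 \<noteq> 0"
  shows "(\<forall>p\<in>I. \<forall>q\<in>I. p \<noteq> q \<longrightarrow>
            not_bounded_from (null_space (T p)) (lpnorm p) (Lp q) (lpnorm q)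
              (Hinf0_calc p (T p) \<omega> \<nu> f)) \<and>
         (\<forall>p\<in>I. \<forall>q\<in>I. p \<noteq> q \<longrightarrow>
            not_bounded_from (Lp p) (lpnorm p) (Lp q) (lpnorm q)
              (Hinf0_calc p (T p) \<omega> \<nu> f))"
proof -
  have adm: "D_admissible Dh" and Bm: "B \<in> borel_measurable borel" and \<omega>: "0 \<le> \<omega>"
    using assms(1) by (auto simp: standing_assumption_def Linf_matrix_def)
  have gi: "open_interval_2 I" "I \<subseteq> I2" "\<And>q. q \<in> I \<Longrightarrow> good_exponent (op_BD Dh B) \<omega> q \<and> good_exponent (op_DB Dh B) \<omega> q"
    using assms(3) by (auto simp: is_I_DB_def good_interval_def)
  have gt1: "1 < q" if "q \<in> I" for q using gi(1) that by (auto simp: open_interval_2_def)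
  have low: "B_lower Dh B q" if "q \<in> I" for q using assms(2) gi(2) that by (auto simp: is_I2_def)
  have gT: "good_exponent T \<omega> q" if "q \<in> I" for q using gi(3)[OF that] assms(4) by auto
  have BD0: "(0, 0) \<in> op_BD Dh B q" if "q \<in> I" for q
    using zero_in_op_D[of q Dh] gt1[OF that] matmult_zero[OF Bm] by (force simp: op_BD_def)
  have T0: "(0, 0) \<in> T q" if "q \<in> I" for q
    using assms(4) BD0[OF that] zero_in_op_D[of q Dh] gt1[OF that] by (auto simp: op_DB_def matmult_zero[OF Bm])
  have nL: "null_space (T q) \<subseteq> Lp q" for q
    using assms(4) by (auto simp: null_space_def op_DB_def op_BD_def op_D_def)
  \<comment> \<open>Here the nontrivial null space enters: one exponent \<open>r\<close> with N_r(T)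
    \<noteq> 0 rules out the elliptic alternative. The outcome concerns the symbol alone and
    therefore serves all exponents.\<close>
  have sing: "det (symbol Dh \<xi>) = 0" for \<xi>
  proof (rule ccontr)
    assume "det (symbol Dh \<xi>) \<noteq> 0"
    then obtain \<kappa> where ell: "0 < \<kappa>" "\<And>\<xi> e. \<kappa> * norm \<xi> * norm e \<le> norm (symbol Dh \<xi> *v e)"
      using symbol_singular_or_elliptic[OF adm] by blast
    obtain r where r: "r \<in> I" "null_space (T r) \<noteq> {0}" using assms(7) by blast
    have r1: "1 \<le> r" "0 < r" using gt1[OF r(1)] by auto
    have D: "u = 0" if "(u, 0) \<in> op_D Dh r" for u
      by (rule null_space_op_D_elliptic[OF r1(1) ell that])
    \<comment> \<open>Required for \<open>DB\<close> as well, whose injectivity rests on the density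
      of the range of \<open>BD\<close>.\<close>
    have BD: "null_space (op_BD Dh B r) = {0}"
      using D null_space_op_BD[OF r1(2) low[OF r(1)]] BD0[OF r(1)] by (auto simp: null_space_def)
    have "null_space (op_DB Dh B r) \<subseteq> {0}"
      using null_space_op_DB_trivial[OF r1(1) Bm _ BD D] gi(3)[OF r(1)] by (auto simp: good_exponent_def)
    with BD have "null_space (T r) \<subseteq> {0}" using assms(4) by auto
    moreover have "0 \<in> null_space (T r)" using T0[OF r(1)] by (simp add: null_space_def)
    ultimately show False using r(2) by blast
  qed
  \<comment> \<open>A continuous inclusion of the null space into L^q is refuted. The factor f(0) is
    divided out when this is applied.\<close>
  have main: False
    if pq: "p \<in> I" "q \<in> I" "p \<noteq> q"
      and in_Lq: "\<And>u. u \<in> null_space (T p) \<Longrightarrow> u \<in> Lp q"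
      and C: "0 \<le> C" "\<And>u. u \<in> null_space (T p) \<Longrightarrow> lpnorm q u \<le> C * lpnorm p u"
    for p q C
  proof -
    let ?n = "real CARD('n)"
    have p: "1 < p" "1 \<le> p" "0 < p" and q: "1 < q" "1 \<le> q" "0 < q" using gt1 pq by force+
    \<comment> \<open>In both cases all powers of \<open>t\<close> combine to this exponent, which
      is nonzero because \<open>p\<close> and \<open>q\<close> differ.\<close>
    have ex: "?n / p - ?n / q \<noteq> 0" using pq(3) p q by (simp add: field_simps)
    from assms(4) show False
    proof
      assume T: "T = op_BD Dh B"
      obtain v :: "real^'n \<Rightarrow> complex^'m" and x0 where v: "\<And>i. (\<lambda>x. v x $ i) \<in> ctest" "v x0 \<noteq> 0"
        "\<And>x i. (\<Sum>j\<in>UNIV. \<Sum>k\<in>UNIV. Dh j $ i $ k * dd (axis j 1) (\<lambda>x. v x $ k) x) = 0"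
        using singular_imp_test_solution[OF sing] by blast
      obtain a where a: "0 < a" "\<And>t. 0 < t \<Longrightarrow> dilate v t \<in> Lp p \<and> lpnorm p (dilate v t) = a * t powr (- (?n / p))"
        using lpnorm_dilate[OF v(1,2) p(3)] by blast
      obtain b where b: "0 < b" "\<And>t. 0 < t \<Longrightarrow> dilate v t \<in> Lp q \<and> lpnorm q (dilate v t) = b * t powr (- (?n / q))"
        using lpnorm_dilate[OF v(1,2) q(3)] by blast
      have "t powr (?n / p - ?n / q) \<le> C * a / b" if t: "0 < t" for t
      proof -
        have "(dilate v t, 0) \<in> op_D Dh p"
          using dilate_in_op_D[OF v(1) t p(2) _ v(3)] a(2)[OF t] by blast
        then have "dilate v t \<in> null_space (T p)"
          unfolding T null_space_def op_BD_def using matmult_zero[OF Bm] by force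
        from C(2)[OF this] have "b * t powr (- (?n / q)) \<le> C * (a * t powr (- (?n / p)))"
          using a(2)[OF t] b(2)[OF t] by simp
        then have "b * t powr (- (?n / q)) * t powr (?n / p) \<le> C * (a * t powr (- (?n / p))) * t powr (?n / p)"
          by (intro mult_right_mono) auto
        then have "b * t powr (?n / p - ?n / q) \<le> C * a"
          using t by (simp add: mult.assoc powr_add[symmetric])
        then show ?thesis using b(1) by (simp add: pos_le_divide_eq mult.commute)
      qed
      from powr_not_bounded[OF this ex] show False .
    next
      assume T: "T = op_DB Dh B"
      have "det (symbol (\<lambda>j. cadjoint (Dh j)) \<xi>) = 0" for \<xi>
        by (simp add: symbol_cadjoint det_cadjoint sing)
      then obtain v :: "real^'n \<Rightarrow> complex^'m" and x0 where v: "\<And>i. (\<lambda>x. v x $ i) \<in> ctest" "v x0 \<noteq> 0"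
        "\<And>x i. (\<Sum>j\<in>UNIV. \<Sum>k\<in>UNIV. cadjoint (Dh j) $ i $ k * dd (axis j 1) (\<lambda>x. v x $ k) x) = 0"
        using singular_imp_test_solution[of "\<lambda>j. cadjoint (Dh j)"] by blast
      define q' where "q' = conj_exp q"
      define p' where "p' = conj_exp p"
      have q': "0 < q'" "1 / q' = 1 - 1 / q" and p': "0 < p'"
        using p q by (auto simp: q'_def p'_def conj_exp_def field_simps)
      obtain a where a: "0 < a" "\<And>t. 0 < t \<Longrightarrow> dilate v t \<in> Lp p \<and> lpnorm p (dilate v t) = a * t powr (- (?n / p))"
        using lpnorm_dilate[OF v(1,2) p(3)] by blast
      obtain b where b: "0 < b" "\<And>t. 0 < t \<Longrightarrow> dilate v t \<in> Lp q' \<and> lpnorm q' (dilate v t) = b * t powr (- (?n / q'))"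
        using lpnorm_dilate[OF v(1,2) q'(1)] by blast
      obtain a' where a': "\<And>t. 0 < t \<Longrightarrow> dilate v t \<in> Lp p'"
        using lpnorm_dilate[OF v(1,2) p'] by blast
      obtain c where c: "0 < c" "\<And>t. 0 < t \<Longrightarrow> lpnorm 2 (dilate v t) = c * t powr (- (?n / 2))"
        using lpnorm_dilate[OF v(1,2), of 2] by (metis zero_less_numeral)
      have kr: "kernel_range_decomposition p (T p)" using gT[OF pq(1)] by (simp add: good_exponent_def)
      \<comment> \<open>The bound of the projection onto the null space depends on \<open>p\<close>
        and not on the dilation parameter.\<close>
      obtain M0 where M0: "\<And>x y. x \<in> null_space (T p) \<Longrightarrow> y \<in> Lp_closure p (Range (T p)) \<Longrightarrow> lpnorm p x \<le> M0 * lpnorm p (x + y)"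
        using kr unfolding kernel_range_decomposition_def by blast
      have "t powr (?n / p - ?n / q) \<le> C * M0 * a * b / c\<^sup>2" if t: "0 < t" for t
      proof -
        define g where "g = dilate v t"
        have gL: "g \<in> Lp p" "g \<in> Lp (conj_exp q)" "g \<in> Lp (conj_exp p)"
          using a(2)[OF t] b(2)[OF t] a'[OF t] by (auto simp: g_def q'_def p'_def)
        obtain x y where xy: "x \<in> null_space (T p)" "y \<in> Lp_closure p (Range (T p))" "g = x + y"
          using kernel_range_decomposition_obtain[OF kr gL(1)] by blast
        have xL: "x \<in> Lp p" "y \<in> Lp p" using nL xy Lp_closure_subset by blast+
        have "pairing w g = 0" if w: "w \<in> Range (T p)" for w
        proof -
          obtain u where "(matmult B u, w) \<in> op_D Dh p"
            using w by (auto simp: T op_DB_def)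
          then show ?thesis unfolding g_def by (rule pairing_range_op_D[OF v(1) t p(2) _ v(3)])
        qed
        then have "pairing y g = 0"
          by (rule pairing_Lp_closure_eq_0[OF p(1) _ gL(3) xy(2)])
        \<comment> \<open>Orthogonality to the range leaves only the null space component
          \<open>x\<close>. The assumed inclusion places it in L^q with controlled norm, which is
          all that Holder needs.\<close>
        then have "pairing g g = pairing x g"
          using pairing_add[OF p(1) xL gL(3)] xy(3) by simp
        then have "cmod (pairing g g) \<le> lpnorm q x * lpnorm q' g"
          using Holder_pairing[OF q(1) in_Lq[OF xy(1)] gL(2)] by (simp add: q'_def)
        also have "\<dots> \<le> (C * (M0 * lpnorm p g)) * lpnorm q' g"
        proof (rule mult_right_mono)
          have "lpnorm q x \<le> C * lpnorm p x" by (rule C(2)[OF xy(1)])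
          also have "\<dots> \<le> C * (M0 * lpnorm p g)"
            using M0[OF xy(1,2)] xy(3) C(1) by (intro mult_left_mono) auto
          finally show "lpnorm q x \<le> C * (M0 * lpnorm p g)" .
        qed simp
        also have "cmod (pairing g g) = (lpnorm 2 g)\<^sup>2"
        proof -
          have n2: "(\<Sum>i\<in>UNIV. z $ i * cnj (z $ i)) = of_real (norm z powr 2)" for z :: "complex^'m"
            by (simp add: norm_vec_def L2_set_def complex_norm_square[symmetric] real_sqrt_pow2 sum_nonneg)
          have "pairing g g = of_real (\<integral>x. norm (rep_vfun g x) powr 2 \<partial>lborel)"
            unfolding pairing_def n2 by (rule integral_complex_of_real)
          then have "pairing g g = of_real ((lpnorm 2 g)\<^sup>2)"
            using lpnorm_powr[of 2 g] by simp
          then show ?thesis by (simp only: norm_of_real) simp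
        qed
        finally have "(c * t powr (- (?n / 2)))\<^sup>2 \<le> (C * (M0 * (a * t powr (- (?n / p))))) * (b * t powr (- (?n / q')))"
          using a(2)[OF t] b(2)[OF t] c(2)[OF t] by (simp add: g_def)
        then have "(c * t powr (- (?n / 2)))\<^sup>2 * t powr (?n / p + ?n / q') \<le> (C * (M0 * (a * t powr (- (?n / p))))) * (b * t powr (- (?n / q'))) * t powr (?n / p + ?n / q')"
          by (intro mult_right_mono) auto
        also have "(c * t powr (- (?n / 2)))\<^sup>2 * t powr (?n / p + ?n / q') = c\<^sup>2 * t powr (?n / p + ?n / q' - ?n)"
          using t by (simp add: power_mult_distrib power2_eq_square mult.assoc powr_add[symmetric])
        also have "?n / p + ?n / q' - ?n = ?n / p - ?n / q"
        proof -
          have "?n / q' = ?n * (1 / q')" by simp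
          also have "\<dots> = ?n - ?n / q" unfolding q'(2) by (simp add: right_diff_distrib)
          finally show ?thesis by simp
        qed
        also have "(C * (M0 * (a * t powr (- (?n / p))))) * (b * t powr (- (?n / q'))) * t powr (?n / p + ?n / q') = C * M0 * a * b"
        proof -
          have "t powr (- (?n / p)) * t powr (- (?n / q')) * t powr (?n / p + ?n / q') = 1"
            using t by (simp add: powr_add[symmetric])
          then show ?thesis by (simp add: mult_ac)
        qed
        finally show ?thesis using c(1) by (simp add: pos_le_divide_eq mult.commute)
      qed
      from powr_not_bounded[OF this ex] show False .
    qed
  qed
  have N: "not_bounded_from (null_space (T p)) (lpnorm p) (Lp q) (lpnorm q) (Hinf0_calc p (T p) \<omega> \<nu> f)"
    if pq: "p \<in> I" "q \<in> I" "p \<noteq> q" for p q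
  proof (rule ccontr)
    have p: "1 \<le> p" "0 < p" and q: "0 < q" using gt1 pq by force+
    have calc: "Hinf0_calc p (T p) \<omega> \<nu> f u = cscale (f 0) u" if "u \<in> null_space (T p)" for u
      using gT[OF pq(1)] nL that
      by (intro Hinf0_calc_null_space[OF p(1) T0[OF pq(1)] _ _ \<omega> assms(5,6,8)]) (auto simp: good_exponent_def)
    assume "\<not> not_bounded_from (null_space (T p)) (lpnorm p) (Lp q) (lpnorm q) (Hinf0_calc p (T p) \<omega> \<nu> f)"
    then obtain C where C: "0 < C" "\<And>u. u \<in> null_space (T p) \<Longrightarrow> cscale (f 0) u \<in> Lp q"
      "\<And>u. u \<in> null_space (T p) \<Longrightarrow> lpnorm q (cscale (f 0) u) \<le> C * lpnorm p u"
      using calc by (auto simp: not_bounded_from_def)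
    show False
    proof (rule main[OF pq, of "C / cmod (f 0)"])
      show "0 \<le> C / cmod (f 0)" using C(1) by simp
      fix u assume u: "u \<in> null_space (T p)"
      have "u = cscale (1 / f 0) (cscale (f 0) u)" using assms(9) by simp
      then show "u \<in> Lp q" using Lp_cscale[OF q C(2)[OF u], of "1 / f 0"] by simp
      show "lpnorm q u \<le> C / cmod (f 0) * lpnorm p u"
        using C(3)[OF u] assms(9) q by (simp add: lpnorm_cscale field_simps)
    qed
  qed
  \<comment> \<open>Failure on the null space, a subset of L^p with the same norm, is failure on
    L^p.\<close>
  have "not_bounded_from (Lp p) (lpnorm p) (Lp q) (lpnorm q) (Hinf0_calc p (T p) \<omega> \<nu> f)"
    if pq: "p \<in> I" "q \<in> I" "p \<noteq> q" for p q
    using N[OF pq] nL[of p] unfolding not_bounded_from_def by blast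
  with N show ?thesis by blast
qed

end
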